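(* Let $K$ be a field, $R = K[x_0,\dots,x_n]$, and let $I\subset R$ be a homogeneous Artinian ideal such that $A := R/I$ has the Weak Lefschetz property and its Hilbert function satisfies, with $u_1,\dots,u_\ell$ as in the context and $d := u_1$, $$h_A(j) = \binom{n+j}{n}\quad\text{for all } j\le d = u_1 \le u_2-3$$ and $u_k+2\le u_{k+1}$ for all $k$ with $2\le k<\ell$. Then the graded Betti numbers of $A$ are $$ [\operatorname{tor}_i^R(A,K)]_{i+j} = \begin{cases} \binom{n+d}{i+d} & \text{if } j = d,\\ -\Delta h_A(u_k)\cdot\binom{n}{i-1} & \text{if } j = u_k-1,\\ 0 & \text{otherwise.} \end{cases} $$
   Context: A graded Artinian algebra $A=R/I$ has the Weak Lefschetz property if there is a linear form $g$ such that $\times g: A_i\to A_{i+1}$ has maximal rank for every $i$. Write $h_j = h_A(j)=\dim_K [A]_j$ for the Hilbert function, $\Delta h_A(j)=h_A(j)-h_A(j-1)$ for its first difference, and let $s$ be the largest degree with $h_s\neq 0$. For an algebra with the Weak Lefschetz property there are integers $u_1<u_2<\dots<u_\ell$ with $$h_0<h_1<\cdots<h_{u_1}=\cdots=h_{u_2-1}>h_{u_2}=\cdots=h_{u_3-1}>h_{u_3}=\cdots>h_{u_\ell}=\cdots=h_s>0.$$ Finally, $[\operatorname{tor}_i^R(A,K)]_j := \dim_K[\operatorname{Tor}_i^R(A,K)]_j$.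
   Formalization: The value for j = d is corrected to C(d+i-1,d)·C(n+d,i+d); the final drop to 0 at u_{ℓ+1} := s+1 is counted among the u_k, both in the formula and in the gap conditions (so u_ℓ+2 ≤ s+1 for ℓ ≥ 2, and d ≤ s-2 if ℓ = 1); only i ≥ 1 is treated. *)

theory Defs
  imports Complex_Main "HOL-Library.Poly_Mapping" "HOL-Library.Cardinality"
begin

text \<open>
  \<open>('x, 'k) poly_ring\<close> is the polynomial ring over \<open>'k\<close> whose variables are the elements of \<open>'x\<close>;
  a monomial is its exponent vector \<open>'x \<Rightarrow>\<^sub>0 nat\<close>.  The ring \<open>K[x\<^sub>0, \<dots>, x\<^sub>n]\<close> is obtained for
  \<open>CARD('x) = n + 1\<close>.
\<close>

type_synonym ('x, 'k) poly_ring = "('x \<Rightarrow>\<^sub>0 nat) \<Rightarrow>\<^sub>0 'k"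

definition scale :: "'r::comm_ring_1 \<Rightarrow> ('b \<Rightarrow>\<^sub>0 'r) \<Rightarrow> ('b \<Rightarrow>\<^sub>0 'r)" where
  "scale c = Poly_Mapping.map ((*) c)"

lemma lookup_scale [simp]: "Poly_Mapping.lookup (scale c v) b = c * Poly_Mapping.lookup v b"
  by (simp add: scale_def map.rep_eq when_def)

global_interpretation vs: vector_space "scale :: 'k::field \<Rightarrow> ('b \<Rightarrow>\<^sub>0 'k) \<Rightarrow> _"
  by unfold_locales (auto intro!: poly_mapping_eqI simp: lookup_add algebra_simps)

text \<open>The dimension of \<open>V/W\<close>, for \<open>W\<close> a subspace of a finite-dimensional space \<open>V\<close>.\<close>

definition qdim :: "('b \<Rightarrow>\<^sub>0 'k::field) set \<Rightarrow> ('b \<Rightarrow>\<^sub>0 'k) set \<Rightarrow> nat" where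
  "qdim V W = vs.dim V - vs.dim W"


section \<open>Graded quotients of the polynomial ring\<close>

definition mdeg :: "('x::finite \<Rightarrow>\<^sub>0 nat) \<Rightarrow> nat" where
  "mdeg t = (\<Sum>x\<in>UNIV. Poly_Mapping.lookup t x)"

definition forms :: "nat \<Rightarrow> ('x::finite, 'k::field) poly_ring set" where
  "forms j = {p. \<forall>t\<in>Poly_Mapping.keys p. mdeg t = j}"

definition hom_component :: "nat \<Rightarrow> ('x::finite, 'k::field) poly_ring \<Rightarrow> ('x, 'k) poly_ring" where
  "hom_component j p =
     (\<Sum>t | t \<in> Poly_Mapping.keys p \<and> mdeg t = j. Poly_Mapping.single t (Poly_Mapping.lookup p t))"

abbreviation is_ideal :: "'r::comm_ring_1 set \<Rightarrow> bool" where
  "is_ideal \<equiv> module.subspace (*)"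

definition homogeneous_ideal :: "('x::finite, 'k::field) poly_ring set \<Rightarrow> bool" where
  "homogeneous_ideal I \<longleftrightarrow> is_ideal I \<and> (\<forall>p\<in>I. \<forall>j. hom_component j p \<in> I)"

text \<open>
  The descending chain condition for ideals of \<open>R/I\<close>, expressed through the corresponding ideals
  of \<open>R\<close> that contain \<open>I\<close>.
\<close>

definition artinian_ideal :: "'r::comm_ring_1 set \<Rightarrow> bool" where
  "artinian_ideal I \<longleftrightarrow> is_ideal I \<and>
     (\<forall>J :: nat \<Rightarrow> 'r set. (\<forall>k. is_ideal (J k) \<and> I \<subseteq> J k \<and> J (Suc k) \<subseteq> J k)
        \<longrightarrow> (\<exists>N. \<forall>k\<ge>N. J k = J N))"

definition hilb :: "('x::finite, 'k::field) poly_ring set \<Rightarrow> nat \<Rightarrow> nat" where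
  "hilb I j = qdim (forms j) (I \<inter> forms j)"

definition delta_hilb :: "('x::finite, 'k::field) poly_ring set \<Rightarrow> nat \<Rightarrow> int" where
  "delta_hilb I j = int (hilb I j) - (if j = 0 then 0 else int (hilb I (j - 1)))"

text \<open>
  The rank of \<open>\<times>g : [R/I]\<^sub>j \<rightarrow> [R/I]\<^sub>j\<^sub>+\<^sub>1\<close> for a linear form \<open>g\<close>: the image is
  \<open>(g R\<^sub>j + I\<^sub>j\<^sub>+\<^sub>1) / I\<^sub>j\<^sub>+\<^sub>1\<close>.
\<close>

definition mult_rank ::
  "('x::finite, 'k::field) poly_ring set \<Rightarrow> ('x, 'k) poly_ring \<Rightarrow> nat \<Rightarrow> nat" where
  "mult_rank I g j =
     qdim {g * p + q | p q. p \<in> forms j \<and> q \<in> I \<inter> forms (j + 1)} (I \<inter> forms (j + 1))"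

definition weak_lefschetz :: "('x::finite, 'k::field) poly_ring set \<Rightarrow> bool" where
  "weak_lefschetz I \<longleftrightarrow>
     (\<exists>g\<in>forms 1. \<forall>j. mult_rank I g j = min (hilb I j) (hilb I (j + 1)))"

text \<open>
  The shape of the Hilbert function of an algebra with the Weak Lefschetz property:
  \<open>h\<^sub>0 < \<dots> < h\<^bsub>u 1\<^esub> = \<dots> = h\<^bsub>u 2 - 1\<^esub> > h\<^bsub>u 2\<^esub> = \<dots> > h\<^bsub>u l\<^esub> = \<dots> = h\<^sub>s > 0\<close>.  Here \<open>s\<close> is the
  largest degree with \<open>h\<^sub>s \<noteq> 0\<close>, and \<open>u (l + 1) = s + 1\<close> by convention, so that \<open>u 2, \<dots>, u (l + 1)\<close>
  are exactly the degrees \<open>j > 0\<close> with \<open>h\<^sub>j < h\<^sub>j\<^sub>-\<^sub>1\<close>, including the final drop to \<open>0\<close>.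
\<close>

definition hilb_shape ::
  "('x::finite, 'k::field) poly_ring set \<Rightarrow> nat \<Rightarrow> nat \<Rightarrow> (nat \<Rightarrow> nat) \<Rightarrow> bool" where
  "hilb_shape I s l u \<longleftrightarrow>
     hilb I s \<noteq> 0 \<and> (\<forall>j>s. hilb I j = 0) \<and>
     1 \<le> l \<and> u (l + 1) = s + 1 \<and> (\<forall>k\<in>{1..l}. u k < u (k + 1)) \<and>
     (\<forall>j<u 1. hilb I j < hilb I (j + 1)) \<and>
     (\<forall>k\<in>{1..l}. \<forall>j\<in>{u k..<u (k + 1)}. hilb I j = hilb I (u k)) \<and>
     (\<forall>k\<in>{2..l}. hilb I (u k) < hilb I (u k - 1))"


section \<open>Graded free resolutions and Tor\<close>

text \<open>
  A rank function \<open>r\<close> describes the graded free module \<open>\<Oplus>\<^sub>m R(-m)\<^bsup>r m\<^esup>\<close>; its basis consists of the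
  pairs \<open>(m, k)\<close> with \<open>k < r m\<close>, and \<open>(m, k)\<close> has degree \<open>m\<close>.  There may be infinitely many
  basis elements, but only finitely many in each degree.
\<close>

definition basis :: "(nat \<Rightarrow> nat) \<Rightarrow> (nat \<times> nat) set" where
  "basis r = {(m, k). k < r m}"

definition free_mod :: "(nat \<Rightarrow> nat) \<Rightarrow> (nat \<times> nat \<Rightarrow>\<^sub>0 'r::zero) set" where
  "free_mod r = {v. Poly_Mapping.keys v \<subseteq> basis r}"

definition free_mod_part ::
  "(nat \<Rightarrow> nat) \<Rightarrow> nat \<Rightarrow> (nat \<times> nat \<Rightarrow>\<^sub>0 ('x::finite, 'k::field) poly_ring) set" where
  "free_mod_part r m =
     {v \<in> free_mod r. \<forall>b\<in>Poly_Mapping.keys v.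
        fst b \<le> m \<and> Poly_Mapping.lookup v b \<in> forms (m - fst b)}"

text \<open>The linear map out of a free module which sends each basis element \<open>b\<close> to \<open>f b\<close>.\<close>

definition lin_ext :: "('b \<Rightarrow> ('c \<Rightarrow>\<^sub>0 'r::comm_ring_1)) \<Rightarrow> ('b \<Rightarrow>\<^sub>0 'r) \<Rightarrow> ('c \<Rightarrow>\<^sub>0 'r)" where
  "lin_ext f v = (\<Sum>b\<in>Poly_Mapping.keys v. scale (Poly_Mapping.lookup v b) (f b))"

definition lin_form :: "('b \<Rightarrow> 'r) \<Rightarrow> ('b \<Rightarrow>\<^sub>0 'r) \<Rightarrow> 'r::comm_ring_1" where
  "lin_form f v = (\<Sum>b\<in>Poly_Mapping.keys v. Poly_Mapping.lookup v b * f b)"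

text \<open>
  Data of a graded free resolution \<open>\<dots> \<rightarrow> F\<^sub>1 \<rightarrow> F\<^sub>0 \<rightarrow> R/I \<rightarrow> 0\<close>: \<open>rk i\<close> is the rank function of \<open>F\<^sub>i\<close>,
  \<open>diff i b\<close> is the image of the basis element \<open>b\<close> under \<open>F\<^sub>i\<^sub>+\<^sub>1 \<rightarrow> F\<^sub>i\<close>, and \<open>aug b\<close> is a
  representative in \<open>R\<close> of the image of \<open>b\<close> under \<open>F\<^sub>0 \<rightarrow> R/I\<close>.
\<close>

record (overloaded) ('x, 'k) free_res =
  rk :: "nat \<Rightarrow> nat \<Rightarrow> nat"
  diff :: "nat \<Rightarrow> nat \<times> nat \<Rightarrow> (nat \<times> nat \<Rightarrow>\<^sub>0 ('x, 'k) poly_ring)"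
  aug :: "nat \<times> nat \<Rightarrow> ('x, 'k) poly_ring"

definition graded_free_resolution ::
  "('x::finite, 'k::field) poly_ring set \<Rightarrow> ('x, 'k) free_res \<Rightarrow> bool" where
  "graded_free_resolution I F \<longleftrightarrow>
     (\<forall>b\<in>basis (rk F 0). aug F b \<in> forms (fst b)) \<and>
     (\<forall>i. \<forall>b\<in>basis (rk F (i + 1)). diff F i b \<in> free_mod_part (rk F i) (fst b)) \<and>
     {lin_form (aug F) v + a | v a. v \<in> free_mod (rk F 0) \<and> a \<in> I} = UNIV \<and>
     {v \<in> free_mod (rk F 0). lin_form (aug F) v \<in> I} = lin_ext (diff F 0) ` free_mod (rk F 1) \<and>
     (\<forall>i. {v \<in> free_mod (rk F (i + 1)). lin_ext (diff F i) v = 0}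
            = lin_ext (diff F (i + 1)) ` free_mod (rk F (i + 2)))"

text \<open>
  The complex \<open>F \<otimes>\<^sub>R K\<close>, where \<open>K\<close> is the residue field of \<open>R\<close> at the ideal generated by the
  variables.  \<open>F\<^sub>i \<otimes>\<^sub>R K\<close> is the \<open>K\<close>-vector space on the basis of \<open>F\<^sub>i\<close>, and the differential is
  obtained by replacing each coefficient by its residue class, i.e. its constant term.
\<close>

definition tensor_part :: "('x, 'k::field) free_res \<Rightarrow> nat \<Rightarrow> nat \<Rightarrow> (nat \<times> nat \<Rightarrow>\<^sub>0 'k) set" where
  "tensor_part F i m = {w \<in> free_mod (rk F i). \<forall>b\<in>Poly_Mapping.keys w. fst b = m}"

definition tensor_diff ::
  "('x, 'k::field) free_res \<Rightarrow> nat \<Rightarrow> (nat \<times> nat \<Rightarrow>\<^sub>0 'k) \<Rightarrow> (nat \<times> nat \<Rightarrow>\<^sub>0 'k)" where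
  "tensor_diff F i = lin_ext (\<lambda>b. Poly_Mapping.map (\<lambda>p. Poly_Mapping.lookup p 0) (diff F i b))"

definition tensor_cycles :: "('x, 'k::field) free_res \<Rightarrow> nat \<Rightarrow> nat \<Rightarrow> (nat \<times> nat \<Rightarrow>\<^sub>0 'k) set" where
  "tensor_cycles F i m =
     {w \<in> tensor_part F i m. i = 0 \<or> tensor_diff F (i - 1) w = 0}"

definition tensor_boundaries ::
  "('x, 'k::field) free_res \<Rightarrow> nat \<Rightarrow> nat \<Rightarrow> (nat \<times> nat \<Rightarrow>\<^sub>0 'k) set" where
  "tensor_boundaries F i m = tensor_diff F i ` tensor_part F (i + 1) m"

text \<open>
  \<open>tor_dim I i m\<close> is \<open>dim\<^sub>K [Tor\<^sub>i\<^sup>R(R/I, K)]\<^sub>m\<close>, computed from an arbitrary graded free resolution of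
  \<open>R/I\<close>; the choice is immaterial.
\<close>

definition tor_dim :: "('x::finite, 'k::field) poly_ring set \<Rightarrow> nat \<Rightarrow> nat \<Rightarrow> nat" where
  "tor_dim I i m =
     (let F = (SOME F. graded_free_resolution I F)
      in qdim (tensor_cycles F i m) (tensor_boundaries F i m))"

end

theory Submission
  imports Defs "HOL-Library.Function_Algebras" "HOL-Library.Product_Plus"
begin

text \<open>
  Betti numbers are computed as dimensions of Koszul homology.  For a resolution \<open>F\<close> with syzygy
  modules \<open>Z\<close>, the short exact sequences \<open>0 \<rightarrow> Z \<rightarrow> F \<rightarrow> F/Z \<rightarrow> 0\<close> shift the Koszul homology of \<open>A\<close>
  down to \<open>(Z \<inter> mF)/mZ\<close>, which is also the homology of \<open>F \<otimes> K\<close>.  Take the Lefschetz form \<open>g\<close> as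
  the first of the linear forms in the Koszul complex.  As a mapping cone, its homology
  on \<open>A\<close> is built from that of \<open>A/gA\<close> and of \<open>0 :\<^sub>A g\<close> over the remaining \<open>n\<close> variables.  By the
  Lefschetz property, \<open>A/gA\<close> is the polynomial ring \<open>S = R/gR\<close> modulo \<open>m\<^bsup>d+1\<^esup>\<close>, and \<open>0 :\<^sub>A g\<close> is
  concentrated in the degrees \<open>u k - 1\<close>, no two of which are adjacent, so that it is killed by the
  variables.  The hypothesis \<open>u 1 + 3 \<le> u 2\<close> separates the two contributions, so that the
  connecting homomorphisms vanish.
\<close>

text \<open>Where the 3 comes from: let \<open>N = A/gA\<close> and \<open>K = 0 : g\<close>, and
  let \<open>j\<close> be the degree of the coefficients of a Koszul chain, so that the Tor degree
  is \<open>j + p\<close>. The connecting homomorphisms of the cone go from \<open>H_p(N)\<close> in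
  degree \<open>j\<close> to \<open>H_(p-2)(K)\<close> in degree \<open>j + 1\<close>. For
  \<open>p \<ge> 1\<close> the homology of \<open>N\<close> sits in degree \<open>d\<close> alone,
  so only degree \<open>d + 1\<close> of \<open>K\<close> could interfere, and
  \<open>u 2 - 1 \<ge> d + 2\<close> excludes it.

  The resolution in \<open>tor_dim\<close> is an unspecified one. It need not be minimal, so the
  differential of \<open>F \<otimes> K\<close> may be nonzero, and the comparison with Koszul
  homology has to hold for every resolution.

  No quotient is ever formed: a module is a pair \<open>Q \<subseteq> P\<close> of graded subspaces
  of a fixed space, and homology is a difference of dimensions. \<open>A/gA\<close> and
  \<open>0 : g\<close> are again such pairs.

  The homology of \<open>N\<close> in degree \<open>d\<close> has the rank of a Koszul differential
  on \<open>S\<close> as its dimension. These ranks are computed recursively from the exactness of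
  the Koszul complex of \<open>S\<close>.\<close>

abbreviation "lookup \<equiv> Poly_Mapping.lookup"
abbreviation "keys \<equiv> Poly_Mapping.keys"
abbreviation "single \<equiv> Poly_Mapping.single"

section \<open>Dimensions of finite-dimensional subspaces\<close>

text \<open>The ambient spaces are infinite-dimensional, so finiteness belongs to subspaces.
  Carrying \<open>vector_space s\<close> inside the predicate lets facts about a linear map between
  two spaces be stated outside any locale.\<close>

definition findim :: "('k::field \<Rightarrow> 'v::ab_group_add \<Rightarrow> 'v) \<Rightarrow> 'v set \<Rightarrow> bool" where
  "findim s S \<longleftrightarrow> vector_space s \<and> module.subspace s S \<and> (\<exists>B. finite B \<and> S \<subseteq> module.span s B)"

context vector_space
begin

lemma findim_subspace: "findim scale T \<Longrightarrow> subspace S \<Longrightarrow> S \<subseteq> T \<Longrightarrow> findim scale S"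
  unfolding findim_def by blast

lemma findim_imp_subspace: "findim scale S \<Longrightarrow> subspace S"
  unfolding findim_def by blast

lemma findim_basis:
  assumes "findim scale S"
  obtains B where "finite B" "B \<subseteq> S" "independent B" "S = span B" "card B = dim S"
proof -
  obtain C where C: "finite C" "S \<subseteq> span C" and S: "subspace S"
    using assms unfolding findim_def by blast
  obtain B where B: "B \<subseteq> S" "independent B" "S \<subseteq> span B" "card B = dim S"
    using basis_exists by blast
  have "finite B"
    using independent_span_bound[OF C(1) B(2)] B(1) C(2) by blast
  moreover have "span B = S"
    using B S by (metis span_subspace)
  ultimately show ?thesis
    using B that by blast
qed

lemma findim_dim_mono:
  assumes "findim scale T" "S \<subseteq> T"
  shows "dim S \<le> dim T"
proof -
  obtain B where B: "finite B" "T = span B" "card B = dim T"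
    by (rule findim_basis[OF assms(1)])
  have "S \<subseteq> span B" using assms(2) B(2) by (rule subset_trans[OF _ equalityD1])
  then show ?thesis
    using dim_le_card[OF _ B(1)] B(3) by metis
qed

lemma findim_dim_eq:
  assumes "findim scale T" "subspace S" "S \<subseteq> T" "dim T \<le> dim S"
  shows "S = T"
proof (rule ccontr)
  assume "S \<noteq> T"
  then obtain x where x: "x \<in> T" "x \<notin> S"
    using assms(3) by blast
  obtain B where B: "finite B" "B \<subseteq> S" "independent B" "S = span B" "card B = dim S"
    using findim_basis[OF findim_subspace[OF assms(1-3)]] by blast
  have xB: "x \<notin> span B" using x B(4) by simp
  then have "independent (insert x B)"
    using B(3) by (rule independent_insertI)
  then have "dim (insert x B) = Suc (dim S)"
    using B(1,5) xB span_base[of x B] by (auto simp: dim_eq_card_independent card_insert_if)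
  moreover have "dim (insert x B) \<le> dim T"
    using findim_dim_mono[OF assms(1), of "insert x B"] B(2) x(1) assms(3) by blast
  ultimately show False
    using assms(4) by simp
qed

lemma findim_zero: "findim scale {0}"
  unfolding findim_def using vector_space_axioms by (auto intro!: exI[of _ "{}"])

lemma dim_zero_space [simp]: "dim {0} = 0"
  using dim_le_card[of "{0}" "{}"] by simp

lemma findim_sums:
  assumes "findim scale S" "findim scale T"
  shows "findim scale {x + y | x y. x \<in> S \<and> y \<in> T}"
proof -
  obtain B where B: "finite B" "S = span B" using findim_basis[OF assms(1)] by metis
  obtain C where C: "finite C" "T = span C" using findim_basis[OF assms(2)] by metis
  have "{x + y | x y. x \<in> S \<and> y \<in> T} = span (B \<union> C)"
    using span_Un[of B C] unfolding B(2)[symmetric] C(2)[symmetric] by (rule sym)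
  moreover have "finite (B \<union> C)" using B(1) C(1) by simp
  ultimately show ?thesis
    unfolding findim_def using vector_space_axioms subspace_span[of "B \<union> C"] by (metis order_refl)
qed

end

lemma findim_image:
  assumes "Vector_Spaces.linear s1 s2 f" "findim s1 S"
  shows "findim s2 (f ` S)"
proof -
  interpret Vector_Spaces.linear s1 s2 f by fact
  obtain B where B: "finite B" "S \<subseteq> vs1.span B"
    using assms(2) unfolding findim_def by blast
  have "f ` S \<subseteq> vs2.span (f ` B)"
    using B span_image by blast
  then show ?thesis
    using assms(2) B subspace_image vs2.vector_space_axioms unfolding findim_def by blast
qed

lemma rank_nullity:
  assumes "Vector_Spaces.linear s1 s2 f" "findim s1 S"
  shows "vector_space.dim s1 S = vector_space.dim s2 (f ` S) + vector_space.dim s1 {x \<in> S. f x = 0}"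
proof -
  interpret Vector_Spaces.linear s1 s2 f by fact
  let ?K = "{x \<in> S. f x = 0}"
  have S: "vs1.subspace S" using assms(2) by (rule vs1.findim_imp_subspace)
  have "vs1.subspace ?K"
    using vs1.subspace_inter[OF S subspace_kernel] by (simp add: Int_def)
  then have "findim s1 ?K" using vs1.findim_subspace[OF assms(2)] by blast
  then obtain B where B: "finite B" "B \<subseteq> ?K" "vs1.independent B" "?K = vs1.span B" "card B = vs1.dim ?K"
    using vs1.findim_basis by blast
  obtain C where C: "B \<subseteq> C" "C \<subseteq> S" "vs1.independent C" "S \<subseteq> vs1.span C"
    using vs1.maximal_independent_subset_extend[of B S] B by blast
  obtain A where A: "finite A" "S \<subseteq> vs1.span A"
    using assms(2) unfolding findim_def by blast
  have finC: "finite C"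
    using vs1.independent_span_bound[OF A(1) C(3)] A(2) C(2) by blast
  define D where "D = C - B"
  have D: "vs1.independent D" "D \<subseteq> S" "finite D"
    using C finC vs1.independent_mono unfolding D_def by blast+
  \<comment> \<open>\<open>D\<close> completes the basis \<open>B\<close> of the kernel to a basis
    \<open>C\<close>. A kernel element of \<open>span D\<close> has coordinates supported both on
    \<open>B\<close> and on \<open>D = C - B\<close>, so all of them vanish.\<close>
  have inj: "inj_on f (vs1.span D)"
  proof (subst inj_on_iff_eq_0)
    show "\<forall>x\<in>vs1.span D. f x = 0 \<longrightarrow> x = 0"
    proof (intro ballI impI)
      fix x assume x: "x \<in> vs1.span D" "f x = 0"
      have "x \<in> S" using x D S by (meson subsetD vs1.span_minimal)
      then have xB: "x \<in> vs1.span B" using x B by blast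
      have "vs1.representation C x b = 0" for b
      proof -
        have "vs1.representation C x b = vs1.representation B x b"
          by (rule fun_cong[OF vs1.representation_extend[OF C(3) xB C(1)]])
        moreover have "vs1.representation C x b = vs1.representation D x b"
          by (rule fun_cong[OF vs1.representation_extend[OF C(3) x(1)]]) (simp add: D_def)
        ultimately show ?thesis
          using vs1.representation_ne_zero[of B x b] vs1.representation_ne_zero[of D x b] D_def by auto
      qed
      moreover have "x \<in> vs1.span C" using xB C(1) vs1.span_mono by blast
      ultimately show "x = 0"
        using vs1.sum_nonzero_representation_eq[OF C(3), of x] by simp
    qed
  qed simp
  have "vs2.independent (f ` D)" by (rule independent_injective_image[OF D(1) inj])
  moreover have "vs2.span (f ` D) = f ` S"
  proof -
    have "f ` C \<subseteq> insert 0 (f ` D)" using B D_def by auto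
    then have "vs2.span (f ` C) \<subseteq> vs2.span (f ` D)"
      by (metis vs2.span_insert_0 vs2.span_mono)
    moreover have "vs1.span C = S"
      using C S by (metis vs1.span_subspace)
    moreover have "vs2.span (f ` D) \<subseteq> vs2.span (f ` C)"
      by (rule vs2.span_mono) (auto simp: D_def)
    ultimately show ?thesis
      using span_image[of C] by simp
  qed
  ultimately have "vs2.dim (f ` S) = card (f ` D)"
    by (metis vs2.dim_span_eq_card_independent)
  also have "\<dots> = card D"
    using inj by (meson card_image inj_on_subset vs1.span_superset)
  finally have "vs2.dim (f ` S) = card D" .
  moreover have "vs1.dim S = card C"
    using C by (metis vs1.basis_card_eq_dim)
  moreover have "card C = card D + card B"
    unfolding D_def using C(1) finC card_mono[OF finC C(1)] by (simp add: card_Diff_subset finite_subset)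
  ultimately show ?thesis using B by simp
qed

text \<open>As the kernel of \<open>f\<close> on \<open>V\<close> lies in \<open>W\<close>, both
  dimensions drop by that of the kernel; this is \<open>V/W \<cong> f V / f W\<close>. The
  comparisons of homology below (connecting maps, pullbacks, constant terms) are instances of
  it.\<close>

lemma dim_quotient_image:
  assumes "Vector_Spaces.linear s1 s2 f" "findim s1 V" "module.subspace s1 W" "W \<subseteq> V"
    and "\<And>x. x \<in> V \<Longrightarrow> f x = 0 \<Longrightarrow> x \<in> W"
  shows "vector_space.dim s1 V - vector_space.dim s1 W =
         vector_space.dim s2 (f ` V) - vector_space.dim s2 (f ` W)"
proof -
  interpret Vector_Spaces.linear s1 s2 f by fact
  have "findim s1 W" using assms vs1.findim_subspace by blast
  moreover have "{x \<in> W. f x = 0} = {x \<in> V. f x = 0}" using assms by blast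
  ultimately show ?thesis
    using rank_nullity[OF assms(1,2)] rank_nullity[OF assms(1), of W] by simp
qed

lemma dim_image_inj:
  assumes "Vector_Spaces.linear s1 s2 f" "findim s1 V" "\<And>x. x \<in> V \<Longrightarrow> f x = 0 \<Longrightarrow> x = 0"
  shows "vector_space.dim s2 (f ` V) = vector_space.dim s1 V"
proof -
  interpret Vector_Spaces.linear s1 s2 f by fact
  have "{x \<in> V. f x = 0} = {0}" using assms vs1.subspace_0[OF vs1.findim_imp_subspace[OF assms(2)]] by auto
  then show ?thesis using rank_nullity[OF assms(1,2)] by simp
qed

section \<open>Koszul homology of graded subquotients\<close>

text \<open>
  A chain assigns a vector to each list of booleans; the entry \<open>l\<close> is the coefficient of the wedge
  of those generators at whose position \<open>l\<close> is \<open>True\<close>.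
\<close>

fun kdiff :: "('r \<Rightarrow> 'v \<Rightarrow> 'v::ab_group_add) \<Rightarrow> 'r list \<Rightarrow> (bool list \<Rightarrow> 'v) \<Rightarrow> bool list \<Rightarrow> 'v" where
  "kdiff act [] c l = 0"
| "kdiff act (y # ys) c [] = 0"
| "kdiff act (y # ys) c (False # l) = kdiff act ys (\<lambda>l. c (False # l)) l + act y (c (True # l))"
| "kdiff act (y # ys) c (True # l) = - kdiff act ys (\<lambda>l. c (True # l)) l"

text \<open>The homological degree is an integer: shifts such as \<open>p - 2\<close> need no case
  distinction, and in negative degrees only the zero chain remains. Entries off the index set are
  zero, so that chains are plain functions and can be compared as such.\<close>

definition chains :: "int \<Rightarrow> nat \<Rightarrow> 'v::zero set \<Rightarrow> (bool list \<Rightarrow> 'v) set" where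
  "chains p n P = {c. \<forall>l. if length l = n \<and> int (count_list l True) = p then c l \<in> P else c l = 0}"

definition chain_scale :: "('k \<Rightarrow> 'v \<Rightarrow> 'v) \<Rightarrow> 'k \<Rightarrow> (bool list \<Rightarrow> 'v) \<Rightarrow> bool list \<Rightarrow> 'v" where
  "chain_scale s c f = (\<lambda>l. s c (f l))"

text \<open>Cycles and boundaries of the Koszul complex of \<open>P/Q\<close>, lifted to
  \<open>P\<close>. The index \<open>j\<close> is the degree of the coefficients; the differential
  raises it by one while lowering \<open>p\<close>, so the internal degree of a class is
  \<open>j + p\<close>.\<close>

definition cycles where
  "cycles act ys p P Q j = {c \<in> chains p (length ys) (P j). \<forall>l. kdiff act ys c l \<in> Q (j + 1)}"

definition boundaries where
  "boundaries act ys p P Q j =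
     {kdiff act ys e + q | e q. e \<in> chains (p + 1) (length ys) (P (j - 1)) \<and> q \<in> chains p (length ys) (Q j)}"

text \<open>The two layers of the Koszul complex on \<open>y # ys\<close> seen as a cone:
  \<open>lo\<close> collects the wedges without \<open>y\<close>, \<open>hi\<close> the coefficients
  of those with \<open>y\<close>.\<close>

definition lo :: "(bool list \<Rightarrow> 'v) \<Rightarrow> bool list \<Rightarrow> 'v" where "lo c = (\<lambda>l. c (False # l))"
definition hi :: "(bool list \<Rightarrow> 'v) \<Rightarrow> bool list \<Rightarrow> 'v" where "hi c = (\<lambda>l. c (True # l))"
definition join :: "(bool list \<Rightarrow> 'v::zero) \<Rightarrow> (bool list \<Rightarrow> 'v) \<Rightarrow> bool list \<Rightarrow> 'v" where
  "join a b l = (case l of [] \<Rightarrow> 0 | h # t \<Rightarrow> if h then b t else a t)"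

lemma join_simps [simp]: "lo (join a b) = a" "hi (join a b) = b" "join a b [] = 0"
  by (simp_all add: lo_def hi_def join_def)

lemma lo_hi_eqI: "c [] = d [] \<Longrightarrow> lo c = lo d \<Longrightarrow> hi c = hi d \<Longrightarrow> c = d"
proof
  fix l assume "c [] = d []" "lo c = lo d" "hi c = hi d"
  then show "c l = d l"
    by (cases l) (auto simp: lo_def hi_def fun_eq_iff split: bool.splits, metis (full_types))
qed

lemma lo_add [simp]: "lo (a + b) = lo a + lo b" and hi_add [simp]: "hi (a + b) = hi a + hi b"
  and lo_zero [simp]: "lo 0 = 0" and hi_zero [simp]: "hi 0 = 0"
  by (auto simp: lo_def hi_def fun_eq_iff)

lemma kdiff_Nil_index [simp]: "kdiff act ys c [] = 0"
  by (cases ys) auto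

lemma kdiff_Nil [simp]: "kdiff act [] c = 0"
  by (auto simp: fun_eq_iff)

lemma lo_kdiff: "lo (kdiff act (y # ys) c) = kdiff act ys (lo c) + (\<lambda>l. act y (hi c l))"
  by (auto simp: lo_def hi_def fun_eq_iff)

lemma hi_kdiff: "hi (kdiff act (y # ys) c) = - kdiff act ys (hi c)"
  by (auto simp: lo_def hi_def fun_eq_iff)

lemma chains_0: "c \<in> chains p 0 P \<longleftrightarrow> (if p = 0 then c [] \<in> P else c [] = 0) \<and> (\<forall>l. l \<noteq> [] \<longrightarrow> c l = 0)"
proof -
  have *: "length l = 0 \<and> int (count_list l True) = p \<longleftrightarrow> l = [] \<and> p = 0" for l
    by (cases l) auto
  show ?thesis
    unfolding chains_def mem_Collect_eq * by metis
qed

lemma chains_Suc: "c \<in> chains p (Suc n) P \<longleftrightarrow> c [] = 0 \<and> lo c \<in> chains p n P \<and> hi c \<in> chains (p - 1) n P"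
proof
  assume c: "c \<in> chains p (Suc n) P"
  then have *: "if length l = Suc n \<and> int (count_list l True) = p then c l \<in> P else c l = 0" for l
    by (simp add: chains_def)
  show "c [] = 0 \<and> lo c \<in> chains p n P \<and> hi c \<in> chains (p - 1) n P"
    unfolding chains_def lo_def hi_def
    using *[of "[]"] *[of "False # _"] *[of "True # _"] by (auto simp: algebra_simps)
next
  assume c: "c [] = 0 \<and> lo c \<in> chains p n P \<and> hi c \<in> chains (p - 1) n P"
  show "c \<in> chains p (Suc n) P"
    unfolding chains_def
  proof (clarify)
    fix l
    show "if length l = Suc n \<and> int (count_list l True) = p then c l \<in> P else c l = 0"
    proof (cases l)
      case Nil then show ?thesis using c by simp
    next
      case (Cons h t)
      have "if length t = n \<and> int (count_list t True) = p then c (False # t) \<in> P else c (False # t) = 0"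
        "if length t = n \<and> int (count_list t True) = p - 1 then c (True # t) \<in> P else c (True # t) = 0"
        using c by (auto simp: chains_def lo_def hi_def)
      then show ?thesis using Cons by (cases h) (auto simp: algebra_simps)
    qed
  qed
qed

lemma join_chains: "a \<in> chains p n P \<Longrightarrow> b \<in> chains (p - 1) n P \<Longrightarrow> join a b \<in> chains p (Suc n) P"
  by (simp add: chains_Suc)

lemma chains_mono: "P \<subseteq> P' \<Longrightarrow> chains p n P \<subseteq> chains p n P'"
  unfolding chains_def by auto

lemma chains_values: "c \<in> chains p n P \<Longrightarrow> 0 \<in> P \<Longrightarrow> c l \<in> P"
  unfolding chains_def by (auto split: if_splits dest!: spec[of _ l])

lemma chains_valuesI: "c \<in> chains p n P \<Longrightarrow> (\<And>l. c l \<in> P') \<Longrightarrow> c \<in> chains p n P'"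
  unfolding chains_def by auto

lemma chains_map: "c \<in> chains p n P \<Longrightarrow> (\<And>v. v \<in> P \<Longrightarrow> f v \<in> P') \<Longrightarrow> f 0 = 0 \<Longrightarrow> (\<lambda>l. f (c l)) \<in> chains p n P'"
  unfolding chains_def by auto

lemma chains_choice:
  assumes "c \<in> chains p n P" "\<And>v. v \<in> P \<Longrightarrow> \<exists>w\<in>P'. R v w" "R 0 0"
  shows "\<exists>d\<in>chains p n P'. \<forall>l. R (c l) (d l)"
proof -
  let ?I = "\<lambda>l. length l = n \<and> int (count_list l True) = p"
  have "\<exists>w. R (c l) w \<and> (if ?I l then w \<in> P' else w = 0)" for l
    using assms(1) assms(2)[of "c l"] assms(3) unfolding chains_def
    by (auto split: if_splits dest!: spec[of _ l])
  then obtain d where "\<And>l. R (c l) (d l) \<and> (if ?I l then d l \<in> P' else d l = 0)"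
    by metis
  then show ?thesis by (intro bexI[of _ d]) (auto simp: chains_def)
qed

text \<open>Naturality in the coefficients. It is applied to scalars, to the action of a ring
  element, to the coordinates of a free module and to module homomorphisms.\<close>

lemma kdiff_compose:
  assumes "\<And>u v. \<phi> (u + v) = \<phi> u + \<phi> v" "\<And>y v. y \<in> set ys \<Longrightarrow> \<phi> (act y v) = act' y (\<phi> v)"
  shows "kdiff act' ys (\<lambda>l. \<phi> (c l)) = (\<lambda>l. \<phi> (kdiff act ys c l))"
proof -
  have 0: "\<phi> 0 = 0" using assms(1)[of 0 0] by simp
  have m: "\<phi> (- v) = - \<phi> v" for v
    using assms(1)[of v "- v"] 0 by (simp add: minus_unique)
  show ?thesis
    using assms(2)
  proof (induction ys arbitrary: c)
    case Nil then show ?case by (simp add: 0 fun_eq_iff)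
  next
    case (Cons y ys)
    have IH: "kdiff act' ys (\<lambda>l. \<phi> (c l)) = (\<lambda>l. \<phi> (kdiff act ys c l))" for c
      by (rule Cons.IH) (simp add: Cons.prems)
    show ?case
    proof (rule lo_hi_eqI)
      show "kdiff act' (y # ys) (\<lambda>l. \<phi> (c l)) [] = \<phi> (kdiff act (y # ys) c [])" by (simp add: 0)
      show "lo (kdiff act' (y # ys) (\<lambda>l. \<phi> (c l))) = lo (\<lambda>l. \<phi> (kdiff act (y # ys) c l))"
        using IH[of "lo c"] by (simp add: lo_def fun_eq_iff assms(1) Cons.prems)
      show "hi (kdiff act' (y # ys) (\<lambda>l. \<phi> (c l))) = hi (\<lambda>l. \<phi> (kdiff act (y # ys) c l))"
        using IH[of "hi c"] by (simp add: hi_def fun_eq_iff m)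
    qed
  qed
qed

locale kmod = vector_space s + M: module act
  for s :: "'k::field \<Rightarrow> 'v::ab_group_add \<Rightarrow> 'v" and act :: "'r::comm_ring_1 \<Rightarrow> 'v \<Rightarrow> 'v" +
  assumes act_scale: "act r (s c v) = s c (act r v)"
begin

sublocale ch: vector_space "chain_scale s"
  by unfold_locales (auto simp: chain_scale_def fun_eq_iff algebra_simps vector_space_assms)

lemma linearI_ch: "(\<And>a b. f (a + b) = f a + f b) \<Longrightarrow> (\<And>c a. f (chain_scale s c a) = chain_scale s c (f a)) \<Longrightarrow>
    Vector_Spaces.linear (chain_scale s) (chain_scale s) f"
  by (simp add: Vector_Spaces.linear_iff ch.vector_space_axioms)

lemma linear_lo: "Vector_Spaces.linear (chain_scale s) (chain_scale s) lo"
  by (rule linearI_ch) (auto simp: lo_def chain_scale_def)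

lemma linear_hi: "Vector_Spaces.linear (chain_scale s) (chain_scale s) hi"
  by (rule linearI_ch) (auto simp: hi_def chain_scale_def)

lemma linear_join1: "Vector_Spaces.linear (chain_scale s) (chain_scale s) (\<lambda>a. join a 0)"
  by (rule linearI_ch) (auto simp: join_def chain_scale_def fun_eq_iff split: list.splits)

lemma linear_join2: "Vector_Spaces.linear (chain_scale s) (chain_scale s) (\<lambda>b. join 0 b)"
  by (rule linearI_ch) (auto simp: join_def chain_scale_def fun_eq_iff split: list.splits)

lemma kdiff_add: "kdiff act ys (a + b) = kdiff act ys a + kdiff act ys b"
proof
  fix l
  have "kdiff act ys (\<lambda>l. a l + b l) l = kdiff act ys a l + kdiff act ys b l"
  proof (induction ys arbitrary: a b l)
    case (Cons y ys)
    then show ?case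
      by (cases l; cases "hd l") (auto simp: M.scale_right_distrib algebra_simps)
  qed simp
  then show "kdiff act ys (a + b) l = (kdiff act ys a + kdiff act ys b) l"
    by (simp add: plus_fun_def)
qed

lemma kdiff_chain_scale: "kdiff act ys (chain_scale s c a) = chain_scale s c (kdiff act ys a)"
  unfolding chain_scale_def by (rule kdiff_compose) (simp_all add: vector_space_assms act_scale)

lemma linear_kdiff: "Vector_Spaces.linear (chain_scale s) (chain_scale s) (kdiff act ys)"
  by (rule linearI_ch) (rule kdiff_add kdiff_chain_scale)+

lemma kdiff_zero [simp]: "kdiff act ys 0 = 0" using kdiff_add[of ys 0 0] by simp
lemma kdiff_minus: "kdiff act ys (- a) = - kdiff act ys a"
  using kdiff_add[of ys a "- a"] by (simp add: minus_unique)
lemma kdiff_diff: "kdiff act ys (a - b) = kdiff act ys a - kdiff act ys b"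
  using kdiff_add[of ys a "- b"] by (simp add: kdiff_minus)

lemma kdiff_act: "kdiff act ys (\<lambda>l. act y (c l)) = (\<lambda>l. act y (kdiff act ys c l))"
  by (rule kdiff_compose) (simp_all only: M.scale_right_distrib M.scale_left_commute)

text \<open>The minus sign in the \<open>hi\<close> layer of \<open>kdiff\<close> makes the two
  terms cancel in which \<open>y\<close> acts on the differential of the \<open>hi\<close>
  part.\<close>

lemma kdiff_kdiff [simp]: "kdiff act ys (kdiff act ys c) = 0"
proof
  fix l
  have "kdiff act ys (kdiff act ys c) l = 0"
  proof (induction ys arbitrary: c l)
    case (Cons y ys)
    show ?case
    proof (cases l)
      case (Cons h t)
      have "kdiff act ys (\<lambda>l. kdiff act ys (\<lambda>l. c (False # l)) l + act y (c (True # l))) t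
          = act y (kdiff act ys (\<lambda>l. c (True # l)) t)"
        using fun_cong[OF kdiff_add, of ys "kdiff act ys (\<lambda>l. c (False # l))" "\<lambda>l. act y (c (True # l))" t]
        by (simp add: Cons.IH plus_fun_def kdiff_act)
      moreover have "kdiff act ys (\<lambda>l. - kdiff act ys (\<lambda>l. c (True # l)) l) t = 0"
        using fun_cong[OF kdiff_minus, of ys "kdiff act ys (\<lambda>l. c (True # l))" t]
        by (simp add: Cons.IH fun_Compl_def)
      ultimately show ?thesis using Cons by (cases h) (simp_all add: M.scale_minus_right)
    qed simp
  qed simp
  then show "kdiff act ys (kdiff act ys c) l = 0 l" by simp
qed

lemma subspace_chains: "subspace P \<Longrightarrow> ch.subspace (chains p n P)"
  unfolding ch.subspace_def subspace_def chains_def chain_scale_def by auto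

lemmas chains_add = ch.subspace_add[OF subspace_chains]
lemmas chains_minus = ch.subspace_neg[OF subspace_chains]
lemmas chains_diff = ch.subspace_diff[OF subspace_chains]
lemmas chains_zero = ch.subspace_0[OF subspace_chains]

text \<open>Splitting off one generator, \<open>lo\<close> maps onto the chains in degree
  \<open>p\<close>, and its kernel is a copy of the chains in degree \<open>p - 1\<close>; the
  dimensions then follow Pascal's rule.\<close>

lemma findim_dim_chains:
  assumes P: "findim s P"
  shows "findim (chain_scale s) (chains p n P) \<and>
         ch.dim (chains p n P) = (if p \<ge> 0 then n choose (nat p) else 0) * dim P"
proof (induction n arbitrary: p)
  case 0
  have sub: "subspace P" using P by (rule findim_imp_subspace)
  show ?case
  proof (cases "p = 0")
    case True
    let ?f = "\<lambda>v l. if l = [] then v else (0::'v)"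
    have lin: "Vector_Spaces.linear s (chain_scale s) ?f"
      by (auto simp: Vector_Spaces.linear_iff vector_space_axioms ch.vector_space_axioms chain_scale_def fun_eq_iff)
    have "chains 0 0 P = ?f ` P"
    proof
      show "chains 0 0 P \<subseteq> ?f ` P"
      proof
        fix c assume "c \<in> chains 0 0 P"
        then have "c = ?f (c [])" "c [] \<in> P" by (auto simp: chains_0 fun_eq_iff)
        then show "c \<in> ?f ` P" by blast
      qed
      show "?f ` P \<subseteq> chains 0 0 P" by (auto simp: chains_0)
    qed
    moreover have "v = 0" if "?f v = 0" for v
      using fun_cong[OF that, of "[]"] by simp
    then have "ch.dim (?f ` P) = dim P" by (rule dim_image_inj[OF lin P])
    moreover have "findim (chain_scale s) (?f ` P)" by (rule findim_image[OF lin P])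
    ultimately show ?thesis unfolding True by simp
  next
    case False
    then have "chains p 0 P = {0}" by (auto simp: chains_0 fun_eq_iff) (metis)
    then show ?thesis using False ch.findim_zero by simp
  qed
next
  case (Suc n)
  have sub: "subspace P" using P by (rule findim_imp_subspace)
  have "chains p (Suc n) P \<subseteq>
    {x + y | x y. x \<in> (\<lambda>a. join a 0) ` chains p n P \<and> y \<in> (\<lambda>b. join 0 b) ` chains (p - 1) n P}"
  proof
    fix c assume c: "c \<in> chains p (Suc n) P"
    have "c = join (lo c) 0 + join 0 (hi c)"
      by (rule lo_hi_eqI) (use c in \<open>auto simp: chains_Suc\<close>)
    then show "c \<in> {x + y | x y. x \<in> (\<lambda>a. join a 0) ` chains p n P \<and> y \<in> (\<lambda>b. join 0 b) ` chains (p - 1) n P}"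
      using c unfolding chains_Suc by blast
  qed
  moreover have "findim (chain_scale s) {x + y | x y. x \<in> (\<lambda>a. join a 0) ` chains p n P \<and> y \<in> (\<lambda>b. join 0 b) ` chains (p - 1) n P}"
    using Suc.IH by (intro ch.findim_sums findim_image[OF linear_join1] findim_image[OF linear_join2]) blast+
  ultimately have findim: "findim (chain_scale s) (chains p (Suc n) P)"
    using ch.findim_subspace subspace_chains[OF sub] by blast
  have lo: "lo ` chains p (Suc n) P = chains p n P"
  proof
    show "lo ` chains p (Suc n) P \<subseteq> chains p n P" by (auto simp: chains_Suc)
    show "chains p n P \<subseteq> lo ` chains p (Suc n) P"
    proof
      fix a assume "a \<in> chains p n P"
      then have "join a 0 \<in> chains p (Suc n) P" using sub by (intro join_chains chains_zero)
      then show "a \<in> lo ` chains p (Suc n) P" by (rule image_eqI[rotated]) (rule join_simps(1)[symmetric])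
    qed
  qed
  let ?K = "{c \<in> chains p (Suc n) P. lo c = 0}"
  have K: "findim (chain_scale s) ?K"
  proof (rule ch.findim_subspace[OF findim])
    show "ch.subspace ?K"
      using subspace_chains[OF sub, of p "Suc n"] unfolding ch.subspace_def
      by (auto simp: lo_def chain_scale_def fun_eq_iff)
  qed blast
  have "hi ` ?K = chains (p - 1) n P"
  proof
    show "hi ` ?K \<subseteq> chains (p - 1) n P" by (auto simp: chains_Suc)
    show "chains (p - 1) n P \<subseteq> hi ` ?K"
    proof
      fix a assume "a \<in> chains (p - 1) n P"
      then have "join 0 a \<in> ?K" using sub by (auto intro!: join_chains chains_zero)
      then show "a \<in> hi ` ?K" by (rule image_eqI[rotated]) (rule join_simps(2)[symmetric])
    qed
  qed
  moreover have "ch.dim (hi ` ?K) = ch.dim ?K"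
  proof (rule dim_image_inj[OF linear_hi K])
    fix x assume "x \<in> ?K" "hi x = 0"
    then have "x [] = 0 []" "lo x = lo 0" "hi x = hi 0" by (simp_all add: chains_Suc)
    then show "x = 0" by (rule lo_hi_eqI)
  qed
  ultimately have "ch.dim (chains p (Suc n) P) = ch.dim (chains p n P) + ch.dim (chains (p - 1) n P)"
    using rank_nullity[OF linear_lo findim] lo by simp
  also have "\<dots> = (if p \<ge> 0 then Suc n choose (nat p) else 0) * dim P"
  proof (cases "p \<ge> 1")
    case True
    then have "nat p = Suc (nat (p - 1))" by simp
    then show ?thesis using True Suc.IH by (simp add: algebra_simps)
  next
    case False
    then show ?thesis using Suc.IH by (cases "p = 0") auto
  qed
  finally show ?case using findim by blast
qed

lemmas findim_chains = findim_dim_chains[THEN conjunct1]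
lemmas dim_chains = findim_dim_chains[THEN conjunct2]

lemma kdiff_chains:
  assumes "subspace P'" "\<And>y v. y \<in> set ys \<Longrightarrow> v \<in> P \<Longrightarrow> act y v \<in> P'" "c \<in> chains p (length ys) P"
  shows "kdiff act ys c \<in> chains (p - 1) (length ys) P'"
  using assms(2,3)
proof (induction ys arbitrary: c p)
  case Nil
  show ?case using chains_zero[OF assms(1), of "p - 1" "length []"] by (simp only: kdiff_Nil)
next
  case (Cons y ys)
  have c: "lo c \<in> chains p (length ys) P" "hi c \<in> chains (p - 1) (length ys) P"
    using Cons.prems(2) by (auto simp: chains_Suc)
  have "kdiff act ys (lo c) \<in> chains (p - 1) (length ys) P'" "kdiff act ys (hi c) \<in> chains (p - 1 - 1) (length ys) P'"
    using Cons.IH Cons.prems(1) c by (meson list.set_intros(2))+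
  moreover have "(\<lambda>l. act y (hi c l)) \<in> chains (p - 1) (length ys) P'"
    by (rule chains_map[OF c(2)]) (simp_all add: Cons.prems(1))
  ultimately show ?case
    using assms(1) by (simp add: chains_Suc lo_kdiff hi_kdiff chains_add chains_minus)
qed

text \<open>A graded module is a family of subspaces of one ambient space, indexed by integers so
  that shifts are total. Closure is required only under the elements of \<open>ys\<close>, as the
  Koszul complex uses no others.\<close>

definition gmod :: "'r list \<Rightarrow> (int \<Rightarrow> 'v set) \<Rightarrow> bool" where
  "gmod ys P \<longleftrightarrow> (\<forall>j. findim s (P j)) \<and> (\<forall>y\<in>set ys. \<forall>j. \<forall>v\<in>P j. act y v \<in> P (j + 1))"

lemma gmod_subspace: "gmod ys P \<Longrightarrow> subspace (P j)"
  unfolding gmod_def using findim_imp_subspace by blast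

lemma gmod_kdiff:
  assumes "gmod ys P" "c \<in> chains p (length ys) (P j)"
  shows "kdiff act ys c \<in> chains (p - 1) (length ys) (P (j + 1))"
  by (rule kdiff_chains[OF gmod_subspace[OF assms(1)] _ assms(2)]) (use assms(1) in \<open>auto simp: gmod_def\<close>)

lemma subspace_cycles:
  assumes "gmod ys P" "gmod ys Q"
  shows "ch.subspace (cycles act ys p P Q j)"
  using subspace_chains[OF gmod_subspace[OF assms(1)], of p "length ys" j] gmod_subspace[OF assms(2), of "j+1"]
  unfolding ch.subspace_def subspace_def cycles_def
  by (auto simp: kdiff_add kdiff_chain_scale) (simp add: chain_scale_def)

lemma cycles_chains: "cycles act ys p P Q j \<subseteq> chains p (length ys) (P j)"
  unfolding cycles_def by blast

lemma findim_cycles: "gmod ys P \<Longrightarrow> gmod ys Q \<Longrightarrow> findim (chain_scale s) (cycles act ys p P Q j)"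
  by (rule ch.findim_subspace[OF findim_chains subspace_cycles cycles_chains]) (auto simp: gmod_def)

lemma boundaries_sums:
  "boundaries act ys p P Q j = {x + y | x y. x \<in> kdiff act ys ` chains (p + 1) (length ys) (P (j - 1)) \<and> y \<in> chains p (length ys) (Q j)}"
  unfolding boundaries_def by blast

lemma findim_boundaries: "gmod ys P \<Longrightarrow> gmod ys Q \<Longrightarrow> findim (chain_scale s) (boundaries act ys p P Q j)"
  unfolding boundaries_sums by (intro ch.findim_sums findim_image[OF linear_kdiff] findim_chains) (auto simp: gmod_def)

lemma chains_boundaries: "gmod ys P \<Longrightarrow> chains p (length ys) (Q j) \<subseteq> boundaries act ys p P Q j"
  unfolding boundaries_def using chains_zero[OF gmod_subspace] by (force simp del: plus_fun_apply)

lemma boundaries_cycles: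
  assumes "gmod ys P" "gmod ys Q" "\<And>j. Q j \<subseteq> P j"
  shows "boundaries act ys p P Q j \<subseteq> cycles act ys p P Q j"
proof
  fix c assume "c \<in> boundaries act ys p P Q j"
  then obtain e q where c: "c = kdiff act ys e + q" "e \<in> chains (p + 1) (length ys) (P (j - 1))" "q \<in> chains p (length ys) (Q j)"
    unfolding boundaries_def by blast
  have "kdiff act ys e \<in> chains p (length ys) (P j)" using gmod_kdiff[OF assms(1) c(2)] by simp
  moreover have "q \<in> chains p (length ys) (P j)" using c(3) chains_mono[OF assms(3)] by blast
  moreover have "kdiff act ys q l \<in> Q (j + 1)" for l
    using chains_values[OF gmod_kdiff[OF assms(2) c(3)]] subspace_0[OF gmod_subspace[OF assms(2)]] by blast
  ultimately show "c \<in> cycles act ys p P Q j"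
    unfolding cycles_def c(1) by (auto simp: chains_add[OF gmod_subspace[OF assms(1)]] kdiff_add)
qed

end

section \<open>Koszul homology of a cone\<close>

lemma chains_UNIV: "c \<in> chains p n P \<Longrightarrow> c \<in> chains p n UNIV"
  using chains_mono by blast

lemma lo_Cons: "f (False # t) = lo f t" and hi_Cons: "f (True # t) = hi f t"
  by (simp_all add: lo_def hi_def)

definition koszul_dim where
  "koszul_dim s act ys p P Q j =
     vector_space.dim (chain_scale s) (cycles act ys p P Q j) - vector_space.dim (chain_scale s) (boundaries act ys p P Q j)"

context kmod
begin

definition act_chain :: "'r \<Rightarrow> (bool list \<Rightarrow> 'v) \<Rightarrow> bool list \<Rightarrow> 'v" where
  "act_chain y c = (\<lambda>l. act y (c l))"

lemma act_chain_add: "act_chain y (a + b) = act_chain y a + act_chain y b"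
  by (simp add: act_chain_def fun_eq_iff M.scale_right_distrib)

lemma act_chain_minus: "act_chain y (- a) = - act_chain y a"
  by (simp add: act_chain_def fun_eq_iff M.scale_minus_right)

lemma act_chain_diff: "act_chain y (a - b) = act_chain y a - act_chain y b"
  by (simp add: act_chain_def fun_eq_iff M.scale_right_diff_distrib)

lemma kdiff_act_chain: "kdiff act ys (act_chain y c) = act_chain y (kdiff act ys c)"
  unfolding act_chain_def by (rule kdiff_act)

lemma lo_kd': "lo (kdiff act (y # ys) c) = kdiff act ys (lo c) + act_chain y (hi c)"
  unfolding act_chain_def by (rule lo_kdiff)

lemma act_chain_chains: "c \<in> chains p n P \<Longrightarrow> (\<And>v. v \<in> P \<Longrightarrow> act y v \<in> P') \<Longrightarrow> act_chain y c \<in> chains p n P'"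
  unfolding act_chain_def by (rule chains_map) auto

lemma linear_act: "Vector_Spaces.linear s s (act y)"
  by (simp add: Vector_Spaces.linear_iff vector_space_axioms act_scale M.scale_right_distrib)

text \<open>For \<open>A = P/Q\<close>, the quotient \<open>A/yA\<close> is
  \<open>P / quot_by y P Q\<close> and the annihilator of \<open>y\<close> in \<open>A\<close> is
  \<open>ann_by y P Q / Q\<close>. Both ends of the cone are thus again pairs of subspaces of the
  same ambient space.\<close>

definition quot_by :: "'r \<Rightarrow> (int \<Rightarrow> 'v set) \<Rightarrow> (int \<Rightarrow> 'v set) \<Rightarrow> int \<Rightarrow> 'v set" where
  "quot_by y P Q j = {act y a + q | a q. a \<in> P (j - 1) \<and> q \<in> Q j}"

lemma quot_byI: "a \<in> P (j - 1) \<Longrightarrow> q \<in> Q j \<Longrightarrow> act y a + q \<in> quot_by y P Q j"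
  unfolding quot_by_def by blast

definition ann_by :: "'r \<Rightarrow> (int \<Rightarrow> 'v set) \<Rightarrow> (int \<Rightarrow> 'v set) \<Rightarrow> int \<Rightarrow> 'v set" where
  "ann_by y P Q j = {v \<in> P j. act y v \<in> Q (j + 1)}"

lemma gmod_tl: "gmod (y # ys) P \<Longrightarrow> gmod ys P"
  unfolding gmod_def by auto

lemma gmod_act: "gmod ys P \<Longrightarrow> y \<in> set ys \<Longrightarrow> v \<in> P j \<Longrightarrow> act y v \<in> P (j + 1)"
  unfolding gmod_def by auto

lemma gmod_act': "gmod ys P \<Longrightarrow> y \<in> set ys \<Longrightarrow> v \<in> P (j - 1) \<Longrightarrow> act y v \<in> P j"
  using gmod_act[of ys P y v "j - 1"] by simp

lemma gmod_findim: "gmod ys P \<Longrightarrow> findim s (P j)"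
  unfolding gmod_def by blast

lemma gmod_quot_by:
  assumes "gmod ys P" "gmod ys Q"
  shows "gmod ys (quot_by y P Q)"
  unfolding gmod_def
proof safe
  fix j
  have "quot_by y P Q j = {u + v | u v. u \<in> act y ` P (j - 1) \<and> v \<in> Q j}"
    unfolding quot_by_def by blast
  then show "findim s (quot_by y P Q j)"
    using findim_sums[OF findim_image[OF linear_act gmod_findim[OF assms(1)]] gmod_findim[OF assms(2)]] by simp
next
  fix x j v assume x: "x \<in> set ys" and v: "v \<in> quot_by y P Q j"
  then obtain a q where *: "v = act y a + q" "a \<in> P (j - 1)" "q \<in> Q j"
    unfolding quot_by_def by blast
  then have "act x v = act y (act x a) + act x q"
    by (simp add: M.scale_right_distrib mult.commute)
  moreover have "act x a \<in> P (j + 1 - 1)" "act x q \<in> Q (j + 1)"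
    using gmod_act'[OF assms(1) x *(2)] gmod_act[OF assms(2) x *(3)] by simp_all
  ultimately show "act x v \<in> quot_by y P Q (j + 1)"
    unfolding quot_by_def by blast
qed

lemma gmod_ann_by:
  assumes "gmod ys P" "gmod ys Q"
  shows "gmod ys (ann_by y P Q)"
  unfolding gmod_def
proof safe
  fix j
  have "subspace (ann_by y P Q j)"
    using gmod_subspace[OF assms(1), of j] gmod_subspace[OF assms(2), of "j + 1"]
    unfolding ann_by_def subspace_def by (auto simp: M.scale_right_distrib act_scale)
  then show "findim s (ann_by y P Q j)"
    by (rule findim_subspace[OF gmod_findim[OF assms(1)]]) (auto simp: ann_by_def)
next
  fix x j v assume x: "x \<in> set ys" and v: "v \<in> ann_by y P Q j"
  then show "act x v \<in> ann_by y P Q (j + 1)"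
    using gmod_act[OF assms(1) x, of v] gmod_act[OF assms(2) x, of "act y v" "j + 1"]
    unfolding ann_by_def by (auto simp: mult.commute)
qed

lemma chains_quot_by:
  assumes "gmod ys P" "gmod ys Q" "c \<in> chains p n (quot_by y P Q j)"
  obtains a q where "c = act_chain y a + q" "a \<in> chains p n (P (j - 1))" "q \<in> chains p n (Q j)"
proof -
  note sQ = gmod_subspace[OF assms(2)]
  have "\<exists>d\<in>chains p n (P (j - 1)). \<forall>l. c l - act y (d l) \<in> Q j"
  proof (rule chains_choice[OF assms(3)])
    fix v assume "v \<in> quot_by y P Q j"
    then obtain a q where "v = act y a + q" "a \<in> P (j - 1)" "q \<in> Q j" unfolding quot_by_def by blast
    then show "\<exists>w\<in>P (j - 1). v - act y w \<in> Q j" by (intro bexI[of _ a]) simp_all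
  qed (simp add: subspace_0[OF sQ])
  then obtain a where a: "a \<in> chains p n (P (j - 1))" "\<And>l. c l - act y (a l) \<in> Q j" by blast
  have "c - act_chain y a \<in> chains p n UNIV"
    by (intro chains_diff[OF subspace_UNIV] chains_UNIV[OF assms(3)] act_chain_chains[OF a(1)]) simp
  then have "c - act_chain y a \<in> chains p n (Q j)"
    by (rule chains_valuesI) (use a(2) in \<open>simp add: act_chain_def\<close>)
  moreover have "c = act_chain y a + (c - act_chain y a)" by simp
  ultimately show ?thesis using a(1) that by blast
qed

lemma chains_quot_byI:
  assumes "gmod ys P" "gmod ys Q" "a \<in> chains p n (P (j - 1))" "q \<in> chains p n (Q j)"
  shows "act_chain y a + q \<in> chains p n (quot_by y P Q j)"
proof (rule chains_valuesI)
  show "act_chain y a + q \<in> chains p n UNIV"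
    by (intro chains_add[OF subspace_UNIV] chains_UNIV[OF assms(4)] act_chain_chains[OF assms(3)]) simp
  fix l show "(act_chain y a + q) l \<in> quot_by y P Q j"
    using chains_values[OF assms(3) subspace_0[OF gmod_subspace[OF assms(1)]], of l]
      chains_values[OF assms(4) subspace_0[OF gmod_subspace[OF assms(2)]], of l]
    unfolding quot_by_def act_chain_def by auto
qed

context
  fixes y ys P Q
  assumes P: "gmod (y # ys) P" and Q: "gmod (y # ys) Q" and QP: "\<And>j. Q j \<subseteq> P j"
begin

private abbreviation "N \<equiv> quot_by y P Q"
private abbreviation "K \<equiv> ann_by y P Q"
private abbreviation "n \<equiv> length ys"
private abbreviation "ZC p j \<equiv> cycles act (y # ys) p P Q j"
private abbreviation "BC p j \<equiv> boundaries act (y # ys) p P Q j"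
private abbreviation "ZN p j \<equiv> cycles act ys p P N j"
private abbreviation "BN p j \<equiv> boundaries act ys p P N j"
private abbreviation "ZK p j \<equiv> cycles act ys p K Q j"
private abbreviation "BK p j \<equiv> boundaries act ys p K Q j"
private abbreviation "ker_lo X \<equiv> {c \<in> X. lo c = 0}"

private lemmas gm = gmod_tl[OF P] gmod_tl[OF Q]
  gmod_quot_by[OF gmod_tl[OF P] gmod_tl[OF Q], of y] gmod_ann_by[OF gmod_tl[OF P] gmod_tl[OF Q], of y]

private lemmas sP = gmod_subspace[OF P] and sQ = gmod_subspace[OF Q]

private lemma NP: "N j \<subseteq> P j"
  unfolding quot_by_def using gmod_act'[OF P, of y] QP subspace_add[OF sP] by (auto simp: subset_iff)

private lemma QK: "Q j \<subseteq> K j"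
  unfolding ann_by_def using gmod_act[OF Q, of y] QP by auto

private lemma KP: "K j \<subseteq> P j"
  unfolding ann_by_def by auto

private lemma Q_values: "q \<in> chains p m (Q j) \<Longrightarrow> q l \<in> Q j"
  by (rule chains_values[OF _ subspace_0[OF sQ]])

text \<open>No exactness is involved: the \<open>hi\<close> part of a chain contributes a
  \<open>y\<close>-multiple to the \<open>lo\<close> part of its boundary, and these multiples are
  exactly what \<open>A/yA\<close> divides out.\<close>

lemma lo_boundaries: "lo ` BC p j = BN p j"
proof
  show "lo ` BC p j \<subseteq> BN p j"
  proof (clarsimp simp: boundaries_def lo_kd' chains_Suc)
    fix e q assume e: "lo e \<in> chains (p + 1) n (P (j - 1))" "hi e \<in> chains p n (P (j - 1))"
      "lo q \<in> chains p n (Q j)"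
    have "act_chain y (hi e) + lo q \<in> chains p n (N j)"
      by (rule chains_quot_byI[OF gm(1,2) e(2,3)])
    then show "\<exists>e' q'. kdiff act ys (lo e) + act_chain y (hi e) + lo q = kdiff act ys e' + q' \<and>
       e' \<in> chains (p + 1) n (P (j - 1)) \<and> q' \<in> chains p n (N j)"
      using e(1) by (intro exI[of _ "lo e"] exI[of _ "act_chain y (hi e) + lo q"]) (simp add: add.assoc)
  qed
  show "BN p j \<subseteq> lo ` BC p j"
  proof
    fix c assume "c \<in> BN p j"
    then obtain e q where c: "c = kdiff act ys e + q" "e \<in> chains (p + 1) n (P (j - 1))"
      "q \<in> chains p n (N j)" unfolding boundaries_def by blast
    obtain a r where q: "q = act_chain y a + r" "a \<in> chains p n (P (j - 1))" "r \<in> chains p n (Q j)"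
      by (rule chains_quot_by[OF gm(1,2) c(3)])
    have "join e a \<in> chains (p + 1) (length (y # ys)) (P (j - 1))"
      using c(2) q(2) by (simp add: chains_Suc)
    moreover have "join r 0 \<in> chains p (length (y # ys)) (Q j)"
      using q(3) chains_zero[OF sQ] by (simp add: chains_Suc)
    ultimately have "kdiff act (y # ys) (join e a) + join r 0 \<in> BC p j"
      unfolding boundaries_def by blast
    moreover have "c = lo (kdiff act (y # ys) (join e a) + join r 0)"
      by (simp add: c(1) q(1) lo_kd' add.assoc)
    ultimately show "c \<in> lo ` BC p j" by blast
  qed
qed

lemma lo_cycles_subset: "lo ` ZC p j \<subseteq> ZN p j"
proof
  fix a assume "a \<in> lo ` ZC p j"
  then obtain c where c: "a = lo c" "c \<in> chains p (Suc n) (P j)"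
    "\<And>l. kdiff act (y # ys) c l \<in> Q (j + 1)"
    unfolding cycles_def by auto
  have a: "a \<in> chains p n (P j)" "hi c \<in> chains (p - 1) n (P j)"
    using c by (auto simp: chains_Suc)
  have "kdiff act ys a l \<in> N (j + 1)" for l
  proof -
    have "act y (- hi c l) + kdiff act (y # ys) c (False # l) \<in> N (j + 1)"
    proof (rule quot_byI)
      show "- hi c l \<in> P (j + 1 - 1)"
        using chains_values[OF a(2) subspace_0[OF sP], of l] subspace_neg[OF sP] by simp
    qed (rule c(3))
    moreover have "kdiff act ys a l = act y (- hi c l) + kdiff act (y # ys) c (False # l)"
      by (simp add: c(1) lo_def hi_def M.scale_minus_right)
    ultimately show ?thesis by simp
  qed
  then show "a \<in> ZN p j" using a(1) by (simp add: cycles_def)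
qed

text \<open>A class of \<open>A/yA\<close> lifts to the cone unless it is obstructed by the
  connecting homomorphism into the homology of \<open>0 : y\<close>, two homological degrees lower
  and one coefficient degree higher. Each alternative of the hypothesis makes this map zero, by its
  source or by its target.\<close>

lemma lo_cycles:
  assumes "ZN p j \<subseteq> BN p j \<or>
           ZK (p - 2) (j + 1) \<subseteq> BK (p - 2) (j + 1)"
  shows "lo ` ZC p j = ZN p j"
proof
  show "lo ` ZC p j \<subseteq> ZN p j" by (rule lo_cycles_subset)
  show "ZN p j \<subseteq> lo ` ZC p j"
  proof (cases "ZN p j \<subseteq> BN p j")
    case True
    moreover have "lo ` BC p j \<subseteq> lo ` ZC p j"
      by (rule image_mono[OF boundaries_cycles[OF P Q QP]])
    ultimately show ?thesis unfolding lo_boundaries by (rule subset_trans)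
  next
    case False
    then have ex: "ZK (p - 2) (j + 1) \<subseteq> BK (p - 2) (j + 1)" using assms by blast
    show ?thesis
    proof
      fix a assume "a \<in> ZN p j"
      then have a: "a \<in> chains p n (P j)" "\<And>l. kdiff act ys a l \<in> N (j + 1)"
        unfolding cycles_def by auto
      have "kdiff act ys a \<in> chains (p - 1) n (N (j + 1))"
        using gmod_kdiff[OF gm(1) a(1)] a(2) by (rule chains_valuesI)
      then obtain b q where b: "kdiff act ys a = act_chain y b + q" "b \<in> chains (p - 1) n (P j)"
        "q \<in> chains (p - 1) n (Q (j + 1))"
        by (rule chains_quot_by[OF gm(1,2)]) simp
      \<comment> \<open>Differentiating once more shows that \<open>y\<close> times the differential
        of \<open>b\<close> lies in \<open>Q\<close>. So this differential is a cycle of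
        \<open>0 : y\<close>; it represents the image of \<open>a\<close> under the connecting
        homomorphism.\<close>
      have "kdiff act ys (kdiff act ys a) = act_chain y (kdiff act ys b) + kdiff act ys q"
        unfolding b(1) by (simp add: kdiff_add kdiff_act_chain)
      then have eq: "act_chain y (kdiff act ys b) = - kdiff act ys q"
        by (simp add: eq_neg_iff_add_eq_0)
      have db: "kdiff act ys b \<in> chains (p - 2) n (P (j + 1))"
        using gmod_kdiff[OF gm(1) b(2)] by simp
      have dq: "kdiff act ys q l \<in> Q (j + 2)" for l
        using Q_values[OF gmod_kdiff[OF gm(2) b(3)]] by (simp add: add.commute)
      have "kdiff act ys b l \<in> K (j + 1)" for l
      proof -
        have "act y (kdiff act ys b l) = - kdiff act ys q l"
          using fun_cong[OF eq, of l] by (simp add: act_chain_def)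
        then show ?thesis
          unfolding ann_by_def
          using chains_values[OF db subspace_0[OF sP]] dq subspace_neg[OF sQ] by (auto simp: add.commute)
      qed
      then have "kdiff act ys b \<in> chains (p - 2) n (K (j + 1))"
        by (rule chains_valuesI[OF db])
      then have "kdiff act ys b \<in> ZK (p - 2) (j + 1)"
        unfolding cycles_def using subspace_0[OF sQ] by simp
      then obtain b2 q2 where b2: "kdiff act ys b = kdiff act ys b2 + q2" "b2 \<in> chains (p - 2 + 1) n (K (j + 1 - 1))"
        "q2 \<in> chains (p - 2) n (Q (j + 1))"
        using ex unfolding boundaries_def by blast
      have b2K: "b2 \<in> chains (p - 1) n (K j)" using b2(2) by simp
      have b2P: "b2 \<in> chains (p - 1) n (P j)" using b2K chains_mono[OF KP] by blast
      \<comment> \<open>Adding \<open>b2\<close> to \<open>- b\<close> brings the \<open>hi\<close>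
        part of the differential into \<open>Q\<close>, and the \<open>lo\<close> part is in
        \<open>Q\<close> as well because \<open>y\<close> kills \<open>b2\<close> modulo
        \<open>Q\<close>.\<close>
      define c where "c = join a (b2 - b)"
      have "c \<in> chains p (length (y # ys)) (P j)"
        unfolding c_def using a(1) b(2) b2P by (simp add: chains_Suc chains_diff[OF sP])
      moreover have "kdiff act (y # ys) c l \<in> Q (j + 1)" for l
      proof (cases l)
        case Nil then show ?thesis using subspace_0[OF sQ] by simp
      next
        case (Cons h t)
        have lo: "lo (kdiff act (y # ys) c) = act_chain y b2 + q"
          unfolding lo_kd' c_def by (simp add: b(1) act_chain_diff)
        have "kdiff act (y # ys) c (False # t) = act y (b2 t) + q t"
          unfolding lo_Cons lo by (simp add: act_chain_def)
        moreover have "act y (b2 t) \<in> Q (j + 1)"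
          using chains_values[OF b2K subspace_0[OF gmod_subspace[OF gm(4)]]] by (simp add: ann_by_def)
        ultimately have F: "kdiff act (y # ys) c (False # t) \<in> Q (j + 1)"
          using Q_values[OF b(3)] subspace_add[OF sQ] by simp
        have hi: "hi (kdiff act (y # ys) c) = q2"
          unfolding hi_kdiff c_def by (simp add: kdiff_diff b2(1))
        have "kdiff act (y # ys) c (True # t) = q2 t"
          unfolding hi_Cons hi ..
        then have "kdiff act (y # ys) c (True # t) \<in> Q (j + 1)"
          using Q_values[OF b2(3)] by simp
        then show ?thesis using F Cons by (cases h) simp_all
      qed
      ultimately have "c \<in> ZC p j" unfolding cycles_def by blast
      moreover have "a = lo c" by (simp add: c_def)
      ultimately show "a \<in> lo ` ZC p j" by blast
    qed
  qed
qed

lemma hi_ker_cycles: "hi ` ker_lo (ZC p j) = ZK (p - 1) j"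
proof
  show "hi ` ker_lo (ZC p j) \<subseteq> ZK (p - 1) j"
  proof
    fix b assume "b \<in> hi ` ker_lo (ZC p j)"
    then obtain c where c: "b = hi c" "c \<in> chains p (Suc n) (P j)" "lo c = 0"
      "\<And>l. kdiff act (y # ys) c l \<in> Q (j + 1)" unfolding cycles_def by auto
    have b: "b \<in> chains (p - 1) n (P j)" using c by (simp add: chains_Suc)
    have "act y (b l) \<in> Q (j + 1)" for l
    proof -
      have "act y (b l) = lo (kdiff act (y # ys) c) l" by (simp only: lo_kd' c(1,3)) (simp add: act_chain_def)
      also have "\<dots> \<in> Q (j + 1)" using c(4)[of "False # l"] unfolding lo_Cons .
      finally show ?thesis .
    qed
    then have "b \<in> chains (p - 1) n (K j)"
      using chains_values[OF b subspace_0[OF sP]] by (intro chains_valuesI[OF b]) (simp add: ann_by_def)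
    moreover have "kdiff act ys b l \<in> Q (j + 1)" for l
    proof -
      have "kdiff act ys b l = - hi (kdiff act (y # ys) c) l" by (simp only: hi_kdiff c(1)) simp
      also have "\<dots> \<in> Q (j + 1)" using subspace_neg[OF sQ c(4)[of "True # l"]] unfolding hi_Cons .
      finally show ?thesis .
    qed
    ultimately show "b \<in> ZK (p - 1) j" unfolding cycles_def by blast
  qed
  show "ZK (p - 1) j \<subseteq> hi ` ker_lo (ZC p j)"
  proof
    fix b assume "b \<in> ZK (p - 1) j"
    then have b: "b \<in> chains (p - 1) n (K j)" "\<And>l. kdiff act ys b l \<in> Q (j + 1)"
      unfolding cycles_def by auto
    have "join 0 b \<in> chains p (length (y # ys)) (P j)"
      using b(1) chains_mono[OF KP] chains_zero[OF sP] by (auto simp: chains_Suc)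
    moreover have "kdiff act (y # ys) (join 0 b) l \<in> Q (j + 1)" for l
    proof (cases l)
      case Nil then show ?thesis using subspace_0[OF sQ] by simp
    next
      case (Cons h t)
      have "kdiff act (y # ys) (join 0 b) (False # t) = act y (b t)"
        unfolding lo_Cons by (simp only: lo_kd' join_simps kdiff_zero) (simp add: act_chain_def)
      then have "kdiff act (y # ys) (join 0 b) (False # t) \<in> Q (j + 1)"
        using chains_values[OF b(1) subspace_0[OF gmod_subspace[OF gm(4)]], of t] by (simp only: ann_by_def) simp
      moreover have "kdiff act (y # ys) (join 0 b) (True # t) = - kdiff act ys b t"
        unfolding hi_Cons by (simp only: hi_kdiff join_simps) simp
      then have "kdiff act (y # ys) (join 0 b) (True # t) \<in> Q (j + 1)"
        using subspace_neg[OF sQ b(2)] by (simp only:)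
      ultimately show ?thesis using Cons by (cases h) simp_all
    qed
    ultimately have "join 0 b \<in> ker_lo (ZC p j)"
      unfolding cycles_def by simp
    then show "b \<in> hi ` ker_lo (ZC p j)"
      by (rule image_eqI[rotated]) simp
  qed
qed

text \<open>A cycle of \<open>0 : y\<close> may become a boundary in the cone without being one
  before. The classes for which this happens form the image of the connecting homomorphism from
  \<open>A/yA\<close> in degrees \<open>p + 1\<close> and \<open>j - 1\<close>.\<close>

lemma hi_ker_boundaries:
  assumes "ZK (p - 1) j \<subseteq> BK (p - 1) j \<or>
           ZN (p + 1) (j - 1) \<subseteq> BN (p + 1) (j - 1)"
  shows "hi ` ker_lo (BC p j) = BK (p - 1) j"
proof
  show "BK (p - 1) j \<subseteq> hi ` ker_lo (BC p j)"
  proof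
    fix b assume "b \<in> BK (p - 1) j"
    then obtain e q where b: "b = kdiff act ys e + q" "e \<in> chains p n (K (j - 1))"
      "q \<in> chains (p - 1) n (Q j)" unfolding boundaries_def by auto
    have eP: "e \<in> chains p n (P (j - 1))" using b(2) chains_mono[OF KP] by blast
    \<comment> \<open>The sign compensates the one in the \<open>hi\<close> layer of
      \<open>kdiff\<close>. The chain \<open>act_chain y e\<close> cancels the \<open>lo\<close>
      part; its values lie in \<open>Q\<close> because \<open>y\<close> annihilates \<open>e\<close>
      modulo \<open>Q\<close>.\<close>
    have "join 0 (- e) \<in> chains (p + 1) (length (y # ys)) (P (j - 1))"
      using eP by (simp add: chains_Suc chains_zero[OF sP] chains_minus[OF sP])
    moreover have "join (act_chain y e) q \<in> chains p (length (y # ys)) (Q j)"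
      using b(3) act_chain_chains[OF b(2), of y "Q j"] by (simp add: chains_Suc ann_by_def)
    ultimately have "kdiff act (y # ys) (join 0 (- e)) + join (act_chain y e) q \<in> BC p j" (is "?c \<in> _")
      unfolding boundaries_def by blast
    moreover have "lo ?c = 0"
      by (simp only: lo_add lo_kd' join_simps kdiff_zero act_chain_minus) simp
    moreover have "b = hi ?c"
      by (simp only: hi_add hi_kdiff join_simps kdiff_minus b(1)) simp
    ultimately show "b \<in> hi ` ker_lo (BC p j)" by blast
  qed
  show "hi ` ker_lo (BC p j) \<subseteq> BK (p - 1) j"
  proof (cases "ZK (p - 1) j \<subseteq> BK (p - 1) j")
    case True
    have "ker_lo (BC p j) \<subseteq> ker_lo (ZC p j)"
      using boundaries_cycles[OF P Q QP, of p j] by blast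
    then have "hi ` ker_lo (BC p j) \<subseteq> hi ` ker_lo (ZC p j)"
      by (rule image_mono)
    then show ?thesis using True unfolding hi_ker_cycles by (rule subset_trans)
  next
    case False
    then have ex: "ZN (p + 1) (j - 1) \<subseteq> BN (p + 1) (j - 1)" using assms by blast
    show ?thesis
    proof
      fix b assume "b \<in> hi ` ker_lo (BC p j)"
      then obtain e q where b: "b = hi (kdiff act (y # ys) e + q)" "lo (kdiff act (y # ys) e + q) = 0"
        "e \<in> chains (p + 1) (Suc n) (P (j - 1))" "q \<in> chains p (Suc n) (Q j)"
        unfolding boundaries_def by auto
      have e: "lo e \<in> chains (p + 1) n (P (j - 1))" "hi e \<in> chains p n (P (j - 1))"
        and q: "lo q \<in> chains p n (Q j)" "hi q \<in> chains (p - 1) n (Q j)"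
        using b(3,4) by (auto simp: chains_Suc)
      have eq: "kdiff act ys (lo e) + act_chain y (hi e) + lo q = 0"
        using b(2) by (simp only: lo_add lo_kd')
      then have "kdiff act ys (lo e) = act_chain y (- hi e) + (- lo q)"
        by (simp only: act_chain_minus) (simp add: algebra_simps eq_neg_iff_add_eq_0)
      moreover have "act_chain y (- hi e) + (- lo q) \<in> chains p n (N j)"
        by (rule chains_quot_byI[OF gm(1,2)]) (use e(2) q(1) in \<open>simp_all add: chains_minus[OF sP] chains_minus[OF sQ]\<close>)
      ultimately have "kdiff act ys (lo e) \<in> chains p n (N j)" by (simp only:)
      then have "kdiff act ys (lo e) l \<in> N j" for l
        by (rule chains_values[OF _ subspace_0[OF gmod_subspace[OF gm(3)]]])
      then have "lo e \<in> ZN (p + 1) (j - 1)"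
        using e(1) unfolding cycles_def by simp
      then obtain a r where a: "lo e = kdiff act ys a + r" "r \<in> chains (p + 1) n (N (j - 1))"
        using ex unfolding boundaries_def by blast
      obtain a2 r2 where a2: "r = act_chain y a2 + r2" "a2 \<in> chains (p + 1) n (P (j - 1 - 1))"
        "r2 \<in> chains (p + 1) n (Q (j - 1))"
        by (rule chains_quot_by[OF gm(1,2) a(2)])
      have da2: "kdiff act ys a2 \<in> chains p n (P (j - 1))"
        using gmod_kdiff[OF gm(1) a2(2)] by simp
      have dr2: "kdiff act ys r2 \<in> chains p n (Q j)"
        using gmod_kdiff[OF gm(2) a2(3)] by simp
      \<comment> \<open>\<open>hi e\<close> need not be annihilated by \<open>y\<close> modulo
        \<open>Q\<close>. Writing \<open>lo e\<close> as a boundary modulo \<open>yP + Q\<close>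
        yields \<open>a2\<close>, whose differential corrects \<open>hi e\<close> without changing
        its differential.\<close>
      define w where "w = kdiff act ys a2 + hi e"
      have "kdiff act ys (lo e) = act_chain y (kdiff act ys a2) + kdiff act ys r2"
        unfolding a(1) a2(1) by (simp add: kdiff_add kdiff_act_chain)
      then have "act_chain y w + (kdiff act ys r2 + lo q) = 0"
        using eq unfolding w_def by (simp only: act_chain_add) (simp add: algebra_simps)
      then have caw: "act_chain y w = - (kdiff act ys r2 + lo q)"
        by (simp only: eq_neg_iff_add_eq_0)
      have wP: "w \<in> chains p n (P (j - 1))"
        unfolding w_def using da2 e(2) by (rule chains_add[OF sP])
      have "- (kdiff act ys r2 + lo q) \<in> chains p n (Q j)"
        using dr2 q(1) by (intro chains_minus[OF sQ] chains_add[OF sQ])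
      then have "act_chain y w l \<in> Q j" for l unfolding caw by (rule Q_values)
      then have "act y (w l) \<in> Q j" for l by (simp only: act_chain_def)
      then have "w l \<in> K (j - 1)" for l
        unfolding ann_by_def using chains_values[OF wP subspace_0[OF sP]] by simp
      then have "w \<in> chains p n (K (j - 1))" by (rule chains_valuesI[OF wP])
      then have "- w \<in> chains (p - 1 + 1) n (K (j - 1))"
        using chains_minus[OF gmod_subspace[OF gm(4)]] by simp
      moreover have "b = kdiff act ys (- w) + hi q"
        unfolding b(1) w_def by (simp only: hi_add hi_kdiff kdiff_minus kdiff_add kdiff_kdiff) simp
      ultimately show "b \<in> BK (p - 1) j"
        unfolding boundaries_def using q(2) by blast
    qed
  qed
qed

text \<open>The hypotheses kill the connecting homomorphisms on both sides, so the long exact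
  sequence of the cone breaks into a short one here. For dimensions: cycles and boundaries are each
  split by rank-nullity along \<open>lo\<close>, and \<open>hi\<close> is injective on the
  kernel.\<close>

theorem cone_dim:
  assumes "ZN p j \<subseteq> BN p j \<or>
           ZK (p - 2) (j + 1) \<subseteq> BK (p - 2) (j + 1)"
    and "ZK (p - 1) j \<subseteq> BK (p - 1) j \<or>
         ZN (p + 1) (j - 1) \<subseteq> BN (p + 1) (j - 1)"
  shows "koszul_dim s act (y # ys) p P Q j = koszul_dim s act ys p P N j + koszul_dim s act ys (p - 1) K Q j"
proof -
  have ker: "ch.dim X = ch.dim (lo ` X) + ch.dim (hi ` {c \<in> X. lo c = 0})"
    if X: "findim (chain_scale s) X" "X \<subseteq> chains p (Suc n) (P j)" for X
  proof -
    have "ch.subspace {c \<in> X. lo c = 0}"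
      using ch.findim_imp_subspace[OF X(1)] unfolding ch.subspace_def
      by (auto simp: lo_def chain_scale_def fun_eq_iff)
    then have "findim (chain_scale s) {c \<in> X. lo c = 0}" by (rule ch.findim_subspace[OF X(1)]) blast
    then have "ch.dim (hi ` {c \<in> X. lo c = 0}) = ch.dim {c \<in> X. lo c = 0}"
    proof (rule dim_image_inj[OF linear_hi])
      fix x assume "x \<in> {c \<in> X. lo c = 0}" "hi x = 0"
      then have "x [] = 0 []" "lo x = lo 0" "hi x = hi 0" using X(2) by (auto simp: chains_Suc)
      then show "x = 0" by (rule lo_hi_eqI)
    qed
    then show ?thesis using rank_nullity[OF linear_lo X(1)] by simp
  qed
  have sub: "BC p j \<subseteq> ZC p j"
    by (rule boundaries_cycles[OF P Q QP])
  have Z: "ch.dim (ZC p j) =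
      ch.dim (ZN p j) + ch.dim (ZK (p - 1) j)"
    using ker[OF findim_cycles[OF P Q], of p j] cycles_chains[of "y # ys" p P Q j]
    unfolding lo_cycles[OF assms(1)] hi_ker_cycles by simp
  have B: "ch.dim (BC p j) =
      ch.dim (BN p j) + ch.dim (BK (p - 1) j)"
    using ker[OF findim_boundaries[OF P Q], of p j] subset_trans[OF sub cycles_chains]
    unfolding lo_boundaries hi_ker_boundaries[OF assms(2)] by simp
  have "ch.dim (BN p j) \<le> ch.dim (ZN p j)"
    using ch.findim_dim_mono[OF findim_cycles[OF gm(1,3)] boundaries_cycles[OF gm(1,3) NP]] .
  moreover have "ch.dim (BK (p - 1) j) \<le> ch.dim (ZK (p - 1) j)"
    using ch.findim_dim_mono[OF findim_cycles[OF gm(4,2)] boundaries_cycles[OF gm(4,2) QK]] .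
  ultimately show ?thesis unfolding koszul_dim_def Z B by simp
qed

end

lemma koszul_dim_0_iff:
  assumes "gmod ys P" "gmod ys Q" "\<And>j. Q j \<subseteq> P j"
  shows "koszul_dim s act ys p P Q j = 0 \<longleftrightarrow> cycles act ys p P Q j \<subseteq> boundaries act ys p P Q j"
proof
  assume "koszul_dim s act ys p P Q j = 0"
  then have "ch.dim (cycles act ys p P Q j) \<le> ch.dim (boundaries act ys p P Q j)" unfolding koszul_dim_def by simp
  then have "boundaries act ys p P Q j = cycles act ys p P Q j"
    using ch.findim_dim_eq[OF findim_cycles[OF assms(1,2)] ch.findim_imp_subspace[OF findim_boundaries[OF assms(1,2)]]
      boundaries_cycles[OF assms]] by blast
  then show "cycles act ys p P Q j \<subseteq> boundaries act ys p P Q j" by simp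
next
  assume "cycles act ys p P Q j \<subseteq> boundaries act ys p P Q j"
  then have "cycles act ys p P Q j = boundaries act ys p P Q j" using boundaries_cycles[OF assms] by blast
  then show "koszul_dim s act ys p P Q j = 0" unfolding koszul_dim_def by simp
qed

end

section \<open>The polynomial ring\<close>

lemma lookup_single_mult:
  fixes p :: "('x::type, 'k::field) poly_ring"
  shows "lookup (single a c * p) (a + t) = c * lookup p t"
  by (simp add: lookup_mult lookup_single when_mult)

lemma lookup_single_mult_ne_0:
  fixes p :: "('x::type, 'k::field) poly_ring"
  assumes "lookup (single a c * p) s \<noteq> 0"
  obtains t where "s = a + t" "t \<in> keys p"
proof -
  have "s \<in> keys (single a c * p)" using assms by (simp add: in_keys_iff)
  then show ?thesis
    using keys_mult[of "single a c" p] that by (auto split: if_splits)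
qed

lemma poly_mapping_sum_singles:
  "p = (\<Sum>t\<in>keys p. single t (lookup p t))"
proof (rule poly_mapping_eqI)
  fix k
  show "lookup p k =
    lookup (\<Sum>t\<in>keys p. single t (lookup p t)) k"
    by (simp add: lookup_sum lookup_single when_def in_keys_iff)
qed

lemma mdeg_add [simp]: "mdeg (s + t) = mdeg s + mdeg t"
  by (simp add: mdeg_def lookup_add sum.distrib)

lemma mdeg_single [simp]: "mdeg (single x k) = k"
  by (simp add: mdeg_def lookup_single when_def)

lemma mdeg_zero [simp]: "mdeg 0 = 0"
  by (simp add: mdeg_def)

lemma mdeg_eq_1:
  assumes "mdeg t = 1"
  obtains x where "t = single x 1"
proof -
  obtain x where x: "lookup t x > 0"
    using assms by (metis bot_nat_0.not_eq_extremum mdeg_zero poly_mapping_eqI lookup_zero zero_neq_one)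
  have "mdeg t = lookup t x + (\<Sum>y\<in>UNIV - {x}. lookup t y)"
    unfolding mdeg_def by (rule sum.remove) simp_all
  then have "lookup t x = 1" "(\<Sum>y\<in>UNIV - {x}. lookup t y) = 0"
    using x assms by linarith+
  then have "t = single x 1"
    by (intro poly_mapping_eqI) (auto simp: lookup_single when_def)
  then show ?thesis by (rule that)
qed

lemma bij_betw_monomials:
  fixes xs :: "'x::finite list"
  assumes xs: "set xs = UNIV" "distinct xs"
  shows "bij_betw (\<lambda>t. map (lookup t) xs) {t :: 'x \<Rightarrow>\<^sub>0 nat. mdeg t = j}
    {l. length l = CARD('x) \<and> sum_list l = j}"
proof (rule bij_betw_imageI)
  have len: "length xs = CARD('x)" using xs by (metis distinct_card)
  have deg: "sum_list (map (lookup t) xs) = mdeg t" for t :: "'x \<Rightarrow>\<^sub>0 nat"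
    unfolding mdeg_def using xs by (metis sum_list_distinct_conv_sum_set)
  show "inj_on (\<lambda>t. map (lookup t) xs) {t :: 'x \<Rightarrow>\<^sub>0 nat. mdeg t = j}"
    by (rule inj_onI) (metis UNIV_I map_eq_conv poly_mapping_eqI xs(1))
  show "(\<lambda>t. map (lookup t) xs) ` {t :: 'x \<Rightarrow>\<^sub>0 nat. mdeg t = j} =
    {l. length l = CARD('x) \<and> sum_list l = j}"
  proof (intro equalityI subsetI)
    fix l assume "l \<in> {l. length l = CARD('x) \<and> sum_list l = j}"
    then have l: "length l = length xs" "sum_list l = j" using len by auto
    define t where "t = Abs_poly_mapping (\<lambda>x. the (map_of (zip xs l) x))"
    have "lookup t = (\<lambda>x. the (map_of (zip xs l) x))"
      unfolding t_def by simp
    then have "map (lookup t) xs = l"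
      using l(1) xs(2) by (auto intro!: nth_equalityI simp: map_of_zip_nth)
    then show "l \<in> (\<lambda>t. map (lookup t) xs) ` {t :: 'x \<Rightarrow>\<^sub>0 nat. mdeg t = j}"
      using deg[of t] l(2) by (intro image_eqI[of _ _ t]) simp_all
  qed (use deg len in auto)
qed

lemma card_monomials:
  assumes "CARD('x::finite) = n + 1"
  shows "finite {t :: 'x \<Rightarrow>\<^sub>0 nat. mdeg t = j} \<and> card {t :: 'x \<Rightarrow>\<^sub>0 nat. mdeg t = j} = (n + j) choose n"
proof -
  obtain xs :: "'x list" where xs: "set xs = UNIV" "distinct xs"
    using finite_distinct_list[of "UNIV :: 'x set"] by auto
  note bij = bij_betw_monomials[OF xs, of j]
  have "finite {l :: nat list. set l \<subseteq> {..j} \<and> length l = CARD('x)}"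
    by (rule finite_lists_length_eq) simp
  then have "finite {l :: nat list. length l = CARD('x) \<and> sum_list l = j}"
    by (rule rev_finite_subset) (auto simp: member_le_sum_list)
  moreover have "card {l :: nat list. length l = CARD('x) \<and> sum_list l = j} = (n + j) choose n"
    using binomial_symmetric[of n "j + n"] unfolding card_length_sum_list assms by (simp add: add.commute)
  ultimately show ?thesis
    using bij_betw_finite[OF bij] bij_betw_same_card[OF bij] by simp
qed

lemma finite_monomials: "finite {t :: 'x::finite \<Rightarrow>\<^sub>0 nat. mdeg t = j}"
  using card_monomials[where 'x='x, of "CARD('x) - 1" j] by simp

lemma dim_supported:
  assumes "finite T"
  shows "findim scale {p :: 'b \<Rightarrow>\<^sub>0 'k::field. keys p \<subseteq> T}"
    and "vs.dim {p :: 'b \<Rightarrow>\<^sub>0 'k::field. keys p \<subseteq> T} = card T"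
proof -
  let ?V = "{p :: 'b \<Rightarrow>\<^sub>0 'k. keys p \<subseteq> T}"
  let ?e = "\<lambda>t. single t (1::'k)"
  have sub: "vs.subspace ?V"
    unfolding vs.subspace_def by (auto simp: in_keys_iff subset_iff lookup_add) (metis add_0)
  have span: "?V \<subseteq> vs.span (?e ` T)"
  proof
    fix p assume p: "p \<in> ?V"
    have "p = (\<Sum>t\<in>keys p. scale (lookup p t) (?e t))"
      using poly_mapping_sum_singles[of p] by (simp add: scale_def)
    also have "\<dots> \<in> vs.span (?e ` T)"
      using p by (intro vs.span_sum vs.span_scale vs.span_base) auto
    finally show "p \<in> vs.span (?e ` T)" .
  qed
  have inj: "inj_on ?e T"
    by (rule inj_onI) (metis lookup_single_eq lookup_single_not_eq zero_neq_one)
  have "vs.independent (?e ` T)"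
  proof (subst vs.dependent_finite)
    show "\<not> (\<exists>u. (\<exists>v\<in>?e ` T. u v \<noteq> 0) \<and> (\<Sum>v\<in>?e ` T. scale (u v) v) = 0)"
    proof (rule notI, elim exE conjE bexE imageE)
      fix u v t
      assume *: "(\<Sum>v\<in>?e ` T. scale (u v) v) = 0" and v: "u v \<noteq> 0" "v = ?e t" and t: "t \<in> T"
      have "0 = lookup (\<Sum>v\<in>?e ` T. scale (u v) v) t" by (simp add: *)
      also have "\<dots> = u (?e t)"
        using t assms by (simp add: sum.reindex[OF inj] lookup_sum lookup_single when_def if_distrib[of "(*) _"] cong: if_cong)
      finally show False using v by simp
    qed
  qed (use assms in simp)
  then have "card (?e ` T) = vs.dim ?V"
    by (intro vs.basis_card_eq_dim span) auto
  then show "vs.dim ?V = card T" using card_image[OF inj] by simp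
  show "findim scale ?V"
    unfolding findim_def using vs.vector_space_axioms sub span assms by blast
qed

global_interpretation RK: kmod "scale :: 'k::field \<Rightarrow> ('x::type, 'k) poly_ring \<Rightarrow> _" "(*)"
  by unfold_locales (auto simp: algebra_simps scale_def mult_map_scale_conv_mult)

text \<open>Integer degrees, with zero in the negative ones, so that the shifts \<open>j - 1\<close>
  and \<open>j - int (fst b)\<close> need no side conditions.\<close>

definition poly_part :: "int \<Rightarrow> ('x::finite, 'k::field) poly_ring set" where
  "poly_part j = {p. \<forall>t\<in>keys p. int (mdeg t) = j}"

lemma poly_part_forms: "poly_part (int j) = forms j"
  by (simp add: poly_part_def forms_def)

lemma poly_part_neg: "j < 0 \<Longrightarrow> poly_part j = {0}"
  by (auto simp: poly_part_def simp flip: keys_eq_empty)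

lemma poly_part_supported: "poly_part j = {p. keys p \<subseteq> {t. int (mdeg t) = j}}"
  by (auto simp: poly_part_def)

lemma finite_monomials_int: "finite {t :: 'x::finite \<Rightarrow>\<^sub>0 nat. int (mdeg t) = j}"
proof -
  have "finite {t :: 'x \<Rightarrow>\<^sub>0 nat. mdeg t = nat j}" by (rule finite_monomials)
  then show ?thesis by (rule rev_finite_subset) auto
qed

lemma findim_poly_part: "findim scale (poly_part j :: ('x::finite, 'k::field) poly_ring set)"
  unfolding poly_part_supported by (rule dim_supported(1)[OF finite_monomials_int])

lemma dim_forms:
  assumes "CARD('x::finite) = n + 1"
  shows "vs.dim (forms j :: ('x, 'k::field) poly_ring set) = (n + j) choose n"
proof -
  have "forms j = {p :: ('x, 'k) poly_ring. keys p \<subseteq> {t. mdeg t = j}}"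
    by (auto simp: forms_def)
  then show ?thesis
    using dim_supported(2)[OF finite_monomials[where 'x='x and j=j], where 'k='k] card_monomials[OF assms, of j] by simp
qed

lemma subspace_poly_part: "vs.subspace (poly_part j)"
  using vs.findim_imp_subspace[OF findim_poly_part] .

lemma poly_part_mult: "p \<in> poly_part i \<Longrightarrow> q \<in> poly_part j \<Longrightarrow> p * q \<in> poly_part (i + j)"
  using keys_mult[of p q] unfolding poly_part_def by fastforce

definition var :: "'x \<Rightarrow> ('x, 'k::field) poly_ring" where
  "var x = single (single x 1) 1"

lemma var_poly_part: "var x \<in> poly_part 1"
  by (simp add: poly_part_def var_def)

lemma gmod_poly_part:
  assumes "set ys \<subseteq> (poly_part 1 :: ('x::finite, 'k::field) poly_ring set)"
  shows "RK.gmod ys poly_part"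
  unfolding RK.gmod_def
proof (intro conjI allI ballI)
  fix y v :: "('x, 'k) poly_ring" and j assume "y \<in> set ys" "v \<in> poly_part j"
  then show "y * v \<in> poly_part (j + 1)"
    using poly_part_mult[of y 1 v j] assms by (auto simp: add.commute)
qed (rule findim_poly_part)

section \<open>Ideals generated by variables and a linear form\<close>

text \<open>The ideal generated by the variables in \<open>X\<close>, described by supports so that
  membership is tested monomial by monomial. It is zero for \<open>X = {}\<close> and consists of
  the polynomials without constant term for \<open>X = UNIV\<close>.\<close>

definition mon_ideal :: "'x set \<Rightarrow> ('x, 'k::field) poly_ring set" where
  "mon_ideal X = {p. \<forall>t\<in>keys p. \<exists>x\<in>X. lookup t x > 0}"

definition mon_part :: "'x::finite set \<Rightarrow> int \<Rightarrow> ('x, 'k::field) poly_ring set" where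
  "mon_part X j = mon_ideal X \<inter> poly_part j"

lemma mon_ideal_alt: "p \<in> mon_ideal X \<longleftrightarrow> (\<forall>t. lookup p t \<noteq> 0 \<longrightarrow> (\<exists>x\<in>X. lookup t x > 0))"
  unfolding mon_ideal_def by (auto simp: in_keys_iff)

lemma subspace_mon_ideal: "vs.subspace (mon_ideal X :: ('x, 'k::field) poly_ring set)"
  unfolding vs.subspace_def
proof (intro conjI ballI allI)
  show "0 \<in> mon_ideal X" by (simp add: mon_ideal_def)
next
  fix p q :: "('x, 'k) poly_ring" assume "p \<in> mon_ideal X" "q \<in> mon_ideal X"
  then show "p + q \<in> mon_ideal X"
    using keys_add[of p q] unfolding mon_ideal_def by blast
next
  fix c and p :: "('x, 'k) poly_ring" assume "p \<in> mon_ideal X"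
  then show "scale c p \<in> mon_ideal X" by (simp add: mon_ideal_alt)
qed

lemma mon_ideal_mult:
  assumes "q \<in> mon_ideal X"
  shows "p * q \<in> mon_ideal X"
  unfolding mon_ideal_def
proof (intro CollectI ballI)
  fix t assume "t \<in> keys (p * q)"
  then obtain a b where "t = a + b" "b \<in> keys q" using keys_mult[of p q] by blast
  then show "\<exists>x\<in>X. lookup t x > 0"
    using assms unfolding mon_ideal_def by (auto simp: lookup_add dest!: bspec[of _ _ b])
qed

lemma mon_part_empty: "mon_part {} j = {0}"
  unfolding mon_part_def mon_ideal_def poly_part_def by (auto simp: keys_eq_empty)

lemma gmod_mon_part:
  assumes "set ys \<subseteq> poly_part 1"
  shows "RK.gmod ys (mon_part X :: int \<Rightarrow> ('x::finite, 'k::field) poly_ring set)"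
  unfolding RK.gmod_def
proof safe
  fix j
  show "findim scale (mon_part X j :: ('x::finite, 'k::field) poly_ring set)"
    by (rule vs.findim_subspace[OF findim_poly_part[of j]])
      (auto simp: mon_part_def vs.subspace_inter subspace_mon_ideal subspace_poly_part)
next
  fix y v :: "('x, 'k) poly_ring" and j
  assume "y \<in> set ys" "v \<in> mon_part X j"
  then show "y * v \<in> mon_part X (j + 1)"
    using assms mon_ideal_mult poly_part_mult[of y 1 v j] unfolding mon_part_def by (auto simp: add.commute)
qed

lemma mon_part_le: "mon_part X j \<subseteq> poly_part j" by (simp add: mon_part_def)

lemma var_regular:
  assumes "x \<notin> X" "var x * p \<in> mon_ideal X"
  shows "p \<in> mon_ideal X"
  unfolding mon_ideal_alt
proof (intro allI impI)
  fix t assume "lookup p t \<noteq> 0"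
  then have "lookup (var x * p) (single x 1 + t) \<noteq> 0"
    unfolding var_def lookup_single_mult by simp
  then obtain y where "y \<in> X" "lookup (single x 1 + t) y > 0"
    using assms(2) unfolding mon_ideal_alt by blast
  then show "\<exists>x\<in>X. lookup t x > 0"
    using assms(1) by (intro bexI[of _ y]) (auto simp: lookup_add lookup_single when_def split: if_splits)
qed

lemma linear_form_expand:
  assumes "g \<in> (poly_part 1 :: ('x::finite, 'k::field) poly_ring set)"
  shows "g = (\<Sum>x\<in>UNIV. single (single x 1) (lookup g (single x 1)))"
proof (rule poly_mapping_eqI)
  fix t
  let ?c = "\<lambda>x. lookup g (single x 1)"
  have inj: "single x (1::nat) = single y 1 \<longleftrightarrow> x = y" for x y :: 'x
    by (metis lookup_single_eq lookup_single_not_eq zero_neq_one)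
  show "lookup g t = lookup (\<Sum>x\<in>UNIV. single (single x 1) (?c x)) t"
  proof (cases "\<exists>y. t = single y 1")
    case True
    then obtain y where "t = single y 1" by blast
    then show ?thesis by (simp add: lookup_sum lookup_single when_def inj[unfolded One_nat_def])
  next
    case False
    then have "mdeg t \<noteq> 1" using mdeg_eq_1 by blast
    then have "lookup g t = 0"
      using assms unfolding poly_part_def by (auto simp: in_keys_iff)
    moreover have "lookup (single (single x 1) (?c x)) t = 0" for x
      using False by (auto simp: lookup_single when_def)
    ultimately show ?thesis by (simp add: lookup_sum)
  qed
qed

text \<open>Among the monomials of \<open>p\<close> outside the monomial ideal, one with the largest exponent of the
  variable \<open>x0\<close> survives the multiplication by \<open>g\<close>.\<close>

lemma linear_form_regular:
  fixes g p :: "('x::finite, 'k::field) poly_ring"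
  assumes g: "g \<in> poly_part 1" "lookup g (single x0 1) \<noteq> 0"
    and x0: "x0 \<notin> X" and gp: "g * p \<in> mon_ideal X"
  shows "p \<in> mon_ideal X"
proof (rule ccontr)
  assume "p \<notin> mon_ideal X"
  define B where "B = {t \<in> keys p. \<forall>x\<in>X. lookup t x = 0}"
  have "finite B" "B \<noteq> {}"
    using \<open>p \<notin> mon_ideal X\<close> unfolding B_def mon_ideal_def by auto
  then obtain t where t: "t \<in> B" "\<And>t'. t' \<in> B \<Longrightarrow> lookup t' x0 \<le> lookup t x0"
    using arg_max_nat_lemma[of "\<lambda>t. t \<in> B" _ "\<lambda>t. lookup t x0" "Suc (Max ((\<lambda>t. lookup t x0) ` B))"]
    by (metis (no_types, lifting) Max_ge ex_in_conv finite_imageI imageI le_imp_less_Suc)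
  let ?e = "\<lambda>x. single x (1::nat)"
  let ?c = "\<lambda>x. lookup g (?e x)"
  let ?s = "?e x0 + t"
  have zero: "lookup (single (?e x) (?c x) * p) ?s = 0" if "x \<noteq> x0" for x
  proof (rule ccontr)
    assume "\<not> ?thesis"
    then obtain t' where t': "?s = ?e x + t'" "t' \<in> keys p"
      by (rule lookup_single_mult_ne_0)
    have l: "lookup (?e x0) y + lookup t y = lookup (?e x) y + lookup t' y" for y
      using arg_cong[OF t'(1), of "\<lambda>s. lookup s y"] by (simp add: lookup_add)
    have "lookup t' x0 > lookup t x0"
      using l[of x0] that by (simp add: lookup_single)
    then have "t' \<notin> B" using t(2)[of t'] by auto
    then obtain y where "y \<in> X" "lookup t' y > 0" using t'(2) unfolding B_def by auto
    then show False
      using l[of y] x0 t(1) unfolding B_def by (auto simp: lookup_single when_def split: if_splits)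
  qed
  have "lookup (g * p) ?s =
      (\<Sum>x\<in>UNIV. lookup (single (?e x) (?c x) * p) ?s)"
    by (subst linear_form_expand[OF g(1)]) (simp only: sum_distrib_right lookup_sum)
  also have "\<dots> = lookup (single (?e x0) (?c x0) * p) ?s"
    using zero by (subst sum.remove[of _ x0]) simp_all
  also have "\<dots> \<noteq> 0"
    using g(2) t(1) unfolding lookup_single_mult B_def by (simp add: in_keys_iff)
  finally obtain y where "y \<in> X" "lookup ?s y > 0"
    using gp unfolding mon_ideal_alt by blast
  then show False
    using x0 t(1) unfolding B_def by (auto simp: lookup_add lookup_single when_def split: if_splits)
qed

lemma quot_by_var_mon_part:
  fixes x :: "'x::finite"
  shows "RK.quot_by (var x) poly_part (mon_part X) = (mon_part (insert x X) :: int \<Rightarrow> ('x, 'k::field) poly_ring set)"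
proof (rule ext, rule equalityI)
  fix j
  have gm: "RK.gmod [var x] (RK.quot_by (var x) poly_part (mon_part X) :: int \<Rightarrow> ('x, 'k) poly_ring set)"
    by (rule RK.gmod_quot_by) (simp_all add: gmod_poly_part gmod_mon_part var_poly_part)
  show "RK.quot_by (var x) poly_part (mon_part X) j \<subseteq> (mon_part (insert x X) j :: ('x, 'k) poly_ring set)"
  proof
    fix v :: "('x, 'k) poly_ring" assume "v \<in> RK.quot_by (var x) poly_part (mon_part X) j"
    then obtain a q where v: "v = var x * a + q" "a \<in> poly_part (j - 1)" "q \<in> mon_part X j"
      unfolding RK.quot_by_def by blast
    have "var x \<in> mon_ideal (insert x X)" by (simp add: mon_ideal_def var_def)
    then have "var x * a \<in> mon_ideal (insert x X)"
      using mon_ideal_mult[of "var x" _ a] by (simp add: mult.commute)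
    moreover have "q \<in> mon_ideal (insert x X)" using v(3) unfolding mon_part_def mon_ideal_def by blast
    moreover have "var x * a \<in> poly_part j" using poly_part_mult[OF var_poly_part v(2), of x] by simp
    moreover have "q \<in> poly_part j" using v(3) by (simp add: mon_part_def)
    ultimately show "v \<in> mon_part (insert x X) j"
      unfolding v(1) mon_part_def by (simp add: vs.subspace_add subspace_mon_ideal subspace_poly_part)
  qed
  show "(mon_part (insert x X) j :: ('x, 'k) poly_ring set) \<subseteq> RK.quot_by (var x) poly_part (mon_part X) j"
  proof
    fix p :: "('x, 'k) poly_ring" assume p: "p \<in> mon_part (insert x X) j"
    have "single t (lookup p t) \<in> RK.quot_by (var x) poly_part (mon_part X) j"
      if t: "t \<in> keys p" for t
    proof (cases "lookup t x > 0")
      case True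
      let ?t = "t - single x 1"
      have tt: "t = single x 1 + ?t"
        using True by (intro poly_mapping_eqI) (auto simp: lookup_add lookup_minus lookup_single when_def)
      have "int (mdeg t) = j" using p t by (simp add: mon_part_def poly_part_def)
      then have "single ?t (lookup p t) \<in> poly_part (j - 1)"
        using arg_cong[OF tt, of mdeg] by (auto simp: poly_part_def)
      moreover have "single t (lookup p t) =
          var x * single ?t (lookup p t) + 0"
        using tt by (simp add: var_def mult_single)
      moreover have "0 \<in> mon_part X j" by (simp add: mon_part_def mon_ideal_def poly_part_def)
      ultimately show ?thesis by (metis RK.quot_byI)
    next
      case False
      then have "single t (lookup p t) \<in> mon_part X j"
        using p t by (auto simp: mon_part_def mon_ideal_def poly_part_def)
      moreover have "0 \<in> poly_part (j - 1)" by (simp add: poly_part_def)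
      ultimately have "var x * 0 + single t (lookup p t) \<in> RK.quot_by (var x) poly_part (mon_part X) j"
        by (intro RK.quot_byI)
      then show ?thesis by simp
    qed
    then have "(\<Sum>t\<in>keys p. single t (lookup p t)) \<in> RK.quot_by (var x) poly_part (mon_part X) j"
      by (intro vs.subspace_sum[OF RK.gmod_subspace[OF gm]])
    then show "p \<in> RK.quot_by (var x) poly_part (mon_part X) j"
      using poly_mapping_sum_singles[of p] by simp
  qed
qed

section \<open>Regular sequences and the vanishing of Koszul homology\<close>

context kmod
begin

lemma quot_by_le: 
  assumes "gmod (y # ys) P" "\<And>j. Q j \<subseteq> P j"
  shows "quot_by y P Q j \<subseteq> P j"
  unfolding quot_by_def using gmod_act'[OF assms(1), of y] assms(2) subspace_add[OF gmod_subspace[OF assms(1)]]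
  by (auto simp: subset_iff)

lemma koszul_dim_trivial:
  assumes "gmod ys P" "gmod ys Q" "\<And>j. Q j \<subseteq> P j" "P j = Q j"
  shows "koszul_dim s act ys p P Q j = 0"
  using cycles_chains[of ys p P Q j] chains_boundaries[OF assms(1), of p Q j] assms(4)
  by (subst koszul_dim_0_iff[OF assms(1-3)]) simp

text \<open>If \<open>y\<close> is a nonzerodivisor on \<open>P/Q\<close>, the annihilator end of
  the cone vanishes and only the homology of \<open>P / (yP + Q)\<close> is left.\<close>

lemma cone_exact:
  assumes P: "gmod (y # ys) P" and Q: "gmod (y # ys) Q" and QP: "\<And>j. Q j \<subseteq> P j"
    and ann: "ann_by y P Q = Q" and N: "koszul_dim s act ys p P (quot_by y P Q) j = 0"
  shows "koszul_dim s act (y # ys) p P Q j = 0"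
proof -
  note gP = gmod_tl[OF P] and gQ = gmod_tl[OF Q]
  have K: "koszul_dim s act ys q Q Q i = 0" for q i by (rule koszul_dim_trivial[OF gQ gQ]) simp_all
  have "koszul_dim s act (y # ys) p P Q j = koszul_dim s act ys p P (quot_by y P Q) j + koszul_dim s act ys (p - 1) Q Q j"
    using koszul_dim_0_iff[OF gP gmod_quot_by[OF gP gQ] quot_by_le[OF P QP], THEN iffD1, OF N]
      koszul_dim_0_iff[OF gQ gQ order_refl, THEN iffD1, OF K]
    by (intro cone_dim[OF P Q QP, unfolded ann]) blast+
  then show ?thesis using N K by simp
qed

lemma koszul_dim_Nil:
  assumes "gmod [] P" "gmod [] Q" "\<And>j. Q j \<subseteq> P j" "p \<noteq> 0"
  shows "koszul_dim s act [] p P Q j = 0"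
proof (subst koszul_dim_0_iff[OF assms(1-3)])
  show "cycles act [] p P Q j \<subseteq> boundaries act [] p P Q j"
  proof
    fix c assume "c \<in> cycles act [] p P Q j"
    then have "c \<in> chains p 0 (P j)" unfolding cycles_def by simp
    then have "c l = 0" for l using assms(4) by (cases "l = []") (simp_all add: chains_0)
    then have "c = 0" by auto
    then show "c \<in> boundaries act [] p P Q j"
      using ch.subspace_0[OF ch.findim_imp_subspace[OF findim_boundaries[OF assms(1,2)]]] by simp
  qed
qed

lemma quot_by_commute: "quot_by a P (quot_by b P Q) = quot_by b P (quot_by a P Q)"
proof -
  have "quot_by a P (quot_by b P Q) j \<subseteq> quot_by b P (quot_by a P Q) j" for a b j
  proof
    fix v assume "v \<in> quot_by a P (quot_by b P Q) j"
    then obtain x y q where v: "v = act a x + (act b y + q)" "x \<in> P (j - 1)" "y \<in> P (j - 1)" "q \<in> Q j"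
      unfolding quot_by_def by blast
    have "v = act b y + (act a x + q)" unfolding v(1) by simp
    then show "v \<in> quot_by b P (quot_by a P Q) j"
      using v(2-4) by (metis quot_byI)
  qed
  then show ?thesis by (intro ext equalityI)
qed

end

context
  fixes g :: "('x::finite, 'k::field) poly_ring" and x0
  assumes g: "g \<in> poly_part 1" "lookup g (single x0 1) \<noteq> 0"
begin

private abbreviation "J X \<equiv> RK.quot_by g poly_part (mon_part X)"

private lemma gmod_J: "set ys \<subseteq> poly_part 1 \<Longrightarrow> RK.gmod ys (J X)"
  by (rule RK.gmod_quot_by) (simp_all add: gmod_poly_part gmod_mon_part)

private lemma J_le: "J X j \<subseteq> poly_part j"
  by (rule RK.quot_by_le[of _ "[]"]) (simp_all add: gmod_poly_part g mon_part_le)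

text \<open>If \<open>x v = g q + m\<close>, then \<open>g q\<close> vanishes modulo
  \<open>x\<close> and \<open>X\<close>. There \<open>g\<close> is still regular, because its
  \<open>x0\<close>-term survives, so \<open>q = x a + b\<close> with \<open>b\<close> in the ideal
  of \<open>X\<close>. Now \<open>x (v - g a)\<close> lies in that ideal, and \<open>x\<close> can
  be cancelled.\<close>

private lemma ann_by_J:
  assumes "x \<notin> X" "x \<noteq> x0" "x0 \<notin> X"
  shows "RK.ann_by (var x) poly_part (J X) = J X"
proof (intro ext equalityI subsetI)
  fix j v assume "v \<in> RK.ann_by (var x) poly_part (J X) j"
  then obtain q m where v: "v \<in> poly_part j" "var x * v = g * q + m" "q \<in> poly_part j" "m \<in> mon_part X (j + 1)"
    unfolding RK.ann_by_def RK.quot_by_def by auto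
  have *: "m \<in> mon_ideal (insert x X)" using v(4) unfolding mon_part_def mon_ideal_def by blast
  have "var x \<in> mon_ideal (insert x X)" by (simp add: mon_ideal_def var_def)
  then have "var x * v \<in> mon_ideal (insert x X)"
    using mon_ideal_mult[of "var x" _ v] by (simp add: mult.commute)
  then have "g * q \<in> mon_ideal (insert x X)"
    using * v(2) vs.subspace_diff[OF subspace_mon_ideal, of "var x * v" "insert x X" m] by simp
  then have "q \<in> mon_part (insert x X) j"
    using linear_form_regular[OF g, of "insert x X" q] assms(2,3) v(3) by (auto simp: mon_part_def)
  then obtain a b where q: "q = var x * a + b" "a \<in> poly_part (j - 1)" "b \<in> mon_part X j"
    unfolding quot_by_var_mon_part[symmetric] RK.quot_by_def by blast
  have "var x * (v - g * a) = m + g * b"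
    unfolding right_diff_distrib v(2) q(1) distrib_left mult.left_commute[of g "var x"] by simp
  moreover have "m + g * b \<in> mon_ideal X"
    using v(4) q(3) by (intro vs.subspace_add[OF subspace_mon_ideal] mon_ideal_mult) (auto simp: mon_part_def)
  ultimately have "var x * (v - g * a) \<in> mon_ideal X" by (simp only:)
  then have "v - g * a \<in> mon_ideal X" by (rule var_regular[OF assms(1)])
  moreover have "v - g * a \<in> poly_part j"
    using v(1) poly_part_mult[OF g(1) q(2)] by (intro vs.subspace_diff[OF subspace_poly_part]) simp_all
  ultimately have "g * a + (v - g * a) \<in> J X j"
    using q(2) by (intro RK.quot_byI) (simp_all add: mon_part_def)
  then show "v \<in> J X j" by simp
next
  fix j v assume v: "v \<in> J X j"
  have "RK.gmod [var x] (J X)" by (rule gmod_J) (simp add: var_poly_part)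
  then have "var x * v \<in> J X (j + 1)" using v unfolding RK.gmod_def by simp
  then show "v \<in> RK.ann_by (var x) poly_part (J X) j"
    using v J_le[of X j] unfolding RK.ann_by_def by blast
qed

text \<open>The variables other than \<open>x0\<close> form a regular sequence on
  \<open>R/gR\<close>. The set \<open>X\<close> collects the variables already divided out, which is
  why the induction generalises over it.\<close>

lemma koszul_dim_mod_linear_form:
  assumes "distinct xs" "x0 \<notin> set xs" "x0 \<notin> X" "set xs \<inter> X = {}" "p \<ge> 1"
  shows "koszul_dim scale (*) (map var xs) p poly_part (J X) j = 0"
  using assms
proof (induction xs arbitrary: X p j)
  case Nil
  then show ?case by (simp add: RK.koszul_dim_Nil gmod_J gmod_poly_part J_le)
next
  case (Cons x xs)
  have gP: "RK.gmod (var x # map var xs) (poly_part :: int \<Rightarrow> ('x, 'k) poly_ring set)"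
    and gJ: "RK.gmod (var x # map var xs) (J X)"
    by (auto intro!: gmod_poly_part gmod_J simp: var_poly_part)
  have ann: "RK.ann_by (var x) poly_part (J X) = J X"
    using Cons.prems by (intro ann_by_J) auto
  have quot: "RK.quot_by (var x) poly_part (J X) = J (insert x X)"
    by (simp add: RK.quot_by_commute[of "var x"] quot_by_var_mon_part)
  have "koszul_dim scale (*) (map var xs) p poly_part (J (insert x X)) j = 0"
    using Cons.prems by (intro Cons.IH) auto
  then show ?case
    unfolding list.map by (intro RK.cone_exact[OF gP gJ J_le ann]) (simp add: quot)
qed

lemma ann_by_linear_form: "RK.ann_by g poly_part (mon_part {}) = mon_part {}"
proof (intro ext equalityI subsetI)
  fix j v assume "v \<in> RK.ann_by g poly_part (mon_part {}) j"
  then have "v \<in> poly_part j" "g * v \<in> mon_ideal {}" unfolding RK.ann_by_def mon_part_def by auto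
  then show "v \<in> mon_part {} j"
    using linear_form_regular[OF g, of "{}" v] by (simp add: mon_part_def)
next
  fix j and v :: "('x, 'k) poly_ring" assume "v \<in> mon_part {} j"
  then have "v = 0" by (simp add: mon_part_empty)
  then show "v \<in> RK.ann_by g poly_part (mon_part {}) j"
    by (simp add: RK.ann_by_def mon_part_empty poly_part_def)
qed

text \<open>As \<open>g\<close> is regular on \<open>R\<close> itself, \<open>g\<close> followed by
  the variables other than \<open>x0\<close> is a regular sequence, and its Koszul complex is
  acyclic in positive degrees.\<close>

lemma koszul_dim_poly_ring:
  assumes "distinct xs" "x0 \<notin> set xs" "p \<ge> 1"
  shows "koszul_dim scale (*) (g # map var xs) p poly_part (mon_part {}) j = 0"
proof -
  have gP: "RK.gmod (g # map var xs) (poly_part :: int \<Rightarrow> ('x, 'k) poly_ring set)"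
    and gM: "RK.gmod (g # map var xs) (mon_part {} :: int \<Rightarrow> ('x, 'k) poly_ring set)"
    by (auto intro!: gmod_poly_part gmod_mon_part simp: var_poly_part g)
  have "koszul_dim scale (*) (map var xs) p poly_part (J {}) j = 0"
    using assms by (intro koszul_dim_mod_linear_form) auto
  then show ?thesis by (rule RK.cone_exact[OF gP gM mon_part_le ann_by_linear_form])
qed

end

section \<open>Graded free modules\<close>

definition scaleK :: "'k::field \<Rightarrow> ('b \<Rightarrow>\<^sub>0 ('x, 'k) poly_ring) \<Rightarrow> ('b \<Rightarrow>\<^sub>0 ('x, 'k) poly_ring)" where
  "scaleK c = scale (single 0 c)"

lemma lookup_scaleK [simp]: "lookup (scaleK c v) b = scale c (lookup v b)"
  by (simp add: scaleK_def) (simp add: scale_def mult_map_scale_conv_mult)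

lemma module_scale: "module (scale :: 'r::comm_ring_1 \<Rightarrow> ('b \<Rightarrow>\<^sub>0 'r) \<Rightarrow> _)"
  by (rule module.intro) (auto intro!: poly_mapping_eqI simp: lookup_add distrib_left distrib_right mult.assoc)

lemma vector_space_scaleK: "vector_space (scaleK :: 'k::field \<Rightarrow> ('b \<Rightarrow>\<^sub>0 ('x::type, 'k) poly_ring) \<Rightarrow> _)"
proof -
  interpret M: module "scale :: ('x, 'k) poly_ring \<Rightarrow> ('b \<Rightarrow>\<^sub>0 ('x, 'k) poly_ring) \<Rightarrow> _"
    by (rule module_scale)
  show ?thesis
    by (rule vector_space.intro)
      (simp_all only: scaleK_def single_add M.scale_left_distrib M.scale_right_distrib M.scale_scale
        mult_single add_0_left M.scale_one single_one)
qed

global_interpretation FK: kmod "scaleK :: 'k::field \<Rightarrow> ('b \<Rightarrow>\<^sub>0 ('x::type, 'k) poly_ring) \<Rightarrow> _"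
  "scale :: ('x, 'k) poly_ring \<Rightarrow> ('b \<Rightarrow>\<^sub>0 ('x, 'k) poly_ring) \<Rightarrow> _"
proof (intro kmod.intro kmod_axioms.intro vector_space_scaleK module_scale)
  fix r :: "('x, 'k) poly_ring" and c and v :: "'b \<Rightarrow>\<^sub>0 ('x, 'k) poly_ring"
  show "scale r (scaleK c v) = scaleK c (scale r v)"
    by (rule poly_mapping_eqI) (simp only: scaleK_def lookup_scale mult.left_commute)
qed

type_synonym ('x, 'k) free_elt = "nat \<times> nat \<Rightarrow>\<^sub>0 ('x, 'k) poly_ring"

definition free_part :: "(nat \<Rightarrow> nat) \<Rightarrow> int \<Rightarrow> ('x::finite, 'k::field) free_elt set" where
  "free_part r j = {v \<in> free_mod r. \<forall>b. lookup v b \<in> poly_part (j - int (fst b))}"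

lemma free_part_lookup: "v \<in> free_part r j \<Longrightarrow> lookup v b \<in> poly_part (j - int (fst b))"
  unfolding free_part_def by blast

lemma free_part_eq_free_mod_part: "free_part r (int m) = free_mod_part r m"
proof -
  have "(\<forall>b. lookup v b \<in> poly_part (int m - int (fst b))) \<longleftrightarrow>
    (\<forall>b\<in>keys v. fst b \<le> m \<and> lookup v b \<in> forms (m - fst b))" for v :: "('x::finite, 'k::field) free_elt"
  proof (intro iffI ballI allI conjI)
    fix b assume v: "\<forall>b. lookup v b \<in> poly_part (int m - int (fst b))" and b: "b \<in> keys v"
    show le: "fst b \<le> m"
      using v[rule_format, of b] b poly_part_neg[of "int m - int (fst b)"] by (force simp: in_keys_iff)
    show "lookup v b \<in> forms (m - fst b)"
      using v[rule_format, of b] le by (simp add: poly_part_forms flip: of_nat_diff)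
  next
    fix b assume *: "\<forall>b\<in>keys v. fst b \<le> m \<and> lookup v b \<in> forms (m - fst b)"
    show "lookup v b \<in> poly_part (int m - int (fst b))"
    proof (cases "b \<in> keys v")
      case True
      then show ?thesis using * by (simp add: poly_part_forms flip: of_nat_diff)
    qed (simp add: in_keys_iff poly_part_def)
  qed
  then show ?thesis unfolding free_part_def free_mod_part_def by auto
qed

definition bounded_basis :: "(nat \<Rightarrow> nat) \<Rightarrow> int \<Rightarrow> (nat \<times> nat) set" where
  "bounded_basis r j = {b \<in> basis r. int (fst b) \<le> j}"

lemma finite_bounded_basis: "finite (bounded_basis r j)"
proof -
  have "bounded_basis r j \<subseteq> (SIGMA m:{..nat j}. {..<r m})"
    by (auto simp: bounded_basis_def basis_def)
  then show ?thesis by (rule finite_subset) simp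
qed

lemma free_part_keys:
  assumes "v \<in> free_part r j" shows "keys v \<subseteq> bounded_basis r j"
proof
  fix b assume b: "b \<in> keys v"
  have "int (fst b) \<le> j"
    using free_part_lookup[OF assms, of b] b poly_part_neg[of "j - int (fst b)"] by (cases "int (fst b) \<le> j") (auto simp: in_keys_iff)
  then show "b \<in> bounded_basis r j"
    using assms b unfolding free_part_def free_mod_def bounded_basis_def by blast
qed

lemma linear_single: "Vector_Spaces.linear scale scaleK (single b)"
  by (auto simp: Vector_Spaces.linear_iff vs.vector_space_axioms FK.vector_space_axioms single_add
      intro!: poly_mapping_eqI simp: lookup_single when_def)

lemma subspace_graded_supported:
  "FK.subspace {v :: ('x::finite, 'k::field) free_elt.
     keys v \<subseteq> B \<and> (\<forall>b. lookup v b \<in> poly_part (j - int (fst b)))}"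
  (is "FK.subspace ?V")
  unfolding FK.subspace_def
proof (intro conjI ballI allI)
  show "0 \<in> ?V" by (auto intro!: vs.subspace_0[OF subspace_poly_part])
next
  fix v w assume "v \<in> ?V" "w \<in> ?V"
  then show "v + w \<in> ?V"
    using keys_add[of v w] by (auto simp: lookup_add intro!: vs.subspace_add[OF subspace_poly_part])
next
  fix c v assume v: "v \<in> ?V"
  have "keys (scaleK c v) \<subseteq> keys v" by (auto simp: in_keys_iff)
  then show "scaleK c v \<in> ?V"
    using v by (auto intro!: vs.subspace_scale[OF subspace_poly_part])
qed

lemma free_part_alt: "free_part r j = {v. keys v \<subseteq> basis r \<and> (\<forall>b. lookup v b \<in> poly_part (j - int (fst b)))}"
  unfolding free_part_def free_mod_def by blast

lemma subspace_free_part: "FK.subspace (free_part r j)"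
  unfolding free_part_alt by (rule subspace_graded_supported)

text \<open>The free module may have infinite rank, but basis elements of degree above
  \<open>j\<close> contribute nothing in degree \<open>j\<close>, and only finitely many have degree
  at most \<open>j\<close>.\<close>

lemma findim_free_part: "findim scaleK (free_part r j :: ('x::finite, 'k::field) free_elt set)"
proof -
  let ?V = "\<lambda>B. {v :: ('x, 'k) free_elt. keys v \<subseteq> B \<and>
    (\<forall>b. lookup v b \<in> poly_part (j - int (fst b)))}"
  have "findim scaleK (?V B)" if "finite B" for B
    using that
  proof induction
    case empty
    have "?V {} = {0}" by (auto simp: poly_part_def)
    then show ?case using FK.findim_zero by simp
  next
    case (insert b B)
    have "?V (insert b B) \<subseteq> {x + y | x y. x \<in> single b ` poly_part (j - int (fst b)) \<and> y \<in> ?V B}"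
    proof
      fix v assume v: "v \<in> ?V (insert b B)"
      let ?x = "single b (lookup v b)"
      have "v = ?x + (v - ?x)" by simp
      moreover have "v - ?x \<in> ?V B"
        using v insert.hyps
        by (auto simp: in_keys_iff lookup_minus lookup_single when_def poly_part_def split: if_splits)
      ultimately show "v \<in> {x + y | x y. x \<in> single b ` poly_part (j - int (fst b)) \<and> y \<in> ?V B}"
        using v by blast
    qed
    moreover have "findim scaleK {x + y | x y. x \<in> single b ` poly_part (j - int (fst b)) \<and> y \<in> ?V B}"
      by (intro FK.findim_sums findim_image[OF linear_single] findim_poly_part insert.IH)
    moreover have "FK.subspace (?V (insert b B))" by (rule subspace_graded_supported)
    ultimately show ?case using FK.findim_subspace by blast
  qed
  from this[OF finite_bounded_basis[of r j]] show ?thesis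
    by (rule FK.findim_subspace[OF _ subspace_free_part]) (use free_part_keys free_part_lookup in blast)
qed

lemma gmod_free_part:
  assumes "set ys \<subseteq> (poly_part 1 :: ('x::finite, 'k::field) poly_ring set)"
  shows "FK.gmod ys (free_part r)"
  unfolding FK.gmod_def
proof (intro conjI allI ballI)
  fix y j and v :: "('x::finite, 'k::field) free_elt"
  assume y: "y \<in> set ys" and v: "v \<in> free_part r j"
  have "y * lookup v b \<in> poly_part (j + 1 - int (fst b))" for b
  proof -
    have "y * lookup v b \<in> poly_part (1 + (j - int (fst b)))"
      using y assms free_part_lookup[OF v] by (intro poly_part_mult) auto
    then show ?thesis by (simp add: algebra_simps)
  qed
  moreover have "keys (scale y v) \<subseteq> keys v"
    by (auto simp: in_keys_iff)
  ultimately show "scale y v \<in> free_part r (j + 1)" using v by (auto simp: free_part_def free_mod_def)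
qed (rule findim_free_part)

text \<open>Every coordinate of a cycle is a Koszul cycle over \<open>R\<close>, with its degree
  shifted by that of the basis element, so preimages can be chosen coordinate by coordinate.\<close>

lemma exact_free_module:
  fixes ys :: "('x::finite, 'k::field) poly_ring list"
  assumes ys: "set ys \<subseteq> poly_part 1"
    and ex: "\<And>j. koszul_dim scale (*) ys p poly_part (mon_part {}) j = 0"
  shows "cycles scale ys p (free_part r) (\<lambda>_. {0}) j \<subseteq> boundaries scale ys p (free_part r) (\<lambda>_. {0}) j"
proof
  fix c assume "c \<in> cycles scale ys p (free_part r) (\<lambda>_. {0}) j"
  then have c: "c \<in> chains p (length ys) (free_part r j)" "\<And>l. kdiff scale ys c l = 0"
    unfolding cycles_def by auto
  let ?c = "\<lambda>b l. lookup (c l) b"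
  have comp: "kdiff (*) ys (\<lambda>l. lookup (f l) b) l = lookup (kdiff scale ys f l) b"
    for f :: "bool list \<Rightarrow> ('x, 'k) free_elt" and b l
    using fun_cong[OF kdiff_compose[of "\<lambda>v. lookup v b" ys scale "(*)" f], of l]
    by (simp add: lookup_add)
  have "\<exists>e\<in>chains (p + 1) (length ys) (poly_part (j - int (fst b) - 1)). ?c b = kdiff (*) ys e" for b
  proof -
    have "?c b \<in> chains p (length ys) (poly_part (j - int (fst b)))"
      by (rule chains_map[OF c(1)]) (simp_all add: free_part_lookup)
    moreover have "kdiff (*) ys (?c b) l = 0" for l unfolding comp c(2) by simp
    ultimately have "?c b \<in> cycles (*) ys p poly_part (mon_part {}) (j - int (fst b))"
      unfolding cycles_def mon_part_empty by blast
    then have "?c b \<in> boundaries (*) ys p poly_part (mon_part {}) (j - int (fst b))"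
      using ex[of "j - int (fst b)"] RK.koszul_dim_0_iff[OF gmod_poly_part[OF ys] gmod_mon_part[OF ys] mon_part_le] by blast
    then obtain e q where e: "?c b = kdiff (*) ys e + q" "e \<in> chains (p + 1) (length ys) (poly_part (j - int (fst b) - 1))"
      "q \<in> chains p (length ys) {0}" unfolding boundaries_def mon_part_empty by blast
    have "q l = 0" for l using chains_values[OF e(3), of l] by simp
    then have "?c b = kdiff (*) ys e" using e(1) by (auto simp: fun_eq_iff)
    then show ?thesis using e(2) by blast
  qed
  then obtain e where e: "\<And>b. e b \<in> chains (p + 1) (length ys) (poly_part (j - int (fst b) - 1))"
    "\<And>b. ?c b = kdiff (*) ys (e b)" by metis
  \<comment> \<open>The sum runs only over the finitely many basis elements of degree at most
    \<open>j\<close>, as an element of a free module has finite support; the other coordinates of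
    \<open>c\<close> are zero.\<close>
  define E where "E = (\<lambda>l. \<Sum>b\<in>bounded_basis r j. single b (e b l))"
  have E: "lookup (E l) b = (if b \<in> bounded_basis r j then e b l else 0)" for l b
    unfolding E_def by (simp add: lookup_sum lookup_single when_def finite_bounded_basis)
  have "E l \<in> free_part r (j - 1)" for l
  proof -
    have "e b l \<in> poly_part (j - 1 - int (fst b))" for b
      using chains_values[OF e(1), of b l] by (simp add: poly_part_def algebra_simps)
    moreover have "keys (E l) \<subseteq> bounded_basis r j" by (auto simp: in_keys_iff E split: if_splits)
    ultimately show ?thesis
      unfolding free_part_def free_mod_def bounded_basis_def E by (auto simp: E poly_part_def bounded_basis_def)
  qed
  moreover have "E l = 0" if "\<not> (length l = length ys \<and> int (count_list l True) = p + 1)" for l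
  proof -
    have "e b l = 0" for b using e(1)[of b] that unfolding chains_def by (auto split: if_splits)
    then show ?thesis unfolding E_def by simp
  qed
  ultimately have "E \<in> chains (p + 1) (length ys) (free_part r (j - 1))" unfolding chains_def by auto
  moreover have "kdiff scale ys E = c"
  proof (rule ext, rule poly_mapping_eqI)
    fix l b
    show "lookup (kdiff scale ys E l) b = lookup (c l) b"
    proof (cases "b \<in> bounded_basis r j")
      case True
      then show ?thesis
        using fun_cong[OF e(2)[of b], of l] by (simp add: E flip: comp)
    next
      case False
      then have "(\<lambda>l. lookup (E l) b) = 0" by (simp add: E fun_eq_iff)
      then have "lookup (kdiff scale ys E l) b = 0"
        unfolding comp[symmetric] by simp
      moreover have "c l \<in> free_part r j"
        using chains_values[OF c(1)] FK.subspace_0[OF subspace_free_part] by blast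
      then have "lookup (c l) b = 0"
        using free_part_keys[of "c l" r j] False by (auto simp: in_keys_iff)
      ultimately show ?thesis by simp
    qed
  qed
  moreover have "(0 :: bool list \<Rightarrow> ('x, 'k) free_elt) \<in> chains p (length ys) {0}"
    by (simp add: chains_def)
  moreover have "c = kdiff scale ys E + 0" using \<open>kdiff scale ys E = c\<close> by simp
  ultimately show "c \<in> boundaries scale ys p (free_part r) (\<lambda>_. {0}) j" unfolding boundaries_def by blast
qed

section \<open>Dimension shifting\<close>

lemma count_True_eq_0: "length l = n \<and> count_list l True = 0 \<longleftrightarrow> l = replicate n False"
proof (induction l arbitrary: n)
  case (Cons b l)
  then show ?case by (cases n; cases b) auto
qed auto

context kmod
begin

text \<open>Degree \<open>j\<close> of the submodule \<open>(y\<^sub>1, \<dots>, y\<^sub>n) P\<close>.\<close>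

primrec gens :: "'r list \<Rightarrow> (int \<Rightarrow> 'v set) \<Rightarrow> int \<Rightarrow> 'v set" where
  "gens [] P = (\<lambda>_. {0})"
| "gens (y # ys) P = quot_by y P (gens ys P)"

definition ev :: "nat \<Rightarrow> (bool list \<Rightarrow> 'v) \<Rightarrow> 'v" where
  "ev n c = c (replicate n False)"

lemma linear_ev: "Vector_Spaces.linear (chain_scale s) s (ev n)"
  by (simp add: Vector_Spaces.linear_iff ch.vector_space_axioms vector_space_axioms ev_def chain_scale_def)

lemma ev_Suc: "ev (Suc n) c = ev n (lo c)"
  by (simp add: ev_def lo_def)

lemma chains_0_index:
  assumes "c \<in> chains 0 n P" "l \<noteq> replicate n False"
  shows "c l = 0"
  using assms unfolding chains_def of_nat_eq_0_iff count_True_eq_0 by auto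

lemma ev_inj: "c \<in> chains 0 n P \<Longrightarrow> ev n c = 0 \<Longrightarrow> c = 0"
  using chains_0_index[of c n P] unfolding ev_def by (metis ext zero_fun_apply)

lemma ev_in_chains_0:
  assumes "c \<in> chains 0 n P" "0 \<in> P'" "ev n c \<in> P'"
  shows "c \<in> chains 0 n P'"
  using assms(1)
proof (rule chains_valuesI)
  fix l show "c l \<in> P'"
    using chains_0_index[OF assms(1), of l] assms(2,3) unfolding ev_def by (cases "l = replicate n False") auto
qed

text \<open>The last Koszul differential sends \<open>(v1, ..., vn)\<close> to
  \<open>y1 v1 + ... + yn vn\<close>; \<open>ev\<close> reads off the only entry of a chain of
  homological degree 0.\<close>

lemma ev_kdiff:
  assumes "\<And>j. 0 \<in> P j"
  shows "ev (length ys) ` kdiff act ys ` chains 1 (length ys) (P (j - 1)) = gens ys P j"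
proof (induction ys)
  case Nil
  have "0 \<in> chains 1 0 (P (j - 1))" by (simp add: chains_0)
  then show ?case by (auto simp: ev_def)
next
  case (Cons y ys)
  show ?case
  proof (intro equalityI subsetI)
    fix v assume "v \<in> ev (length (y # ys)) ` kdiff act (y # ys) ` chains 1 (length (y # ys)) (P (j - 1))"
    then obtain e where e: "v = ev (Suc (length ys)) (kdiff act (y # ys) e)" "e \<in> chains 1 (Suc (length ys)) (P (j - 1))"
      by auto
    have "v = act y (ev (length ys) (hi e)) + ev (length ys) (kdiff act ys (lo e))"
      unfolding e(1) ev_Suc lo_kdiff by (simp add: ev_def)
    moreover have "hi e \<in> chains 0 (length ys) (P (j - 1))" "lo e \<in> chains 1 (length ys) (P (j - 1))"
      using e(2) by (simp_all add: chains_Suc)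
    moreover have "ev (length ys) (hi e) \<in> P (j - 1)"
      unfolding ev_def by (rule chains_values[OF calculation(2) assms])
    ultimately show "v \<in> gens (y # ys) P j"
      unfolding gens.simps using Cons.IH by (metis imageI quot_byI)
  next
    fix v assume "v \<in> gens (y # ys) P j"
    then obtain a q where v: "v = act y a + q" "a \<in> P (j - 1)" "q \<in> gens ys P j"
      by (auto simp: quot_by_def)
    obtain e where e: "e \<in> chains 1 (length ys) (P (j - 1))" "q = ev (length ys) (kdiff act ys e)"
      using v(3) unfolding Cons.IH[symmetric] by blast
    define w where "w = (\<lambda>l. if l = replicate (length ys) False then a else 0)"
    have "w \<in> chains 0 (length ys) (P (j - 1))"
      using v(2) unfolding chains_def of_nat_eq_0_iff count_True_eq_0 w_def by auto
    then have "join e w \<in> chains 1 (length (y # ys)) (P (j - 1))" using e(1) by (simp add: chains_Suc)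
    moreover have "v = ev (length (y # ys)) (kdiff act (y # ys) (join e w))"
      unfolding list.size add_Suc_right add_0_right ev_Suc lo_kdiff join_simps v(1) e(2)
      by (simp add: ev_def w_def add.commute)
    ultimately show "v \<in> ev (length (y # ys)) ` kdiff act (y # ys) ` chains 1 (length (y # ys)) (P (j - 1))"
      by blast
  qed
qed

lemma gmod_zero: "gmod ys (\<lambda>_. {0})"
  unfolding gmod_def using findim_zero by simp

lemma gmod_gens: "gmod ys P \<Longrightarrow> set zs \<subseteq> set ys \<Longrightarrow> gmod ys (gens zs P)"
  by (induction zs) (auto intro: gmod_quot_by gmod_zero)

lemma chains_zero_space: "q \<in> chains p n {0} \<Longrightarrow> q = 0"
  using chains_values[of q p n "{0}"] by (auto simp: fun_eq_iff)

lemma boundaries_zero: "boundaries act ys p P (\<lambda>_. {0}) j = kdiff act ys ` chains (p + 1) (length ys) (P (j - 1))"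
proof -
  have "(0 :: bool list \<Rightarrow> 'v) \<in> chains p (length ys) {0}" by (simp add: chains_def)
  then show ?thesis
    unfolding boundaries_def using chains_zero_space by (force simp del: plus_fun_apply)
qed

lemma cycles_zero: "cycles act ys p P (\<lambda>_. {0}) j = {c \<in> chains p (length ys) (P j). kdiff act ys c = 0}"
  unfolding cycles_def by (auto simp: fun_eq_iff)

text \<open>The connecting homomorphism for \<open>0 \<rightarrow> Z \<rightarrow> F \<rightarrow> F/Z \<rightarrow> 0\<close> is induced by the Koszul differential.\<close>

lemma koszul_dim_connecting:
  assumes F: "gmod ys F" and Z: "gmod ys Z" and ZF: "\<And>j. Z j \<subseteq> F j"
    and ex: "cycles act ys (p + 1) F (\<lambda>_. {0}) j \<subseteq> boundaries act ys (p + 1) F (\<lambda>_. {0}) j"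
  shows "koszul_dim s act ys (p + 1) F Z j =
    ch.dim (chains p (length ys) (Z (j + 1)) \<inter> kdiff act ys ` chains (p + 1) (length ys) (F j)) -
    ch.dim (kdiff act ys ` chains (p + 1) (length ys) (Z j))"
proof -
  have ker: "c \<in> boundaries act ys (p + 1) F Z j" if "c \<in> cycles act ys (p + 1) F Z j" "kdiff act ys c = 0" for c
  proof -
    have "c \<in> cycles act ys (p + 1) F (\<lambda>_. {0}) j"
      using that unfolding cycles_def by simp
    then have "c \<in> boundaries act ys (p + 1) F (\<lambda>_. {0}) j" using ex by blast
    then obtain e where "e \<in> chains (p + 1 + 1) (length ys) (F (j - 1))" "c = kdiff act ys e + 0"
      unfolding boundaries_zero by auto
    then show ?thesis
      unfolding boundaries_def using chains_zero[OF gmod_subspace[OF Z]] by blast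
  qed
  have 1: "kdiff act ys ` cycles act ys (p + 1) F Z j =
      chains p (length ys) (Z (j + 1)) \<inter> kdiff act ys ` chains (p + 1) (length ys) (F j)"
  proof (intro equalityI subsetI)
    fix d assume "d \<in> kdiff act ys ` cycles act ys (p + 1) F Z j"
    then obtain c where c: "d = kdiff act ys c" "c \<in> chains (p + 1) (length ys) (F j)" "\<And>l. kdiff act ys c l \<in> Z (j + 1)"
      unfolding cycles_def by blast
    have "d \<in> chains (p + 1 - 1) (length ys) (Z (j + 1))"
      unfolding c(1) using gmod_kdiff[OF F c(2)] c(3) by (rule chains_valuesI)
    then show "d \<in> chains p (length ys) (Z (j + 1)) \<inter> kdiff act ys ` chains (p + 1) (length ys) (F j)"
      using c(1,2) by simp
  next
    fix d assume "d \<in> chains p (length ys) (Z (j + 1)) \<inter> kdiff act ys ` chains (p + 1) (length ys) (F j)"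
    then obtain c where c: "d = kdiff act ys c" "c \<in> chains (p + 1) (length ys) (F j)" "d \<in> chains p (length ys) (Z (j + 1))"
      by blast
    have "kdiff act ys c l \<in> Z (j + 1)" for l
      using chains_values[OF c(3) subspace_0[OF gmod_subspace[OF Z]], of l] unfolding c(1) .
    then show "d \<in> kdiff act ys ` cycles act ys (p + 1) F Z j"
      using c(1,2) unfolding cycles_def by blast
  qed
  have 2: "kdiff act ys ` boundaries act ys (p + 1) F Z j = kdiff act ys ` chains (p + 1) (length ys) (Z j)"
  proof (intro equalityI subsetI)
    fix d assume "d \<in> kdiff act ys ` boundaries act ys (p + 1) F Z j"
    then obtain e q where "d = kdiff act ys (kdiff act ys e + q)" "q \<in> chains (p + 1) (length ys) (Z j)"
      unfolding boundaries_def by blast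
    then show "d \<in> kdiff act ys ` chains (p + 1) (length ys) (Z j)" by (simp only: kdiff_add kdiff_kdiff add_0_left) blast
  next
    fix d assume "d \<in> kdiff act ys ` chains (p + 1) (length ys) (Z j)"
    then obtain q where q: "d = kdiff act ys q" "q \<in> chains (p + 1) (length ys) (Z j)" by blast
    have "q \<in> boundaries act ys (p + 1) F Z j"
      using q(2) chains_boundaries[OF F] by blast
    then show "d \<in> kdiff act ys ` boundaries act ys (p + 1) F Z j" using q(1) by blast
  qed
  show ?thesis
    unfolding koszul_dim_def 1[symmetric] 2[symmetric]
    by (rule dim_quotient_image[OF linear_kdiff findim_cycles[OF F Z] ch.findim_imp_subspace[OF findim_boundaries[OF F Z]]
          boundaries_cycles[OF F Z ZF]]) (rule ker)
qed

text \<open>Acyclicity of \<open>F\<close> in degree \<open>p\<close> turns every cycle of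
  \<open>Z\<close> into a boundary in \<open>F\<close>, so the connecting homomorphism is onto;
  acyclicity in degree \<open>p + 1\<close> makes it injective. The coefficient degree rises as
  \<open>p\<close> drops, which preserves the internal degree.\<close>

lemma koszul_dim_shift_pos:
  assumes F: "gmod ys F" and Z: "gmod ys Z" and ZF: "\<And>j. Z j \<subseteq> F j"
    and ex: "\<And>j. cycles act ys (p + 1) F (\<lambda>_. {0}) j \<subseteq> boundaries act ys (p + 1) F (\<lambda>_. {0}) j"
      "\<And>j. cycles act ys p F (\<lambda>_. {0}) j \<subseteq> boundaries act ys p F (\<lambda>_. {0}) j"
  shows "koszul_dim s act ys (p + 1) F Z j = koszul_dim s act ys p Z (\<lambda>_. {0}) (j + 1)"
proof -
  have "chains p (length ys) (Z (j + 1)) \<inter> kdiff act ys ` chains (p + 1) (length ys) (F j) =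
      cycles act ys p Z (\<lambda>_. {0}) (j + 1)"
  proof (intro equalityI subsetI)
    fix c assume "c \<in> chains p (length ys) (Z (j + 1)) \<inter> kdiff act ys ` chains (p + 1) (length ys) (F j)"
    then show "c \<in> cycles act ys p Z (\<lambda>_. {0}) (j + 1)" unfolding cycles_zero by auto
  next
    fix c assume "c \<in> cycles act ys p Z (\<lambda>_. {0}) (j + 1)"
    then have c: "c \<in> chains p (length ys) (Z (j + 1))" "kdiff act ys c = 0" unfolding cycles_zero by auto
    then have "c \<in> cycles act ys p F (\<lambda>_. {0}) (j + 1)"
      unfolding cycles_zero using chains_mono[OF ZF] by blast
    then have "c \<in> kdiff act ys ` chains (p + 1) (length ys) (F j)"
      using ex(2)[of "j + 1"] unfolding boundaries_zero by auto
    then show "c \<in> chains p (length ys) (Z (j + 1)) \<inter> kdiff act ys ` chains (p + 1) (length ys) (F j)"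
      using c(1) by blast
  qed
  then show ?thesis
    using koszul_dim_connecting[OF F Z ZF ex(1), of j] unfolding koszul_dim_def boundaries_zero by simp
qed

text \<open>At the bottom \<open>F\<close> is not acyclic: the boundaries there are
  \<open>(ys) F\<close>. The connecting map thus only reaches \<open>Z \<inter> (ys) F\<close>, and
  the result is \<open>(Z \<inter> (ys) F) / (ys) Z\<close> instead of \<open>Z / (ys) Z\<close>.
  For a minimal resolution the two coincide.\<close>

lemma koszul_dim_shift_0:
  assumes F: "gmod ys F" and Z: "gmod ys Z" and ZF: "\<And>j. Z j \<subseteq> F j"
    and ex: "\<And>j. cycles act ys 1 F (\<lambda>_. {0}) j \<subseteq> boundaries act ys 1 F (\<lambda>_. {0}) j"
  shows "koszul_dim s act ys 1 F Z j = dim (Z (j + 1) \<inter> gens ys F (j + 1)) - dim (gens ys Z (j + 1))"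
proof -
  let ?n = "length ys"
  note F0 = subspace_0[OF gmod_subspace[OF F]] and Z0 = subspace_0[OF gmod_subspace[OF Z]]
  have sub: "ch.subspace (kdiff act ys ` chains 1 ?n (P j))" if "gmod ys P" for P
    by (intro ch.findim_imp_subspace findim_image[OF linear_kdiff] findim_chains gmod_findim[OF that])
  have kd0: "kdiff act ys ` chains 1 ?n (P j) \<subseteq> chains 0 ?n (P (j + 1))" if "gmod ys P" for P
    using gmod_kdiff[OF that, of _ 1 j] by auto
  have evdim: "dim (ev ?n ` X) = ch.dim X" if "ch.subspace X" "X \<subseteq> chains 0 ?n (F (j + 1))" for X
  proof (rule dim_image_inj[OF linear_ev])
    show "findim (chain_scale s) X" by (rule ch.findim_subspace[OF findim_chains[OF gmod_findim[OF F]] that])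
    show "\<And>x. x \<in> X \<Longrightarrow> ev ?n x = 0 \<Longrightarrow> x = 0" using ev_inj that(2) by blast
  qed
  have 1: "ev ?n ` kdiff act ys ` chains 1 ?n (P j) = gens ys P (j + 1)" if "gmod ys P" for P
    using ev_kdiff[of P ys "j + 1", OF subspace_0[OF gmod_subspace[OF that]]] by simp
  have 2: "ev ?n ` (chains 0 ?n (Z (j + 1)) \<inter> kdiff act ys ` chains 1 ?n (F j)) = Z (j + 1) \<inter> gens ys F (j + 1)"
  proof (intro equalityI subsetI)
    fix v assume "v \<in> ev ?n ` (chains 0 ?n (Z (j + 1)) \<inter> kdiff act ys ` chains 1 ?n (F j))"
    then obtain c where c: "v = ev ?n c" "c \<in> chains 0 ?n (Z (j + 1))" "c \<in> kdiff act ys ` chains 1 ?n (F j)" by blast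
    have "v \<in> Z (j + 1)" unfolding c(1) ev_def by (rule chains_values[OF c(2) Z0])
    moreover have "v \<in> gens ys F (j + 1)" unfolding c(1) 1[OF F, symmetric] using c(3) by blast
    ultimately show "v \<in> Z (j + 1) \<inter> gens ys F (j + 1)" by blast
  next
    fix v assume v: "v \<in> Z (j + 1) \<inter> gens ys F (j + 1)"
    then obtain c where c: "v = ev ?n c" "c \<in> kdiff act ys ` chains 1 ?n (F j)"
      unfolding 1[OF F, symmetric] by blast
    have "c \<in> chains 0 ?n (F (j + 1))" using c(2) kd0[OF F] by blast
    then have "c \<in> chains 0 ?n (Z (j + 1))"
      by (rule ev_in_chains_0[OF _ Z0]) (use v c(1) in blast)
    then show "v \<in> ev ?n ` (chains 0 ?n (Z (j + 1)) \<inter> kdiff act ys ` chains 1 ?n (F j))" using c by blast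
  qed
  have "koszul_dim s act ys (0 + 1) F Z j =
    ch.dim (chains 0 ?n (Z (j + 1)) \<inter> kdiff act ys ` chains (0 + 1) ?n (F j)) -
    ch.dim (kdiff act ys ` chains (0 + 1) ?n (Z j))"
    by (rule koszul_dim_connecting[OF F Z ZF]) (simp add: ex)
  moreover have "ch.dim (chains 0 ?n (Z (j + 1)) \<inter> kdiff act ys ` chains 1 ?n (F j)) = dim (Z (j + 1) \<inter> gens ys F (j + 1))"
    unfolding 2[symmetric]
    by (rule evdim[symmetric]) (use kd0[OF F] subspace_chains[OF gmod_subspace[OF Z]] sub[OF F] in \<open>auto intro: ch.subspace_inter\<close>)
  moreover have "ch.dim (kdiff act ys ` chains 1 ?n (Z j)) = dim (gens ys Z (j + 1))"
    unfolding 1[OF Z, symmetric]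
    by (rule evdim[symmetric]) (use kd0[OF Z] chains_mono[OF ZF] sub[OF Z] in blast)+
  ultimately show ?thesis by simp
qed

end

locale kmod_hom = A: kmod s1 act1 + B: kmod s2 act2
  for s1 :: "'k::field \<Rightarrow> 'v::ab_group_add \<Rightarrow> 'v" and act1 :: "'r::comm_ring_1 \<Rightarrow> 'v \<Rightarrow> 'v"
  and s2 :: "'k \<Rightarrow> 'w::ab_group_add \<Rightarrow> 'w" and act2 :: "'r \<Rightarrow> 'w \<Rightarrow> 'w" +
  fixes \<phi> :: "'v \<Rightarrow> 'w"
  assumes hom_add: "\<phi> (u + v) = \<phi> u + \<phi> v"
    and hom_scale: "\<phi> (s1 c v) = s2 c (\<phi> v)"
    and hom_act: "\<phi> (act1 y v) = act2 y (\<phi> v)"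
begin

lemma linear_hom: "Vector_Spaces.linear s1 s2 \<phi>"
  by (simp add: Vector_Spaces.linear_iff A.vector_space_axioms B.vector_space_axioms hom_add hom_scale)

lemma hom_zero [simp]: "\<phi> 0 = 0" using hom_add[of 0 0] by simp

lemma hom_gens: "B.gens ys (\<lambda>j. \<phi> ` P j) j = \<phi> ` A.gens ys P j"
proof (induction ys arbitrary: j)
  case (Cons y ys)
  show ?case
  proof (intro equalityI subsetI)
    fix w assume "w \<in> B.gens (y # ys) (\<lambda>j. \<phi> ` P j) j"
    then obtain a q where "w = act2 y (\<phi> a) + \<phi> q" "a \<in> P (j - 1)" "q \<in> A.gens ys P j"
      by (auto simp: B.quot_by_def Cons.IH)
    then have "w = \<phi> (act1 y a + q)" "act1 y a + q \<in> A.gens (y # ys) P j"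
      by (auto simp: hom_add hom_act intro: A.quot_byI)
    then show "w \<in> \<phi> ` A.gens (y # ys) P j" by blast
  next
    fix w assume "w \<in> \<phi> ` A.gens (y # ys) P j"
    then obtain a q where "w = \<phi> (act1 y a + q)" "a \<in> P (j - 1)" "q \<in> A.gens ys P j"
      by (auto simp: A.quot_by_def)
    then show "w \<in> B.gens (y # ys) (\<lambda>j. \<phi> ` P j) j"
      by (auto simp: hom_add hom_act Cons.IH intro!: B.quot_byI)
  qed
qed simp

text \<open>A surjection identifies \<open>P/Q\<close> with \<open>F\<close> modulo the preimage of
  \<open>Q\<close>. With it \<open>R/I\<close> is replaced by \<open>F_0 / Z_0\<close>, and a syzygy
  module \<open>Z_k\<close>, being the image of the next free module, by
  \<open>F_(k+1) / Z_(k+1)\<close>.\<close>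

lemma koszul_dim_hom:
  assumes F: "A.gmod ys F" and P: "B.gmod ys P" and Q: "B.gmod ys Q" and QP: "\<And>j. Q j \<subseteq> P j"
    and onto: "\<And>j. \<phi> ` F j = P j"
  shows "koszul_dim s1 act1 ys p F (\<lambda>j. {v \<in> F j. \<phi> v \<in> Q j}) j = koszul_dim s2 act2 ys p P Q j"
    and "A.gmod ys (\<lambda>j. {v \<in> F j. \<phi> v \<in> Q j})"
proof -
  let ?Z = "\<lambda>j. {v \<in> F j. \<phi> v \<in> Q j}" and ?n = "length ys"
  let ?\<Phi> = "\<lambda>c l. \<phi> (c l)"
  show Z: "A.gmod ys ?Z"
    unfolding A.gmod_def
  proof (intro conjI allI ballI)
    fix j
    have "A.subspace (?Z j)"
      using A.gmod_subspace[OF F, of j] B.gmod_subspace[OF Q, of j]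
      unfolding A.subspace_def B.subspace_def by (auto simp: hom_add hom_scale)
    then show "findim s1 (?Z j)" by (rule A.findim_subspace[OF A.gmod_findim[OF F]]) blast
  next
    fix y j v assume "y \<in> set ys" "v \<in> ?Z j"
    then show "act1 y v \<in> ?Z (j + 1)"
      using A.gmod_act[OF F] B.gmod_act[OF Q] by (auto simp: hom_act)
  qed
  have lin: "Vector_Spaces.linear (chain_scale s1) (chain_scale s2) ?\<Phi>"
    by (simp add: Vector_Spaces.linear_iff A.ch.vector_space_axioms B.ch.vector_space_axioms fun_eq_iff hom_add hom_scale chain_scale_def)
  have kdiff: "kdiff act2 ys (?\<Phi> c) = ?\<Phi> (kdiff act1 ys c)" for c
    by (rule kdiff_compose) (simp_all add: hom_add hom_act)
  have map: "?\<Phi> c \<in> chains q ?n (P j)" if "c \<in> chains q ?n (F j)" for c q j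
    by (rule chains_map[OF that]) (use onto in auto)
  have mapZ: "?\<Phi> c \<in> chains q ?n (Q j)" if "c \<in> chains q ?n (?Z j)" for c q j
    by (rule chains_map[OF that]) auto
  have lift: "\<exists>c'\<in>chains q ?n (F j). c = ?\<Phi> c'" if "c \<in> chains q ?n (P j)" for c q j
  proof -
    have "\<exists>c'\<in>chains q ?n (F j). \<forall>l. c l = \<phi> (c' l)"
      by (rule chains_choice[OF that]) (use onto[of j] in auto)
    then show ?thesis by (auto simp: fun_eq_iff)
  qed
  have liftZ: "\<exists>c'\<in>chains q ?n (?Z j). c = ?\<Phi> c'" if "c \<in> chains q ?n (Q j)" for c q j
  proof -
    have "\<exists>c'\<in>chains q ?n (?Z j). \<forall>l. c l = \<phi> (c' l)"
    proof (rule chains_choice[OF that])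
      fix v assume v: "v \<in> Q j"
      then have "v \<in> \<phi> ` F j" using QP onto by blast
      then show "\<exists>w\<in>?Z j. v = \<phi> w" using v by blast
    qed simp
    then show ?thesis by (auto simp: fun_eq_iff)
  qed
  have cyc: "?\<Phi> ` cycles act1 ys p F ?Z j = cycles act2 ys p P Q j"
  proof (intro equalityI subsetI)
    fix d assume "d \<in> ?\<Phi> ` cycles act1 ys p F ?Z j"
    then obtain c where "d = ?\<Phi> c" "c \<in> chains p ?n (F j)" "\<And>l. kdiff act1 ys c l \<in> ?Z (j + 1)"
      unfolding cycles_def by blast
    then show "d \<in> cycles act2 ys p P Q j"
      unfolding cycles_def using map by (auto simp: kdiff)
  next
    fix d assume "d \<in> cycles act2 ys p P Q j"
    then have d: "d \<in> chains p ?n (P j)" "\<And>l. kdiff act2 ys d l \<in> Q (j + 1)" unfolding cycles_def by auto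
    obtain c where c: "c \<in> chains p ?n (F j)" "d = ?\<Phi> c" using lift[OF d(1)] by blast
    have "kdiff act1 ys c l \<in> ?Z (j + 1)" for l
      using d(2)[of l] chains_values[OF A.gmod_kdiff[OF F c(1)] A.subspace_0[OF A.gmod_subspace[OF F]]]
      unfolding c(2) kdiff by simp
    then show "d \<in> ?\<Phi> ` cycles act1 ys p F ?Z j" using c unfolding cycles_def by blast
  qed
  have add: "?\<Phi> (a + b) = ?\<Phi> a + ?\<Phi> b" for a b by (simp add: fun_eq_iff hom_add)
  have bd: "?\<Phi> ` boundaries act1 ys p F ?Z j = boundaries act2 ys p P Q j"
  proof (intro equalityI subsetI)
    fix d assume "d \<in> ?\<Phi> ` boundaries act1 ys p F ?Z j"
    then obtain e q where d: "d = ?\<Phi> (kdiff act1 ys e + q)" "e \<in> chains (p + 1) ?n (F (j - 1))" "q \<in> chains p ?n (?Z j)"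
      unfolding boundaries_def by blast
    have "d = kdiff act2 ys (?\<Phi> e) + ?\<Phi> q" unfolding d(1) kdiff by (rule add)
    then show "d \<in> boundaries act2 ys p P Q j"
      unfolding boundaries_def using map[OF d(2)] mapZ[OF d(3)] by blast
  next
    fix d assume "d \<in> boundaries act2 ys p P Q j"
    then obtain e q where d: "d = kdiff act2 ys e + q" "e \<in> chains (p + 1) ?n (P (j - 1))" "q \<in> chains p ?n (Q j)"
      unfolding boundaries_def by blast
    obtain e' where e': "e' \<in> chains (p + 1) ?n (F (j - 1))" "e = ?\<Phi> e'" using lift[OF d(2)] by blast
    obtain q' where q': "q' \<in> chains p ?n (?Z j)" "q = ?\<Phi> q'" using liftZ[OF d(3)] by blast
    have "d = ?\<Phi> (kdiff act1 ys e' + q')" unfolding d(1) e'(2) q'(2) kdiff by (rule add[symmetric])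
    then show "d \<in> ?\<Phi> ` boundaries act1 ys p F ?Z j"
      unfolding boundaries_def using e'(1) q'(1) by blast
  qed
  have ZF: "\<And>j. ?Z j \<subseteq> F j" by blast
  have ker: "c \<in> boundaries act1 ys p F ?Z j" if c: "c \<in> cycles act1 ys p F ?Z j" "?\<Phi> c = 0" for c
  proof -
    have "c \<in> chains p ?n (F j)" using c(1) unfolding cycles_def by blast
    moreover have "c l \<in> ?Z j" for l
      using chains_values[OF calculation A.subspace_0[OF A.gmod_subspace[OF F]]] fun_cong[OF c(2), of l]
        B.subspace_0[OF B.gmod_subspace[OF Q]] by simp
    ultimately have "c \<in> chains p ?n (?Z j)" by (rule chains_valuesI)
    then show ?thesis using A.chains_boundaries[OF F, where Q = ?Z and j = j] by blast
  qed
  show "koszul_dim s1 act1 ys p F ?Z j = koszul_dim s2 act2 ys p P Q j"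
    unfolding koszul_dim_def
    using dim_quotient_image[OF lin A.findim_cycles[OF F Z] A.ch.findim_imp_subspace[OF A.findim_boundaries[OF F Z]]
        A.boundaries_cycles[OF F Z ZF] ker]
    unfolding cyc bd .
qed

end

section \<open>Homogeneous components\<close>

definition component :: "int \<Rightarrow> ('x::finite, 'k::field) poly_ring \<Rightarrow> ('x, 'k) poly_ring" where
  "component j p = (\<Sum>t | t \<in> keys p \<and> int (mdeg t) = j. single t (lookup p t))"

lemma component_hom_component: "component (int j) p = hom_component j p"
  by (simp add: component_def hom_component_def)

lemma lookup_component: "lookup (component j p) t = (if int (mdeg t) = j then lookup p t else 0)"
  by (auto simp: component_def lookup_sum lookup_single when_def in_keys_iff)

lemma component_add: "component j (p + q) = component j p + component j q"
  by (rule poly_mapping_eqI) (simp add: lookup_component lookup_add)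

lemma component_zero [simp]: "component j 0 = 0"
  by (rule poly_mapping_eqI) (simp add: lookup_component)

lemma component_sum: "component j (sum f A) = (\<Sum>a\<in>A. component j (f a))"
  by (induction A rule: infinite_finite_induct) (simp_all add: component_add)

lemma component_in_poly_part: "component j p \<in> poly_part j"
  by (auto simp: poly_part_def in_keys_iff lookup_component split: if_splits)

lemma poly_part_lookup: "p \<in> poly_part j \<Longrightarrow> int (mdeg t) \<noteq> j \<Longrightarrow> lookup p t = 0"
  by (auto simp: poly_part_def in_keys_iff)

lemma component_poly_part: "p \<in> poly_part j \<Longrightarrow> component j p = p"
  by (rule poly_mapping_eqI) (simp add: lookup_component poly_part_lookup)

lemma component_mult:
  assumes q: "q \<in> poly_part e"
  shows "component (i + e) (p * q) = component i p * q"
proof -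
  define r where "r = p - component i p"
  have p: "p = component i p + r" by (simp add: r_def)
  have "component (i + e) (r * q) = 0"
  proof (rule poly_mapping_eqI)
    fix t
    have "lookup (r * q) t = 0" if t: "int (mdeg t) = i + e"
    proof (rule ccontr)
      assume "lookup (r * q) t \<noteq> 0"
      then obtain a b where ab: "t = a + b" "a \<in> keys r" "b \<in> keys q"
        using keys_mult[of r q] by (auto simp: in_keys_iff)
      then have "int (mdeg a) = i" using t q by (auto simp: poly_part_def)
      then show False using ab(2) by (simp add: r_def in_keys_iff lookup_minus lookup_component)
    qed
    then show "lookup (component (i + e) (r * q)) t = lookup 0 t"
      by (simp add: lookup_component)
  qed
  moreover have "component (i + e) (component i p * q) = component i p * q"
    by (rule component_poly_part[OF poly_part_mult[OF component_in_poly_part q]])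
  ultimately have "component (i + e) (component i p * q + r * q) = component i p * q"
    by (simp only: component_add add_0_right)
  then show ?thesis
    unfolding distrib_right[symmetric] p[symmetric] .
qed

definition free_component :: "int \<Rightarrow> ('x::finite, 'k::field) free_elt \<Rightarrow> ('x, 'k) free_elt" where
  "free_component m v = (\<Sum>b\<in>keys v. single b (component (m - int (fst b)) (lookup v b)))"

lemma lookup_free_component: "lookup (free_component m v) b = component (m - int (fst b)) (lookup v b)"
  by (auto simp: free_component_def lookup_sum lookup_single when_def in_keys_iff)

lemma free_component_add: "free_component m (v + w) = free_component m v + free_component m w"
  by (rule poly_mapping_eqI) (simp add: lookup_free_component lookup_add component_add)

lemma free_component_zero [simp]: "free_component m 0 = 0"
  by (rule poly_mapping_eqI) (simp add: lookup_free_component)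

lemma free_component_sum: "free_component m (sum f A) = (\<Sum>a\<in>A. free_component m (f a))"
  by (induction A rule: infinite_finite_induct) (simp_all add: free_component_add)

lemma keys_free_component: "keys (free_component m v) \<subseteq> keys v"
proof
  fix b assume "b \<in> keys (free_component m v)"
  then have "component (m - int (fst b)) (lookup v b) \<noteq> 0" unfolding in_keys_iff lookup_free_component .
  then show "b \<in> keys v" by (metis component_zero in_keys_iff)
qed

lemma free_component_in_free_part: "v \<in> free_mod r \<Longrightarrow> free_component m v \<in> free_part r m"
  using keys_free_component[of m v] unfolding free_part_def free_mod_def by (auto simp: lookup_free_component component_in_poly_part)

lemma free_component_free_part: "v \<in> free_part r m \<Longrightarrow> free_component m v = v"
  by (rule poly_mapping_eqI) (simp add: lookup_free_component component_poly_part free_part_lookup)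

lemma free_component_scale:
  assumes "w \<in> free_part r d"
  shows "free_component m (scale p w) = scale (component (m - d) p) w"
proof (rule poly_mapping_eqI)
  fix b
  show "lookup (free_component m (scale p w)) b = lookup (scale (component (m - d) p) w) b"
    using component_mult[OF free_part_lookup[OF assms, of b], of "m - d" p] by (simp add: lookup_free_component)
qed

lemma lin_ext_superset:
  assumes "finite A" "keys v \<subseteq> A"
  shows "lin_ext f v = (\<Sum>b\<in>A. scale (lookup v b) (f b))"
proof -
  show ?thesis
    unfolding lin_ext_def by (intro sum.mono_neutral_left assms)
      (auto simp: in_keys_iff module.scale_zero_left[OF module_scale])
qed

lemma lin_form_superset:
  assumes "finite A" "keys v \<subseteq> A"
  shows "lin_form f v = (\<Sum>b\<in>A. lookup v b * f b)"
  unfolding lin_form_def by (intro sum.mono_neutral_left assms) (auto simp: in_keys_iff)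

lemma lin_ext_add: "lin_ext f (v + w) = lin_ext f v + lin_ext f w"
proof -
  let ?A = "keys v \<union> keys w"
  have "lin_ext f (v + w) = (\<Sum>b\<in>?A. scale (lookup (v + w) b) (f b))"
    using keys_add[of v w] by (intro lin_ext_superset) auto
  also have "\<dots> = (\<Sum>b\<in>?A. scale (lookup v b) (f b)) + (\<Sum>b\<in>?A. scale (lookup w b) (f b))"
    by (simp add: lookup_add module.scale_left_distrib[OF module_scale] sum.distrib)
  also have "\<dots> = lin_ext f v + lin_ext f w"
    by (subst (1 2) lin_ext_superset[of ?A]) auto
  finally show ?thesis .
qed

lemma lin_form_add: "lin_form f (v + w) = lin_form f v + lin_form f w"
proof -
  let ?A = "keys v \<union> keys w"
  have "lin_form f (v + w) = (\<Sum>b\<in>?A. lookup (v + w) b * f b)"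
    using keys_add[of v w] by (intro lin_form_superset) auto
  also have "\<dots> = (\<Sum>b\<in>?A. lookup v b * f b) + (\<Sum>b\<in>?A. lookup w b * f b)"
    by (simp add: lookup_add distrib_right sum.distrib)
  also have "\<dots> = lin_form f v + lin_form f w"
    by (subst (1 2) lin_form_superset[of ?A]) auto
  finally show ?thesis .
qed

lemma keys_scale: "keys (scale c v) \<subseteq> keys v"
  by (auto simp: in_keys_iff)

lemma lin_ext_scale: "lin_ext f (scale c v) = scale c (lin_ext f v)"
proof -
  have "lin_ext f (scale c v) = (\<Sum>b\<in>keys v. scale (c * lookup v b) (f b))"
    by (subst lin_ext_superset[OF _ keys_scale]) simp_all
  then show ?thesis
    unfolding lin_ext_def
    by (simp add: module.scale_sum_right[OF module_scale] module.scale_scale[OF module_scale])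
qed

lemma lin_form_scale: "lin_form f (scale c v) = c * lin_form f v"
proof -
  have "lin_form f (scale c v) = (\<Sum>b\<in>keys v. c * lookup v b * f b)"
    by (subst lin_form_superset[OF _ keys_scale]) simp_all
  then show ?thesis
    unfolding lin_form_def by (simp add: sum_distrib_left mult.assoc)
qed

lemma kmod_hom_lin_ext: "kmod_hom (scaleK :: 'k::field \<Rightarrow> ('b \<Rightarrow>\<^sub>0 ('x::type, 'k) poly_ring) \<Rightarrow> _) scale scaleK scale (lin_ext f)"
  by (intro kmod_hom.intro kmod_hom_axioms.intro FK.kmod_axioms)
    (simp_all only: lin_ext_add lin_ext_scale scaleK_def)

lemma kmod_hom_lin_form: "kmod_hom (scaleK :: 'k::field \<Rightarrow> ('b \<Rightarrow>\<^sub>0 ('x::type, 'k) poly_ring) \<Rightarrow> _) scale scale (*) (lin_form f)"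
proof (intro kmod_hom.intro kmod_hom_axioms.intro FK.kmod_axioms RK.kmod_axioms)
  fix c and v :: "'b \<Rightarrow>\<^sub>0 ('x::type, 'k) poly_ring"
  show "lin_form f (scaleK c v) = scale c (lin_form f v)"
    by (simp only: scaleK_def lin_form_scale) (simp add: scale_def mult_map_scale_conv_mult)
qed (simp_all only: lin_form_add lin_form_scale)

lemma scale_free_part:
  assumes "p \<in> poly_part i" "w \<in> free_part r d" "m = i + d"
  shows "scale p w \<in> free_part r m"
proof -
  have "p * lookup w b \<in> poly_part (m - int (fst b))" for b
    using poly_part_mult[OF assms(1) free_part_lookup[OF assms(2), of b]] assms(3) by (simp add: algebra_simps)
  then show ?thesis
    using keys_scale[of p w] assms(2) unfolding free_part_def free_mod_def by auto
qed

lemma lin_ext_free_part: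
  assumes "\<And>b. b \<in> basis r \<Longrightarrow> f b \<in> free_part r' (int (fst b))" "v \<in> free_part r m"
  shows "lin_ext f v \<in> free_part r' m"
  unfolding lin_ext_def
proof (rule FK.subspace_sum[OF subspace_free_part])
  fix b assume "b \<in> keys v"
  then have "b \<in> basis r" using assms(2) unfolding free_part_def free_mod_def by blast
  then show "scale (lookup v b) (f b) \<in> free_part r' m"
    by (intro scale_free_part[OF free_part_lookup[OF assms(2)] assms(1)]) simp_all
qed

lemma lin_form_poly_part:
  assumes "\<And>b. b \<in> basis r \<Longrightarrow> f b \<in> poly_part (int (fst b))" "v \<in> free_part r m"
  shows "lin_form f v \<in> poly_part m"
  unfolding lin_form_def
proof (rule vs.subspace_sum[OF subspace_poly_part])
  fix b assume "b \<in> keys v"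
  then have "b \<in> basis r" using assms(2) unfolding free_part_def free_mod_def by blast
  then show "lookup v b * f b \<in> poly_part m"
    using poly_part_mult[OF free_part_lookup[OF assms(2), of b] assms(1)[of b]] by simp
qed

lemma free_component_lin_ext:
  assumes "\<And>b. b \<in> basis r \<Longrightarrow> f b \<in> free_part r' (int (fst b))" "v \<in> free_mod r"
  shows "free_component m (lin_ext f v) = lin_ext f (free_component m v)"
proof -
  have "free_component m (lin_ext f v) = (\<Sum>b\<in>keys v. scale (lookup (free_component m v) b) (f b))"
    unfolding lin_ext_def free_component_sum lookup_free_component
  proof (rule sum.cong[OF refl])
    fix b assume "b \<in> keys v"
    then have "f b \<in> free_part r' (int (fst b))" using assms unfolding free_mod_def by blast
    then show "free_component m (scale (lookup v b) (f b)) = scale (component (m - int (fst b)) (lookup v b)) (f b)"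
      by (rule free_component_scale)
  qed
  then show ?thesis using lin_ext_superset[of "keys v" "free_component m v" f, OF finite_keys keys_free_component] by simp
qed

lemma component_lin_form:
  assumes "\<And>b. b \<in> basis r \<Longrightarrow> f b \<in> poly_part (int (fst b))" "v \<in> free_mod r"
  shows "component m (lin_form f v) = lin_form f (free_component m v)"
proof -
  have "component m (lin_form f v) = (\<Sum>b\<in>keys v. lookup (free_component m v) b * f b)"
    unfolding lin_form_def component_sum lookup_free_component
  proof (rule sum.cong[OF refl])
    fix b assume "b \<in> keys v"
    then have "f b \<in> poly_part (int (fst b))" using assms unfolding free_mod_def by blast
    from component_mult[OF this, of "m - int (fst b)"]
    show "component m (lookup v b * f b) = component (m - int (fst b)) (lookup v b) * f b"
      by simp
  qed
  then show ?thesis using lin_form_superset[of "keys v" "free_component m v" f, OF finite_keys keys_free_component] by simp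
qed

section \<open>Constant terms\<close>

lemma lookup_mult_0:
  fixes p q :: "('x::type, 'k::field) poly_ring"
  shows "lookup (p * q) 0 = lookup p 0 * lookup q 0"
proof -
  have *: "0 = l + t \<longleftrightarrow> l = 0 \<and> t = 0" for l t :: "'x \<Rightarrow>\<^sub>0 nat"
    by (auto simp: poly_mapping_eq_iff fun_eq_iff lookup_add)
  have "(\<Sum>t. lookup q t when 0 = l + t) = (lookup q 0 when l = 0)" for l
    unfolding * by (cases "l = 0") simp_all
  then show ?thesis by (simp add: lookup_mult mult_when)
qed

definition const_term :: "('b \<Rightarrow>\<^sub>0 ('x, 'k::field) poly_ring) \<Rightarrow> ('b \<Rightarrow>\<^sub>0 'k)" where
  "const_term v = Poly_Mapping.map (\<lambda>p. lookup p 0) v"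

lemma lookup_const_term [simp]: "lookup (const_term v) b = lookup (lookup v b) 0"
  by (simp add: const_term_def map.rep_eq when_def)

lemma const_term_add: "const_term (v + w) = const_term v + const_term w"
  by (rule poly_mapping_eqI) (simp add: lookup_add)

lemma const_term_scale: "const_term (scale p v) = scale (lookup p 0) (const_term v)"
  by (rule poly_mapping_eqI) (simp add: lookup_mult_0)

lemma linear_const_term: "Vector_Spaces.linear scaleK scale const_term"
  by (simp add: Vector_Spaces.linear_iff vs.vector_space_axioms FK.vector_space_axioms const_term_add)
    (simp add: scaleK_def const_term_scale)

lemma const_term_zero [simp]: "const_term 0 = 0" by (rule poly_mapping_eqI) simp

lemma const_term_sum: "const_term (sum f A) = (\<Sum>a\<in>A. const_term (f a))"
  by (induction A rule: infinite_finite_induct) (simp_all add: const_term_add)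

lemma keys_const_term: "keys (const_term v) \<subseteq> keys v"
  by (auto simp: in_keys_iff)

lemma const_term_lin_ext: "const_term (lin_ext f v) = lin_ext (\<lambda>b. const_term (f b)) (const_term v)"
  unfolding lin_ext_superset[OF finite_keys keys_const_term] unfolding lin_ext_def const_term_sum const_term_scale by simp

lemma const_term_free_part:
  "const_term ` (free_part r (int m) :: ('x::finite, 'k::field) free_elt set) =
    {w \<in> free_mod r. \<forall>b\<in>keys w. fst b = m}"
proof (intro equalityI subsetI)
  fix w :: "nat \<times> nat \<Rightarrow>\<^sub>0 'k" assume "w \<in> const_term ` (free_part r (int m) :: ('x, 'k) free_elt set)"
  then obtain v :: "('x, 'k) free_elt" where v: "w = const_term v" "v \<in> free_part r (int m)" by blast
  have "fst b = m" if "b \<in> keys w" for b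
  proof -
    have "lookup (lookup v b) 0 \<noteq> 0" using that v(1) by (simp add: in_keys_iff)
    then have "int (mdeg (0 :: 'x \<Rightarrow>\<^sub>0 nat)) = int m - int (fst b)"
      using poly_part_lookup[OF free_part_lookup[OF v(2), of b], of 0] by blast
    then show ?thesis by simp
  qed
  moreover have "w \<in> free_mod r" using v keys_const_term[of v] unfolding free_part_def free_mod_def by blast
  ultimately show "w \<in> {w \<in> free_mod r. \<forall>b\<in>keys w. fst b = m}" by blast
next
  fix w :: "nat \<times> nat \<Rightarrow>\<^sub>0 'k" assume w: "w \<in> {w \<in> free_mod r. \<forall>b\<in>keys w. fst b = m}"
  let ?v = "Poly_Mapping.map (single 0) w :: ('x, 'k) free_elt"
  have l: "lookup ?v b = single 0 (lookup w b)" for b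
    by (simp add: map.rep_eq when_def)
  have "w = const_term ?v" by (rule poly_mapping_eqI) (simp add: l)
  moreover have "lookup ?v b \<in> poly_part (int m - int (fst b))" for b
  proof (cases "b \<in> keys w")
    case True
    then have "fst b = m" using w by blast
    then show ?thesis unfolding l by (simp add: poly_part_def)
  qed (simp add: l in_keys_iff poly_part_def)
  moreover have "keys ?v \<subseteq> keys w" by (auto simp: in_keys_iff l)
  ultimately show "w \<in> const_term ` (free_part r (int m) :: ('x, 'k) free_elt set)"
    using w unfolding free_part_def free_mod_def by blast
qed

lemma gens_vars: "RK.gens (map var xs) poly_part = (mon_part (set xs) :: int \<Rightarrow> ('x::finite, 'k::field) poly_ring set)"
proof (induction xs)
  case Nil
  then show ?case by (simp add: mon_part_empty fun_eq_iff)
next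
  case (Cons x xs)
  then show ?case by (simp add: quot_by_var_mon_part)
qed

lemma gens_coordinates:
  fixes g :: "('x::finite, 'k::field) poly_ring"
  assumes g: "g \<in> poly_part 1" "lookup g (single x0 1) \<noteq> 0"
    and xs: "insert x0 (set xs) = UNIV"
  shows "RK.gens (g # map var xs) poly_part j = mon_part UNIV j"
proof (intro equalityI subsetI)
  fix p assume "p \<in> RK.gens (g # map var xs) poly_part j"
  then obtain a q where p: "p = g * a + q" "a \<in> poly_part (j - 1)" "q \<in> mon_part (set xs) j"
    unfolding RK.gens.simps gens_vars RK.quot_by_def by blast
  have "g \<in> mon_ideal UNIV"
    unfolding mon_ideal_def
  proof (intro CollectI ballI)
    fix t assume "t \<in> keys g"
    then have "mdeg t = 1" using g(1) by (auto simp: poly_part_def)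
    then obtain x where "t = single x 1" by (rule mdeg_eq_1)
    then show "\<exists>x\<in>UNIV. 0 < lookup t x" by (intro bexI[of _ x]) simp_all
  qed
  then have "g * a \<in> mon_ideal UNIV" using mon_ideal_mult[of g UNIV a] by (simp add: mult.commute)
  moreover have "g * a \<in> poly_part j" using poly_part_mult[OF g(1) p(2)] by simp
  moreover have "q \<in> mon_ideal UNIV" "q \<in> poly_part j" using p(3) unfolding mon_part_def mon_ideal_def by blast+
  ultimately show "p \<in> mon_part UNIV j"
    unfolding p(1) mon_part_def by (simp add: vs.subspace_add[OF subspace_mon_ideal] vs.subspace_add[OF subspace_poly_part])
next
  fix p :: "('x, 'k) poly_ring" assume "p \<in> mon_part UNIV j"
  then have "p \<in> RK.quot_by (var x0) poly_part (mon_part (set xs)) j"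
    unfolding quot_by_var_mon_part xs .
  then obtain a q where p: "p = var x0 * a + q" "a \<in> poly_part (j - 1)" "q \<in> mon_part (set xs) j"
    unfolding RK.quot_by_def by blast
  define c where "c = lookup g (single x0 1)"
  \<comment> \<open>\<open>h\<close> is \<open>g\<close> without its \<open>x0\<close>-term, hence
    lies in the ideal of the remaining variables. Since \<open>c\<close> is nonzero,
    \<open>var x0\<close> can be replaced by a multiple of \<open>g - h\<close>.\<close>
  define h where "h = g - scale c (var x0)"
  have hR: "h \<in> poly_part 1"
    unfolding h_def by (intro vs.subspace_diff[OF subspace_poly_part] g(1) vs.subspace_scale[OF subspace_poly_part] var_poly_part)
  have "h \<in> mon_ideal (set xs)"
    unfolding mon_ideal_def
  proof (intro CollectI ballI)
    fix t assume t: "t \<in> keys h"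
    then have "mdeg t = 1" using hR by (auto simp: poly_part_def)
    then obtain x where x: "t = single x 1" by (rule mdeg_eq_1)
    have "x \<noteq> x0"
      using t by (auto simp: x h_def c_def var_def in_keys_iff lookup_minus)
    then have "x \<in> set xs" using xs by blast
    then show "\<exists>x\<in>set xs. 0 < lookup t x" by (intro bexI[of _ x]) (simp_all add: x)
  qed
  then have "h * scale (inverse c) a \<in> mon_ideal (set xs)"
    using mon_ideal_mult[of h "set xs" "scale (inverse c) a"] by (simp add: mult.commute)
  moreover have aR: "scale (inverse c) a \<in> poly_part (j - 1)" by (rule vs.subspace_scale[OF subspace_poly_part p(2)])
  then have "h * scale (inverse c) a \<in> poly_part j" using poly_part_mult[OF hR aR] by simp
  ultimately have "q - h * scale (inverse c) a \<in> mon_part (set xs) j"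
    using p(3) unfolding mon_part_def
    by (simp add: vs.subspace_diff[OF subspace_mon_ideal] vs.subspace_diff[OF subspace_poly_part])
  then have "g * scale (inverse c) a + (q - h * scale (inverse c) a) \<in> RK.gens (g # map var xs) poly_part j"
    unfolding RK.gens.simps gens_vars using aR by (rule RK.quot_byI[rotated])
  moreover have "scale c (var x0) * scale (inverse c) a = var x0 * a"
  proof -
    have "scale c (var x0) * scale (inverse c) a = scale (c * inverse c) (var x0 * a)"
      using RK.act_scale[of "scale c (var x0)" "inverse c" a] RK.act_scale[of a c "var x0"]
      by (simp add: mult.commute)
    then show ?thesis using g(2) by (simp add: c_def)
  qed
  then have "p = g * scale (inverse c) a + (q - h * scale (inverse c) a)"
    unfolding p(1) h_def left_diff_distrib by simp
  ultimately show "p \<in> RK.gens (g # map var xs) poly_part j" by simp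
qed

lemma gens_componentwise:
  fixes ys :: "('x::finite, 'k::field) poly_ring list"
  assumes "set ys \<subseteq> poly_part 1" "v \<in> free_part r m" "\<And>b. lookup v b \<in> RK.gens ys poly_part (m - int (fst b))"
  shows "v \<in> FK.gens ys (free_part r) m"
  using assms
proof (induction ys arbitrary: v)
  case Nil
  then show ?case by (auto intro!: poly_mapping_eqI)
next
  case (Cons y ys)
  have "\<exists>a. a \<in> poly_part (m - int (fst b) - 1) \<and> lookup v b - y * a \<in> RK.gens ys poly_part (m - int (fst b))" for b
    using Cons.prems(3)[of b] unfolding RK.gens.simps RK.quot_by_def by force
  then obtain a where a: "\<And>b. a b \<in> poly_part (m - int (fst b) - 1)"
    "\<And>b. lookup v b - y * a b \<in> RK.gens ys poly_part (m - int (fst b))" by metis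
  define A where "A = (\<Sum>b\<in>keys v. single b (a b))"
  have lA: "lookup A b = (if b \<in> keys v then a b else 0)" for b
    unfolding A_def by (simp add: lookup_sum lookup_single when_def)
  have AF: "A \<in> free_part r (m - 1)"
  proof -
    have "lookup A b \<in> poly_part (m - 1 - int (fst b))" for b
      using a(1)[of b] unfolding lA by (simp add: poly_part_def algebra_simps)
    moreover have "keys A \<subseteq> keys v" by (auto simp: in_keys_iff[of _ A] lA split: if_splits)
    ultimately show ?thesis using Cons.prems(2) unfolding free_part_def free_mod_def by blast
  qed
  have yR: "y \<in> poly_part 1" using Cons.prems(1) by simp
  have "v - scale y A \<in> FK.gens ys (free_part r) m"
  proof (rule Cons.IH)
    show "set ys \<subseteq> poly_part 1" using Cons.prems(1) by simp
    show "v - scale y A \<in> free_part r m"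
      by (intro FK.subspace_diff[OF subspace_free_part] Cons.prems(2) scale_free_part[OF yR AF]) simp
    fix b :: "nat \<times> nat"
    have "0 \<in> RK.gens ys poly_part (m - int (fst b))"
      by (rule vs.subspace_0[OF RK.gmod_subspace[OF RK.gmod_gens[OF gmod_poly_part]]]) (use Cons.prems(1) in auto)
    then show "lookup (v - scale y A) b \<in> RK.gens ys poly_part (m - int (fst b))"
      using a(2)[of b] by (auto simp: lookup_minus lA in_keys_iff)
  qed
  then have "scale y A + (v - scale y A) \<in> FK.gens (y # ys) (free_part r) m"
    unfolding FK.gens.simps by (rule FK.quot_byI[of A "free_part r" m, OF AF])
  then show ?case by simp
qed

text \<open>This links the Koszul side to \<open>F \<otimes> K\<close>: the submodule
  \<open>(ys) F\<close> does not depend on the choice of coordinates and is the kernel of the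
  reduction to constant terms.\<close>

lemma gens_free_part:
  fixes g :: "('x::finite, 'k::field) poly_ring"
  assumes g: "g \<in> poly_part 1" "lookup g (single x0 1) \<noteq> 0"
    and xs: "insert x0 (set xs) = UNIV"
  shows "FK.gens (g # map var xs) (free_part r) m = {v \<in> free_part r m. const_term v = 0}"
proof (intro equalityI subsetI)
  have sub: "set (g # map var xs) \<subseteq> poly_part 1" using g(1) var_poly_part by auto
  fix v :: "('x, 'k) free_elt"
  have "v \<in> FK.gens ys (free_part r) m \<Longrightarrow> v \<in> free_part r m \<and> const_term v = 0" if "set ys \<subseteq> poly_part 1" for ys
    using that
  proof (induction ys arbitrary: v)
    case Nil
    then show ?case by (simp add: FK.subspace_0[OF subspace_free_part])
  next
    case (Cons y ys)
    then obtain a q where v: "v = scale y a + q" "a \<in> free_part r (m - 1)" "q \<in> FK.gens ys (free_part r) m"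
      by (auto simp: FK.quot_by_def)
    have yR: "y \<in> poly_part 1" using Cons.prems by simp
    have "q \<in> free_part r m \<and> const_term q = 0" using Cons.IH[OF v(3)] Cons.prems by simp
    moreover have "scale y a \<in> free_part r m" by (rule scale_free_part[OF yR v(2)]) simp
    moreover have "lookup y 0 = 0" using poly_part_lookup[OF yR, of 0] by simp
    ultimately show ?case unfolding v(1) const_term_add const_term_scale by (simp add: FK.subspace_add[OF subspace_free_part])
  qed
  then show "v \<in> FK.gens (g # map var xs) (free_part r) m \<Longrightarrow> v \<in> {v \<in> free_part r m. const_term v = 0}" using sub by blast
  assume v: "v \<in> {v \<in> free_part r m. const_term v = 0}"
  show "v \<in> FK.gens (g # map var xs) (free_part r) m"
  proof (rule gens_componentwise[OF sub])
    show "v \<in> free_part r m" using v by blast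
    fix b :: "nat \<times> nat"
    have "lookup (lookup v b) 0 = 0"
      using v by (metis (mono_tags, lifting) lookup_const_term lookup_zero mem_Collect_eq)
    have "lookup v b \<in> mon_ideal UNIV"
      unfolding mon_ideal_alt
    proof (intro allI impI)
      fix t assume "lookup (lookup v b) t \<noteq> 0"
      then have "t \<noteq> 0" using \<open>lookup (lookup v b) 0 = 0\<close> by metis
      then obtain x where "lookup t x \<noteq> lookup 0 x"
        unfolding poly_mapping_eq_iff fun_eq_iff by blast
      then show "\<exists>x\<in>UNIV. 0 < lookup t x" by (intro bexI[of _ x]) simp_all
    qed
    then show "lookup v b \<in> RK.gens (g # map var xs) poly_part (m - int (fst b))"
      unfolding gens_coordinates[OF g xs] mon_part_def using v free_part_lookup by blast
  qed
qed

section \<open>Existence of graded free resolutions\<close>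

definition graded_submodule ::
  "(nat \<Rightarrow> nat) \<Rightarrow> ('x::finite, 'k::field) free_elt set \<Rightarrow> bool" where
  "graded_submodule r Z \<longleftrightarrow> module.subspace scale Z \<and> Z \<subseteq> free_mod r \<and> (\<forall>v\<in>Z. \<forall>m. free_component m v \<in> Z)"

lemma sum_components:
  obtains M where "finite M" "v = (\<Sum>m\<in>M. free_component m v)"
proof -
  define M where "M = (\<Union>b\<in>keys v. (\<lambda>t. int (fst b) + int (mdeg t)) ` keys (lookup v b))"
  have fin: "finite M" by (simp add: M_def)
  moreover have "v = (\<Sum>m\<in>M. free_component m v)"
  proof (rule poly_mapping_eqI, rule poly_mapping_eqI)
    fix b t
    have "lookup (lookup (\<Sum>m\<in>M. free_component m v) b) t =
      (\<Sum>m\<in>M. if m = int (fst b) + int (mdeg t) then lookup (lookup v b) t else 0)"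
      unfolding lookup_sum lookup_free_component lookup_component by (rule sum.cong) auto
    also have "\<dots> = lookup (lookup v b) t"
    proof (cases "lookup (lookup v b) t = 0")
      case False
      then have "b \<in> keys v" "t \<in> keys (lookup v b)"
        by (auto simp: in_keys_iff)
      then have "int (fst b) + int (mdeg t) \<in> M" unfolding M_def by blast
      then show ?thesis using fin by (simp add: sum.delta')
    qed (simp cong: if_cong)
    finally show "lookup (lookup v b) t =
      lookup (lookup (\<Sum>m\<in>M. free_component m v) b) t" ..
  qed
  ultimately show ?thesis by (rule that)
qed

lemma subspace_scale_scaleK: "module.subspace scale Z \<Longrightarrow> FK.subspace Z"
  unfolding FK.subspace_def module.subspace_def[OF module_scale] scaleK_def by blast

lemma lin_ext_single: "lin_ext f (single b p) = scale p (f b)"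
  by (cases "p = 0") (simp_all add: lin_ext_def module.scale_zero_left[OF module_scale])

lemma lin_ext_minimal:
  assumes "module.subspace scale Z" "\<And>b. b \<in> basis r \<Longrightarrow> f b \<in> Z" "v \<in> free_mod r"
  shows "lin_ext f v \<in> Z"
  unfolding lin_ext_def using assms
  by (intro module.subspace_sum[OF module_scale] module.subspace_scale[OF module_scale]) (auto simp: free_mod_def)

lemma module_subspace_free_mod:
  "module.subspace scale (free_mod r :: (nat \<times> nat \<Rightarrow>\<^sub>0 'a::comm_ring_1) set)"
  unfolding module.subspace_def[OF module_scale] free_mod_def
proof (intro conjI ballI allI; clarify)
  fix v w :: "nat \<times> nat \<Rightarrow>\<^sub>0 'a" and a b
  assume "keys v \<subseteq> basis r" "keys w \<subseteq> basis r" "(a, b) \<in> keys (v + w)"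
  then show "(a, b) \<in> basis r" using keys_add[of v w] by blast
next
  fix c and v :: "nat \<times> nat \<Rightarrow>\<^sub>0 'a" and a b
  assume "keys v \<subseteq> basis r" "(a, b) \<in> keys (scale c v)"
  then show "(a, b) \<in> basis r" using keys_scale[of c v] by blast
qed simp

text \<open>Vector space bases of all graded components together serve as generators. Neither
  minimality nor finite generation is aimed at: finitely many generators in each degree suffice, as
  a rank function may have infinite total rank.\<close>

lemma graded_generators:
  fixes Z :: "('x::finite, 'k::field) free_elt set"
  assumes Z: "graded_submodule r Z"
  obtains r' f where "\<And>b. b \<in> basis r' \<Longrightarrow> f b \<in> free_part r (int (fst b))" "lin_ext f ` free_mod r' = Z"
proof -
  have sub: "FK.subspace Z" "module.subspace scale Z"
    using Z subspace_scale_scaleK unfolding graded_submodule_def by blast+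
  have "\<exists>(n::nat) h. FK.span (h ` {..<n}) = Z \<inter> free_part r (int m) \<and> h ` {..<n} \<subseteq> Z \<inter> free_part r (int m)" for m
  proof -
    have "findim scaleK (Z \<inter> free_part r (int m))"
      by (rule FK.findim_subspace[OF findim_free_part[of r "int m"] FK.subspace_inter[OF sub(1) subspace_free_part]]) blast
    then obtain B where B: "finite B" "B \<subseteq> Z \<inter> free_part r (int m)" "Z \<inter> free_part r (int m) = FK.span B"
      using FK.findim_basis by metis
    obtain h where "bij_betw h {..<card B} B"
      using ex_bij_betw_nat_finite[OF B(1)] by (auto simp: atLeast0LessThan)
    then have "h ` {..<card B} = B" by (rule bij_betw_imp_surj_on)
    then show ?thesis using B by metis
  qed
  then obtain n :: "nat \<Rightarrow> nat" and h where nh: "\<And>m. FK.span (h m ` {..<n m}) = Z \<inter> free_part r (int m)"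
    "\<And>m. h m ` {..<n m} \<subseteq> Z \<inter> free_part r (int m)" by metis
  define f where "f = (\<lambda>b :: nat \<times> nat. h (fst b) (snd b))"
  have fb: "f b \<in> Z \<inter> free_part r (int (fst b))" if "b \<in> basis n" for b
    using nh(2)[of "fst b"] that unfolding f_def basis_def by auto
  have sub_im: "FK.subspace (lin_ext f ` free_mod n)"
  proof -
    interpret H: kmod_hom scaleK scale scaleK scale "lin_ext f" by (rule kmod_hom_lin_ext)
    interpret L: Vector_Spaces.linear scaleK scaleK "lin_ext f" by (rule H.linear_hom)
    show ?thesis by (rule L.subspace_image[OF subspace_scale_scaleK[OF module_subspace_free_mod]])
  qed
  have hom: "Z \<inter> free_part r (int m) \<subseteq> lin_ext f ` free_mod n" for m
    unfolding nh(1)[symmetric]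
  proof (rule FK.span_minimal[OF _ sub_im])
    show "h m ` {..<n m} \<subseteq> lin_ext f ` free_mod n"
    proof
      fix w assume "w \<in> h m ` {..<n m}"
      then obtain i where i: "w = f (m, i)" "(m, i) \<in> basis n" by (auto simp: f_def basis_def)
      have "w = lin_ext f (single (m, i) 1)"
        unfolding lin_ext_single i(1) by (simp add: module.scale_one[OF module_scale])
      moreover have "single (m, i) 1 \<in> free_mod n" using i(2) by (simp add: free_mod_def)
      ultimately show "w \<in> lin_ext f ` free_mod n" by blast
    qed
  qed
  have "lin_ext f ` free_mod n = Z"
  proof (intro equalityI subsetI)
    fix w assume "w \<in> lin_ext f ` free_mod n"
    then show "w \<in> Z" using lin_ext_minimal[OF sub(2), of n f] fb by blast
  next
    fix w assume w: "w \<in> Z"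
    obtain M where M: "finite M" "w = (\<Sum>m\<in>M. free_component m w)" by (rule sum_components)
    have "free_component m w \<in> lin_ext f ` free_mod n" for m
    \<comment> \<open>Basis elements have natural numbers as degrees, so components of negative
      degree are zero; the generators only have to cover \<open>m \<ge> 0\<close>.\<close>
    proof (cases "m < 0")
      case True
      have "free_component m w = 0"
      proof (rule poly_mapping_eqI)
        fix b :: "nat \<times> nat"
        have "poly_part (m - int (fst b)) = ({0} :: ('x, 'k) poly_ring set)" using True by (intro poly_part_neg) linarith
        then show "lookup (free_component m w) b = lookup 0 b"
          using component_in_poly_part[of "m - int (fst b)" "lookup w b"] by (simp add: lookup_free_component)
      qed
      then show ?thesis using FK.subspace_0[OF sub_im] by simp
    next
      case False
      then have "m = int (nat m)" by simp
      moreover have "free_component m w \<in> Z \<inter> free_part r m"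
        using w Z free_component_in_free_part unfolding graded_submodule_def by blast
      ultimately show ?thesis using hom[of "nat m"] by auto
    qed
    then show "w \<in> lin_ext f ` free_mod n"
      by (subst M(2)) (intro FK.subspace_sum[OF sub_im])
  qed
  then show ?thesis using that[of n f] fb by blast
qed

lemma graded_submodule_kernel:
  assumes "\<And>b. b \<in> basis r \<Longrightarrow> f b \<in> free_part r' (int (fst b))"
  shows "graded_submodule r {v \<in> free_mod r. lin_ext f v = 0}"
  unfolding graded_submodule_def
proof (intro conjI ballI allI)
  show "module.subspace scale {v \<in> free_mod r. lin_ext f v = 0}"
    using module_subspace_free_mod[of r] unfolding module.subspace_def[OF module_scale]
    by (auto simp: lin_ext_add lin_ext_scale module.scale_zero_right[OF module_scale]) (simp add: lin_ext_def)
next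
  fix v m assume v: "v \<in> {v \<in> free_mod r. lin_ext f v = 0}"
  then have "lin_ext f (free_component m v) = 0" using free_component_lin_ext[of r f r' v m, OF assms] by simp
  moreover have "free_component m v \<in> free_mod r" using v keys_free_component[of m v] unfolding free_mod_def by blast
  ultimately show "free_component m v \<in> {v \<in> free_mod r. lin_ext f v = 0}" by blast
qed blast

lemma component_ideal:
  assumes "homogeneous_ideal I" "p \<in> I"
  shows "component j p \<in> I"
proof (cases "j < 0")
  case True
  then have "component j p = 0" using component_in_poly_part[of j p] poly_part_neg[of j] by blast
  moreover have "0 \<in> I"
    using assms(1) RK.M.subspace_0 unfolding homogeneous_ideal_def by blast
  ultimately show ?thesis by simp
next
  case False
  then have "j = int (nat j)" by simp
  then show ?thesis using assms component_hom_component[of "nat j" p] unfolding homogeneous_ideal_def by metis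
qed

text \<open>\<open>tor_dim\<close> takes a resolution by \<open>SOME\<close>, so facts about its
  value presuppose that one exists. A state of the dependent choice consists of a free module, a
  submodule and a free cover of it; the next submodule is the kernel of the cover.\<close>

theorem graded_free_resolution_exists:
  fixes I :: "('x::finite, 'k::field) poly_ring set"
  assumes I: "homogeneous_ideal I"
  shows "\<exists>F. graded_free_resolution I F"
proof -
  have idI: "RK.M.subspace I" using I unfolding homogeneous_ideal_def by blast
  define r0 :: "nat \<Rightarrow> nat" where "r0 = (\<lambda>m. if m = 0 then 1 else 0)"
  define au :: "nat \<times> nat \<Rightarrow> ('x, 'k) poly_ring" where "au = (\<lambda>_. 1)"
  have r0: "basis r0 = {(0, 0)}" by (auto simp: basis_def r0_def split: if_splits)
  have au: "au b \<in> poly_part (int (fst b))" if "b \<in> basis r0" for b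
    using that by (simp add: r0 au_def poly_part_def)
  define Z0 where "Z0 = {v \<in> free_mod r0. lin_form au v \<in> I}"
  have Z0: "graded_submodule r0 Z0"
    unfolding graded_submodule_def
  proof (intro conjI ballI allI)
    show "module.subspace scale Z0"
      using module_subspace_free_mod[of r0] idI unfolding Z0_def module.subspace_def[OF module_scale] RK.M.subspace_def
      by (auto simp: lin_form_add lin_form_scale) (simp add: lin_form_def)
    show "Z0 \<subseteq> free_mod r0" unfolding Z0_def by blast
    fix v m assume v: "v \<in> Z0"
    then have "lin_form au (free_component m v) \<in> I"
      using component_lin_form[of r0 au v m, OF au] component_ideal[OF I, of "lin_form au v" m] unfolding Z0_def by simp
    moreover have "free_component m v \<in> free_mod r0" using v keys_free_component[of m v] unfolding free_mod_def Z0_def by blast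
    ultimately show "free_component m v \<in> Z0" unfolding Z0_def by blast
  qed
  define good where "good = (\<lambda>(r, Z, r', f :: nat \<times> nat \<Rightarrow> ('x, 'k) free_elt).
    (\<forall>b\<in>basis r'. f b \<in> free_part r (int (fst b))) \<and> lin_ext f ` free_mod r' = Z)"
  define nxt where "nxt = (\<lambda>(r :: nat \<Rightarrow> nat, Z :: ('x, 'k) free_elt set, r' :: nat \<Rightarrow> nat, f :: _ \<Rightarrow> ('x, 'k) free_elt).
    \<lambda>(r2, Z2, r2' :: nat \<Rightarrow> nat, f2 :: nat \<times> nat \<Rightarrow> ('x, 'k) free_elt). r2 = r' \<and> Z2 = {v \<in> free_mod r'. lin_ext f v = 0})"
  have "\<exists>S. \<forall>n. (good (S n) \<and> (n = 0 \<longrightarrow> fst (S n) = r0 \<and> fst (snd (S n)) = Z0)) \<and> nxt (S n) (S (Suc n))"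
  proof (rule dependent_nat_choice)
    obtain r' f where "\<And>b. b \<in> basis r' \<Longrightarrow> f b \<in> free_part r0 (int (fst b))" "lin_ext f ` free_mod r' = Z0"
      by (rule graded_generators[OF Z0]) blast
    then have "good (r0, Z0, r', f)" by (simp add: good_def)
    then show "\<exists>x. good x \<and> (0 = (0::nat) \<longrightarrow> fst x = r0 \<and> fst (snd x) = Z0)"
      by (intro exI[of _ "(r0, Z0, r', f)"]) simp
  next
    fix x and n :: nat assume "good x \<and> (n = 0 \<longrightarrow> fst x = r0 \<and> fst (snd x) = Z0)"
    moreover obtain r Z r' f where x: "x = (r, Z, r', f)" by (cases x) auto
    ultimately have "\<And>b. b \<in> basis r' \<Longrightarrow> f b \<in> free_part r (int (fst b))" by (simp add: good_def)
    then have "graded_submodule r' {v \<in> free_mod r'. lin_ext f v = 0}" by (rule graded_submodule_kernel)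
    then obtain r'' f2 where "\<And>b. b \<in> basis r'' \<Longrightarrow> f2 b \<in> free_part r' (int (fst b))"
      "lin_ext f2 ` free_mod r'' = {v \<in> free_mod r'. lin_ext f v = 0}"
      by (rule graded_generators) blast
    then have "good (r', {v \<in> free_mod r'. lin_ext f v = 0}, r'', f2)" by (simp add: good_def)
    then show "\<exists>y. (good y \<and> (Suc n = 0 \<longrightarrow> fst y = r0 \<and> fst (snd y) = Z0)) \<and> nxt x y"
      by (intro exI[of _ "(r', {v \<in> free_mod r'. lin_ext f v = 0}, r'', f2)"]) (simp add: x nxt_def)
  qed
  then obtain S where S: "\<And>n. good (S n)" "fst (S 0) = r0" "fst (snd (S 0)) = Z0" "\<And>n. nxt (S n) (S (Suc n))"
    by blast
  define R where "R = (\<lambda>n. fst (S n))"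
  define D where "D = (\<lambda>n. snd (snd (snd (S n))))"
  have next_R: "fst (snd (snd (S n))) = R (Suc n)"
    and next_Z: "fst (snd (S (Suc n))) = {v \<in> free_mod (R (Suc n)). lin_ext (D n) v = 0}" for n
    using S(4)[of n] unfolding R_def D_def nxt_def by (cases "S n"; cases "S (Suc n)"; auto)+
  have good_D: "\<And>b. b \<in> basis (R (Suc n)) \<Longrightarrow> D n b \<in> free_part (R n) (int (fst b))"
    and image_D: "lin_ext (D n) ` free_mod (R (Suc n)) = fst (snd (S n))" for n
    using S(1)[of n] unfolding next_R[symmetric] unfolding R_def D_def good_def by (cases "S n"; auto)+
  have R0: "R 0 = r0" using S(2) by (simp add: R_def)
  let ?F = "\<lparr>rk = R, diff = D, aug = au\<rparr>"
  have "{lin_form au v + a | v a. v \<in> free_mod r0 \<and> a \<in> I} = UNIV"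
  proof -
    have "p \<in> {lin_form au v + a | v a. v \<in> free_mod r0 \<and> a \<in> I}" for p
    proof -
      have "p = lin_form au (single (0, 0) p) + 0" by (simp add: lin_form_def au_def)
      moreover have "single (0, 0) p \<in> free_mod r0" by (simp add: free_mod_def r0)
      moreover have "0 \<in> I" by (rule RK.M.subspace_0[OF idI])
      ultimately show ?thesis by blast
    qed
    then show ?thesis by blast
  qed
  moreover have "{v \<in> free_mod r0. lin_form au v \<in> I} = lin_ext (D 0) ` free_mod (R 1)"
    using image_D[of 0] S(3) by (simp add: Z0_def)
  moreover have "{v \<in> free_mod (R (i + 1)). lin_ext (D i) v = 0} = lin_ext (D (i + 1)) ` free_mod (R (i + 2))" for i
    using image_D[of "Suc i"] next_Z[of i] by simp
  moreover have "aug ?F b \<in> forms (fst b)" if "b \<in> basis r0" for b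
    using au[OF that] by (simp add: poly_part_forms)
  moreover have "D i b \<in> free_mod_part (R i) (fst b)" if "b \<in> basis (R (i + 1))" for i b
    using good_D[of b i] that by (simp add: free_part_eq_free_mod_part)
  ultimately have "graded_free_resolution I ?F"
    unfolding graded_free_resolution_def by (simp add: R0)
  then show ?thesis by blast
qed

section \<open>Betti numbers as Koszul homology\<close>

locale resolved_ideal =
  fixes I :: "('x::finite, 'k::field) poly_ring set" and F :: "('x, 'k) free_res"
    and g :: "('x, 'k) poly_ring" and x0 :: 'x and xs :: "'x list"
  assumes I: "homogeneous_ideal I" and F: "graded_free_resolution I F" and I0: "I \<inter> poly_part 0 = {0}"
    and g: "g \<in> poly_part 1" "lookup g (single x0 1) \<noteq> 0"
    and xs: "distinct xs" "x0 \<notin> set xs" "insert x0 (set xs) = UNIV"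
begin

abbreviation "ys \<equiv> g # map var xs"
definition "Ip j = I \<inter> poly_part j"
definition "D k = lin_ext (diff F k)"
definition "au = lin_form (aug F)"
abbreviation "G k \<equiv> free_part (rk F k)"

text \<open>The syzygy modules. Membership in \<open>{0}\<close> instead of an equation keeps both
  clauses in the form of a preimage, to which \<open>koszul_dim_hom\<close> applies.\<close>

fun Z :: "nat \<Rightarrow> int \<Rightarrow> ('x, 'k) free_elt set" where
  "Z 0 = (\<lambda>m. {v \<in> G 0 m. au v \<in> Ip m})"
| "Z (Suc k) = (\<lambda>m. {v \<in> G (Suc k) m. D k v \<in> {0}})"

lemma ys: "set ys \<subseteq> poly_part 1" using g(1) var_poly_part by auto

lemma idI: "RK.M.subspace I" using I unfolding homogeneous_ideal_def by blast

lemma gmod_Ip: "RK.gmod ys Ip"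
  unfolding RK.gmod_def
proof (intro conjI allI ballI)
  fix j
  have "vs.subspace I"
    using idI unfolding vs.subspace_def RK.M.subspace_def by (simp add: scale_def mult_map_scale_conv_mult)
  then show "findim scale (Ip j)"
    unfolding Ip_def by (intro vs.findim_subspace[OF findim_poly_part] vs.subspace_inter subspace_poly_part) auto
next
  fix y j v assume "y \<in> set ys" "v \<in> Ip j"
  then show "y * v \<in> Ip (j + 1)"
    using RK.M.subspace_scale[OF idI, of v y] poly_part_mult[of y 1 v j] ys unfolding Ip_def
    by (auto simp: add.commute)
qed

lemma diff_free_part: "b \<in> basis (rk F (Suc k)) \<Longrightarrow> diff F k b \<in> G k (int (fst b))"
  using F unfolding graded_free_resolution_def free_part_eq_free_mod_part by simp

lemma aug_poly_part: "b \<in> basis (rk F 0) \<Longrightarrow> aug F b \<in> poly_part (int (fst b))"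
  using F unfolding graded_free_resolution_def poly_part_forms by simp

lemma free_part_free_mod: "v \<in> free_part r m \<Longrightarrow> v \<in> free_mod r"
  unfolding free_part_def by blast

lemma D_image: "D k ` G (Suc k) m = Z k m"
proof (intro equalityI subsetI)
  fix w assume "w \<in> D k ` G (Suc k) m"
  then obtain v where v: "w = D k v" "v \<in> G (Suc k) m" by blast
  have wG: "w \<in> G k m" unfolding v(1) D_def by (rule lin_ext_free_part[OF diff_free_part v(2)])
  have im: "w \<in> lin_ext (diff F k) ` free_mod (rk F (Suc k))"
    using v free_part_free_mod unfolding D_def by blast
  show "w \<in> Z k m"
  proof (cases k)
    case 0
    then have "w \<in> {v \<in> free_mod (rk F 0). lin_form (aug F) v \<in> I}"
      using F im unfolding graded_free_resolution_def by simp
    moreover have "au w \<in> poly_part m"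
      unfolding au_def by (rule lin_form_poly_part[OF aug_poly_part]) (use wG 0 in simp_all)
    ultimately show ?thesis using wG 0 by (simp add: au_def Ip_def)
  next
    case (Suc l)
    then have "w \<in> {v \<in> free_mod (rk F (l + 1)). lin_ext (diff F l) v = 0}"
      using F im unfolding graded_free_resolution_def by simp
    then show ?thesis using wG Suc by (simp add: D_def)
  qed
next
  fix w assume w: "w \<in> Z k m"
  then have wG: "w \<in> G k m" by (cases k) simp_all
  have "w \<in> lin_ext (diff F k) ` free_mod (rk F (Suc k))"
  proof (cases k)
    case 0
    then have "w \<in> {v \<in> free_mod (rk F 0). lin_form (aug F) v \<in> I}"
      using w by (auto simp: Ip_def au_def intro: free_part_free_mod)
    then show ?thesis using F 0 unfolding graded_free_resolution_def by simp
  next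
    case (Suc l)
    then have "w \<in> {v \<in> free_mod (rk F (l + 1)). lin_ext (diff F l) v = 0}"
      using w by (auto simp: D_def intro: free_part_free_mod)
    moreover have "{v \<in> free_mod (rk F (l + 1)). lin_ext (diff F l) v = 0}
        = lin_ext (diff F (l + 1)) ` free_mod (rk F (l + 2))"
      using F unfolding graded_free_resolution_def by blast
    ultimately have "w \<in> lin_ext (diff F (l + 1)) ` free_mod (rk F (l + 2))" by (rule subst[rotated])
    then show ?thesis using Suc by simp
  qed
  then obtain v where v: "w = lin_ext (diff F k) v" "v \<in> free_mod (rk F (Suc k))" by blast
  \<comment> \<open>Exactness provides a preimage of unspecified degree; its component of degree
    \<open>m\<close> has the same image, since \<open>w\<close> is homogeneous of that
    degree.\<close>
  have "w = lin_ext (diff F k) (free_component m v)"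
    using free_component_lin_ext[of "rk F (Suc k)" "diff F k" "rk F k" v m, OF diff_free_part v(2)] free_component_free_part[OF wG] v(1) by simp
  then show "w \<in> D k ` G (Suc k) m"
    unfolding D_def using free_component_in_free_part[OF v(2)] by blast
qed

text \<open>A resolution only promises surjectivity onto \<open>R/I\<close>. But in
  \<open>1 = au v + a\<close>, passing to degree 0 kills \<open>a\<close>, as \<open>I\<close>
  contains no nonzero constant; so 1 itself is in the image, and the augmentation is onto
  \<open>R\<close>.\<close>

lemma au_image: "au ` G 0 j = poly_part j"
proof (intro equalityI subsetI)
  fix p assume "p \<in> au ` G 0 j"
  then show "p \<in> poly_part j" unfolding au_def using lin_form_poly_part[OF aug_poly_part] by blast
next
  fix p :: "('x, 'k) poly_ring" assume p: "p \<in> poly_part j"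
  have "(1 :: ('x, 'k) poly_ring) \<in> {lin_form (aug F) v + a | v a. v \<in> free_mod (rk F 0) \<and> a \<in> I}"
    using F unfolding graded_free_resolution_def by simp
  then obtain v a where v: "1 = au v + a" "v \<in> free_mod (rk F 0)" "a \<in> I" unfolding au_def by blast
  have "component 0 a \<in> I \<inter> poly_part 0" using component_ideal[OF I v(3)] component_in_poly_part by blast
  then have "component 0 a = 0" using I0 by blast
  moreover have "component 0 (1 :: ('x, 'k) poly_ring) = 1" by (rule component_poly_part) (simp add: poly_part_def)
  ultimately have 1: "au (free_component 0 v) = 1"
    using arg_cong[OF v(1), of "component 0"] component_lin_form[of "rk F 0" "aug F" v 0, OF aug_poly_part v(2)]
    by (simp add: component_add au_def)
  have "scale p (free_component 0 v) \<in> G 0 j" by (rule scale_free_part[OF p free_component_in_free_part[OF v(2)]]) simp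
  moreover have "p = au (scale p (free_component 0 v))" using 1 by (simp add: au_def lin_form_scale)
  ultimately show "p \<in> au ` G 0 j" by blast
qed

lemma exact_G:
  assumes "p \<ge> 1"
  shows "cycles scale ys p (G k) (\<lambda>_. {0}) j \<subseteq> boundaries scale ys p (G k) (\<lambda>_. {0}) j"
  by (rule exact_free_module[OF ys]) (rule koszul_dim_poly_ring[OF g xs(1,2) assms])

lemma hom_D: "kmod_hom scaleK scale scaleK scale (D k)"
  unfolding D_def by (rule kmod_hom_lin_ext)

lemma hom_au: "kmod_hom scaleK scale scale (*) au"
  unfolding au_def by (rule kmod_hom_lin_form)

lemma gmod_Z: "FK.gmod ys (Z k)"
proof (induction k)
  case 0
  show ?case
    using kmod_hom.koszul_dim_hom(2)[OF hom_au gmod_free_part[OF ys] gmod_poly_part[OF ys] gmod_Ip _ au_image]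
    by (simp add: Ip_def)
next
  case (Suc k)
  show ?case
    unfolding Z.simps
    by (rule kmod_hom.koszul_dim_hom(2)[OF hom_D gmod_free_part[OF ys] Suc.IH FK.gmod_zero _ D_image])
      (use FK.subspace_0[OF FK.gmod_subspace[OF Suc.IH]] in blast)
qed

lemma Z_subset: "Z k m \<subseteq> G k m"
  by (cases k) auto

text \<open>The dimension of \<open>(Z \<inter> mF)/mZ\<close> in degree \<open>m\<close>, for the maximal ideal \<open>m = (ys)\<close> of \<open>R\<close>.\<close>

definition T :: "nat \<Rightarrow> int \<Rightarrow> nat" where
  "T k m = FK.dim (Z k m \<inter> FK.gens ys (G k) m) - FK.dim (FK.gens ys (Z k) m)"

lemma koszul_dim_G_Z_1: "koszul_dim scaleK scale ys 1 (G k) (Z k) j = T k (j + 1)"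
  unfolding T_def by (rule FK.koszul_dim_shift_0[OF gmod_free_part[OF ys] gmod_Z Z_subset exact_G]) simp

lemma koszul_dim_Z_step: "koszul_dim scaleK scale ys p (Z k) (\<lambda>_. {0}) j = koszul_dim scaleK scale ys p (G (Suc k)) (Z (Suc k)) j"
  unfolding Z.simps(2)
  by (rule kmod_hom.koszul_dim_hom(1)[OF hom_D gmod_free_part[OF ys] gmod_Z FK.gmod_zero _ D_image, symmetric])
    (use FK.subspace_0[OF FK.gmod_subspace[OF gmod_Z]] in blast)

lemma koszul_dim_G_Z_Suc: "koszul_dim scaleK scale ys (int p + 2) (G k) (Z k) j = koszul_dim scaleK scale ys (int p + 1) (Z k) (\<lambda>_. {0}) (j + 1)"
  using FK.koszul_dim_shift_pos[OF gmod_free_part[OF ys] gmod_Z Z_subset exact_G exact_G, of "int p + 1" k j] by (simp add: add.commute)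

text \<open>Each round replaces \<open>F_k / Z_k\<close> by \<open>F_(k+1) / Z_(k+1)\<close> and
  lowers the homological degree by one, until it is 1 and \<open>T\<close> appears. The internal
  degree \<open>j + p + 1\<close> stays fixed.\<close>

lemma koszul_dim_G_Z: "koszul_dim scaleK scale ys (int p + 1) (G k) (Z k) j = T (k + p) (j + int p + 1)"
proof (induction p arbitrary: k j)
  case 0
  then show ?case by (simp add: koszul_dim_G_Z_1)
next
  case (Suc p)
  have "koszul_dim scaleK scale ys (int (Suc p) + 1) (G k) (Z k) j = koszul_dim scaleK scale ys (int p + 2) (G k) (Z k) j"
    by (simp add: add.commute)
  also have "\<dots> = koszul_dim scaleK scale ys (int p + 1) (G (Suc k)) (Z (Suc k)) (j + 1)"
    unfolding koszul_dim_G_Z_Suc koszul_dim_Z_step ..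
  also have "\<dots> = T (Suc k + p) (j + 1 + int p + 1)" by (rule Suc.IH)
  finally show ?case by (simp add: algebra_simps)
qed

lemma koszul_dim_quotient: "koszul_dim scale (*) ys (int k + 1) poly_part Ip j = T k (j + int k + 1)"
proof -
  have "koszul_dim scaleK scale ys (int k + 1) (G 0) (Z 0) j = koszul_dim scale (*) ys (int k + 1) poly_part Ip j"
    unfolding Z.simps
    by (rule kmod_hom.koszul_dim_hom(1)[OF hom_au gmod_free_part[OF ys] gmod_poly_part[OF ys] gmod_Ip _ au_image])
      (simp add: Ip_def)
  then show ?thesis using koszul_dim_G_Z[of k 0 j] by simp
qed

lemma tensor_part_image:
  "tensor_part F k m = const_term ` (G k (int m) :: ('x, 'k) free_elt set)"
  unfolding tensor_part_def const_term_free_part ..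

lemma const_term_D: "const_term (D k v) = tensor_diff F k (const_term v)"
  unfolding D_def tensor_diff_def const_term_lin_ext by (simp add: const_term_def)

text \<open>
  For \<open>C = D\<^sup>-\<^sup>1(mF)\<close> and \<open>B = mF + ker D\<close>, the quotient \<open>C/B\<close> is mapped isomorphically by constant
  terms onto the homology of \<open>F \<otimes> K\<close>, and by the differential onto \<open>(Z \<inter> mF)/mZ\<close>.
\<close>

lemma tor_T: "qdim (tensor_cycles F (Suc k) m) (tensor_boundaries F (Suc k) m) = T k (int m)"
proof -
  define C where "C = {v \<in> G (Suc k) (int m). D k v \<in> FK.gens ys (G k) (int m)}"
  define B where "B = {u + v | u v. u \<in> FK.gens ys (G (Suc k)) (int m) \<and> v \<in> Z (Suc k) (int m)}"
  note gens = gens_free_part[OF g xs(3)]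
  interpret D: kmod_hom scaleK scale scaleK scale "D k" by (rule hom_D)
  have DG: "D k v \<in> G k (int m)" if "v \<in> G (Suc k) (int m)" for v
    unfolding D_def by (rule lin_ext_free_part[OF diff_free_part that])
  have gmG: "FK.gmod ys (FK.gens ys (G k))" for k by (rule FK.gmod_gens[OF gmod_free_part[OF ys]]) simp
  have subC: "FK.subspace C"
    using FK.gmod_subspace[OF gmG, of k "int m"] subspace_free_part[of "rk F (Suc k)" "int m"]
    unfolding C_def FK.subspace_def by (auto simp: D.hom_add D.hom_scale simp del: FK.gens.simps)
  have fdsC: "findim scaleK C"
    by (rule FK.findim_subspace[OF findim_free_part subC]) (auto simp: C_def)
  have "findim scaleK B" unfolding B_def by (intro FK.findim_sums FK.gmod_findim[OF gmG] FK.gmod_findim[OF gmod_Z])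
  then have subB: "FK.subspace B" by (rule FK.findim_imp_subspace)
  have ctD: "const_term (D k v) = 0" if "const_term v = 0" for v
    unfolding const_term_D that tensor_diff_def by (simp add: lin_ext_def)
  have BC: "B \<subseteq> C"
  proof
    fix w assume "w \<in> B"
    then obtain u v where w: "w = u + v" "u \<in> G (Suc k) (int m)" "const_term u = 0" "v \<in> G (Suc k) (int m)" "D k v = 0"
      unfolding B_def gens by auto
    have "D k w = D k u" unfolding w(1) by (simp add: D.hom_add w(5))
    moreover have "w \<in> G (Suc k) (int m)" unfolding w(1) using w(2,4) by (rule FK.subspace_add[OF subspace_free_part])
    ultimately show "w \<in> C" unfolding C_def gens using DG[OF w(2)] ctD[OF w(3)] by simp
  qed
  have inB1: "v \<in> B" if "v \<in> FK.gens ys (G (Suc k)) (int m)" for v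
  proof -
    have "v = v + 0" by simp
    then show ?thesis unfolding B_def using that FK.subspace_0[OF FK.gmod_subspace[OF gmod_Z]] by blast
  qed
  have inB2: "v \<in> B" if "v \<in> Z (Suc k) (int m)" for v
  proof -
    have "v = 0 + v" by simp
    then show ?thesis unfolding B_def using that FK.subspace_0[OF FK.gmod_subspace[OF gmG]] by blast
  qed
  have "FK.dim C - FK.dim B = vs.dim (const_term ` C) - vs.dim (const_term ` B)"
  proof (rule dim_quotient_image[OF linear_const_term fdsC subB BC])
    fix v assume "v \<in> C" "const_term v = 0"
    then show "v \<in> B" by (intro inB1) (simp only: gens C_def, simp)
  qed
  moreover have "FK.dim C - FK.dim B = FK.dim (D k ` C) - FK.dim (D k ` B)"
  proof (rule dim_quotient_image[OF D.linear_hom fdsC subB BC])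
    fix v assume "v \<in> C" "D k v = 0"
    then show "v \<in> B" by (intro inB2) (simp add: C_def)
  qed
  moreover have "D k ` C = Z k (int m) \<inter> FK.gens ys (G k) (int m)"
    unfolding C_def D_image[symmetric] by blast
  moreover have "D k ` B = FK.gens ys (Z k) (int m)"
  proof -
    have "D k ` B = D k ` FK.gens ys (G (Suc k)) (int m)"
    proof (intro equalityI subsetI)
      fix w assume "w \<in> D k ` B"
      then obtain u v where "w = D k (u + v)" "u \<in> FK.gens ys (G (Suc k)) (int m)" "D k v = 0"
        unfolding B_def by (auto simp del: FK.gens.simps)
      then show "w \<in> D k ` FK.gens ys (G (Suc k)) (int m)" by (auto simp: D.hom_add simp del: FK.gens.simps)
    qed (use inB1 in blast)
    also have "\<dots> = FK.gens ys (\<lambda>j. D k ` G (Suc k) j) (int m)" by (rule D.hom_gens[symmetric])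
    also have "\<dots> = FK.gens ys (Z k) (int m)" unfolding D_image ..
    finally show ?thesis .
  qed
  moreover have "const_term ` C = tensor_cycles F (Suc k) m"
  proof (intro equalityI subsetI)
    fix w assume "w \<in> const_term ` C"
    then obtain v where "w = const_term v" "v \<in> G (Suc k) (int m)" "const_term (D k v) = 0"
      unfolding C_def gens by blast
    then show "w \<in> tensor_cycles F (Suc k) m"
      unfolding tensor_cycles_def tensor_part_image by (simp add: const_term_D)
  next
    fix w assume "w \<in> tensor_cycles F (Suc k) m"
    then obtain v :: "('x, 'k) free_elt"
      where v: "w = const_term v" "v \<in> G (Suc k) (int m)" "tensor_diff F k (const_term v) = 0"
      unfolding tensor_cycles_def tensor_part_image by auto
    then have "v \<in> C" unfolding C_def gens using DG by (simp add: const_term_D)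
    then show "w \<in> const_term ` C" using v(1) by blast
  qed
  moreover have "const_term ` B = tensor_boundaries F (Suc k) m"
  proof -
    have "const_term ` B = const_term ` Z (Suc k) (int m)"
    proof (intro equalityI subsetI)
      fix w assume "w \<in> const_term ` B"
      then obtain u v where "w = const_term (u + v)" "const_term u = 0" "v \<in> Z (Suc k) (int m)"
        unfolding B_def gens by blast
      then show "w \<in> const_term ` Z (Suc k) (int m)" by (auto simp: const_term_add simp del: Z.simps)
    qed (use inB2 in blast)
    also have "\<dots> = tensor_diff F (Suc k) ` tensor_part F (Suc k + 1) m"
      unfolding D_image[symmetric] tensor_part_image image_image const_term_D by simp
    finally show ?thesis unfolding tensor_boundaries_def .
  qed
  ultimately show ?thesis unfolding qdim_def T_def by simp
qed

theorem tor_koszul: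
  "qdim (tensor_cycles F (Suc k) m) (tensor_boundaries F (Suc k) m) =
   koszul_dim scale (*) ys (int k + 1) poly_part Ip (int m - int k - 1)"
  unfolding tor_T koszul_dim_quotient by simp

end

section \<open>Koszul homology of annihilated and of truncated modules\<close>

context vector_space
begin

text \<open>Rank-nullity for addition on \<open>A \<times> B\<close>, whose kernel consists of the
  pairs \<open>(x, - x)\<close> with \<open>x \<in> A \<inter> B\<close>.\<close>

lemma dim_sums_Int_findim:
  assumes A: "findim scale A" and B: "findim scale B"
  shows "dim {x + y | x y. x \<in> A \<and> y \<in> B} + dim (A \<inter> B) = dim A + dim B"
proof -
  let ?s = "\<lambda>c p. (scale c (fst p), scale c (snd p))"
  interpret PP: vector_space ?s
    by unfold_locales (auto simp: scale_right_distrib scale_left_distrib)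
  have lin: "Vector_Spaces.linear scale ?s (\<lambda>x. (x, 0))" "Vector_Spaces.linear scale ?s (\<lambda>x. (0, x))"
    "Vector_Spaces.linear ?s scale fst" "Vector_Spaces.linear ?s scale snd"
    "Vector_Spaces.linear ?s scale (\<lambda>p. fst p + snd p)"
    by (auto simp: Vector_Spaces.linear_iff vector_space_axioms PP.vector_space_axioms scale_right_distrib algebra_simps)
  have 0: "0 \<in> A" "0 \<in> B"
    using A B by (auto intro: subspace_0 findim_imp_subspace)
  have prod: "A \<times> B = {x + y | x y. x \<in> (\<lambda>x. (x, 0)) ` A \<and> y \<in> (\<lambda>x. (0, x)) ` B}"
    by force
  have AB: "findim ?s (A \<times> B)"
    unfolding prod by (intro PP.findim_sums findim_image[OF lin(1) A] findim_image[OF lin(2) B])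
  note subA = findim_imp_subspace[OF A] and subB = findim_imp_subspace[OF B]
  have 1: "fst ` (A \<times> B) = A" using 0 by auto
  let ?K = "{p \<in> A \<times> B. fst p = 0}"
  have K: "findim ?s ?K"
    by (rule PP.findim_subspace[OF AB])
      (use PP.findim_imp_subspace[OF AB] in \<open>auto simp: PP.subspace_def\<close>)
  have "PP.dim ?K = dim (snd ` ?K)"
    by (rule dim_image_inj[OF lin(4) K, symmetric]) (auto simp: prod_eq_iff)
  moreover have "snd ` ?K = B" using 0 by force
  ultimately have AB_dim: "PP.dim (A \<times> B) = dim A + dim B"
    using rank_nullity[OF lin(3) AB] 1 by simp
  let ?L = "{p \<in> A \<times> B. fst p + snd p = 0}"
  have "PP.subspace ?L"
    using PP.findim_imp_subspace[OF AB] unfolding PP.subspace_def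
    by (auto simp: scale_right_distrib[symmetric]) (metis add.assoc add.left_commute add_0_right)
  then have L: "findim ?s ?L" by (rule PP.findim_subspace[OF AB]) blast
  have "PP.dim ?L = dim (fst ` ?L)"
    by (rule dim_image_inj[OF lin(3) L, symmetric]) (auto simp: prod_eq_iff)
  moreover have "fst ` ?L = A \<inter> B"
  proof (intro equalityI subsetI)
    fix x assume "x \<in> fst ` ?L"
    then obtain y where "x \<in> A" "y \<in> B" "x + y = 0" by auto
    then show "x \<in> A \<inter> B" using subspace_neg[OF subB, of y] by (simp add: eq_neg_iff_add_eq_0[symmetric])
  next
    fix x assume "x \<in> A \<inter> B"
    then have "(x, - x) \<in> ?L" using subspace_neg[OF subB] by simp
    then show "x \<in> fst ` ?L" by force
  qed
  moreover have "(\<lambda>p. fst p + snd p) ` (A \<times> B) = {x + y | x y. x \<in> A \<and> y \<in> B}" by force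
  ultimately show ?thesis using rank_nullity[OF lin(5) AB] AB_dim by simp
qed

end

context kmod
begin

text \<open>With \<open>P/Q\<close> zero in the neighbouring degrees, the differentials into and out
  of degree \<open>j\<close> vanish, so the homology is the whole chain space.\<close>

lemma koszul_dim_annihilated:
  assumes P: "gmod ys P" and Q: "gmod ys Q" and QP: "\<And>j. Q j \<subseteq> P j"
    and eq: "P (j - 1) = Q (j - 1)" "P (j + 1) = Q (j + 1)"
  shows "koszul_dim s act ys p P Q j = (if p \<ge> 0 then length ys choose nat p else 0) * (dim (P j) - dim (Q j))"
proof -
  have "cycles act ys p P Q j = chains p (length ys) (P j)"
    unfolding cycles_def
    using gmod_kdiff[OF P] chains_values[OF _ subspace_0[OF gmod_subspace[OF Q]]] eq(2) by fastforce
  moreover have "boundaries act ys p P Q j = chains p (length ys) (Q j)"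
  proof (intro equalityI subsetI)
    fix c assume "c \<in> boundaries act ys p P Q j"
    then obtain e q where c: "c = kdiff act ys e + q" "e \<in> chains (p + 1) (length ys) (Q (j - 1))" "q \<in> chains p (length ys) (Q j)"
      unfolding boundaries_def eq by blast
    have "kdiff act ys e \<in> chains p (length ys) (Q j)" using gmod_kdiff[OF Q c(2)] by simp
    then show "c \<in> chains p (length ys) (Q j)" unfolding c(1) using c(3) by (rule chains_add[OF gmod_subspace[OF Q]])
  next
    fix c assume "c \<in> chains p (length ys) (Q j)"
    then show "c \<in> boundaries act ys p P Q j" using chains_boundaries[OF P] by blast
  qed
  ultimately show ?thesis
    unfolding koszul_dim_def by (simp add: dim_chains[OF gmod_findim[OF P]] dim_chains[OF gmod_findim[OF Q]] diff_mult_distrib2)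
qed

text \<open>The rank of the Koszul differential on \<open>P/Q\<close> out of homological degree \<open>p\<close> and internal
  degree \<open>j\<close>.\<close>

definition kdiff_rank :: "'r list \<Rightarrow> int \<Rightarrow> (int \<Rightarrow> 'v set) \<Rightarrow> (int \<Rightarrow> 'v set) \<Rightarrow> int \<Rightarrow> nat" where
  "kdiff_rank ys p P Q j = ch.dim (chains p (length ys) (P j)) - ch.dim (cycles act ys p P Q j)"

text \<open>At an exact spot the ranks of the outgoing and the incoming differential add up to the
  dimension of the chain space of \<open>P/Q\<close>. This is a recursion along the strand
  \<open>(p, j), (p + 1, j - 1), ...\<close>.\<close>

lemma kdiff_rank_exact:
  assumes P: "gmod ys P" and Q: "gmod ys Q" and QP: "\<And>j. Q j \<subseteq> P j"
    and ex: "cycles act ys p P Q j \<subseteq> boundaries act ys p P Q j" and p: "p \<ge> 0"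
  shows "kdiff_rank ys p P Q j + kdiff_rank ys (p + 1) P Q (j - 1) =
    (length ys choose nat p) * (dim (P j) - dim (Q j))"
proof -
  let ?n = "length ys"
  let ?V = "chains (p + 1) ?n (P (j - 1))" and ?W = "cycles act ys (p + 1) P Q (j - 1)"
  have fV: "findim (chain_scale s) ?V" by (rule findim_chains[OF gmod_findim[OF P]])
  have fQ: "findim (chain_scale s) (chains p ?n (Q j))" by (rule findim_chains[OF gmod_findim[OF Q]])
  have eq: "cycles act ys p P Q j = boundaries act ys p P Q j"
    using ex boundaries_cycles[OF P Q QP] by blast
  have int: "kdiff act ys ` ?V \<inter> chains p ?n (Q j) = kdiff act ys ` ?W"
  proof (intro equalityI subsetI)
    fix c assume "c \<in> kdiff act ys ` ?V \<inter> chains p ?n (Q j)"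
    then obtain e where e: "c = kdiff act ys e" "e \<in> ?V" "c \<in> chains p ?n (Q j)" by blast
    have "kdiff act ys e l \<in> Q (j - 1 + 1)" for l
      using chains_values[OF e(3) subspace_0[OF gmod_subspace[OF Q]], of l] unfolding e(1) by simp
    then show "c \<in> kdiff act ys ` ?W" using e(1,2) unfolding cycles_def by blast
  next
    fix c assume "c \<in> kdiff act ys ` ?W"
    then obtain e where e: "c = kdiff act ys e" "e \<in> ?V" "\<And>l. kdiff act ys e l \<in> Q (j - 1 + 1)"
      unfolding cycles_def by blast
    have "c \<in> chains (p + 1 - 1) ?n (Q (j - 1 + 1))"
      unfolding e(1) using gmod_kdiff[OF P e(2)] e(3) by (rule chains_valuesI)
    then show "c \<in> kdiff act ys ` ?V \<inter> chains p ?n (Q j)" using e(1,2) by simp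
  qed
  have "ch.dim (boundaries act ys p P Q j) + ch.dim (kdiff act ys ` ?W) = ch.dim (kdiff act ys ` ?V) + ch.dim (chains p ?n (Q j))"
    using ch.dim_sums_Int_findim[OF findim_image[OF linear_kdiff fV] fQ, of ys]
    unfolding int boundaries_sums[symmetric] .
  moreover have "ch.dim ?V - ch.dim ?W = ch.dim (kdiff act ys ` ?V) - ch.dim (kdiff act ys ` ?W)"
  proof (rule dim_quotient_image[OF linear_kdiff fV subspace_cycles[OF P Q] cycles_chains])
    fix x assume "x \<in> ?V" "kdiff act ys x = 0"
    then show "x \<in> ?W" unfolding cycles_def using subspace_0[OF gmod_subspace[OF Q]] by simp
  qed
  moreover have "ch.dim (kdiff act ys ` ?W) \<le> ch.dim (kdiff act ys ` ?V)"
    by (rule ch.findim_dim_mono) (intro findim_image[OF linear_kdiff fV], intro image_mono cycles_chains)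
  moreover have "ch.dim (cycles act ys p P Q j) \<le> ch.dim (chains p ?n (P j))"
    by (rule ch.findim_dim_mono[OF findim_chains[OF gmod_findim[OF P]] cycles_chains])
  moreover have "ch.dim (chains p ?n (P j)) - ch.dim (chains p ?n (Q j)) = (?n choose nat p) * (dim (P j) - dim (Q j))"
    using p by (simp add: dim_chains[OF gmod_findim[OF P]] dim_chains[OF gmod_findim[OF Q]] diff_mult_distrib2)
  ultimately show ?thesis unfolding kdiff_rank_def eq by linarith
qed

end

text \<open>The recursion of \<open>kdiff_rank_exact\<close>, verified for the closed formula in
  \<open>kdiff_rank_J0\<close>. After an application of Pascal's rule, both products are regrouped
  by \<open>choose_mult\<close> so that \<open>(n + j) choose Suc j\<close> splits off; Pascal's
  rule then adds the cofactors.\<close>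

lemma binomial_identity:
  assumes "p \<ge> 1"
  shows "((p + j) choose Suc j) * ((n + Suc j) choose (p + Suc j)) + ((p + j) choose j) * ((n + j) choose (Suc p + j)) =
    (n choose p) * (((n + Suc j) choose n) - ((n + j) choose n))"
proof (cases n)
  case 0
  then show ?thesis using assms by simp
next
  case (Suc k)
  obtain q where q: "p = Suc q" using assms by (cases p) auto
  have r: "(((n + Suc j) choose n) - ((n + j) choose n)) = (n + j) choose Suc j"
    using binomial_symmetric[of k "n + j"] Suc by simp
  have mult: "((n + j) choose r) * (r choose Suc j) = ((n + j) choose Suc j) * (k choose (r - Suc j))"
    if "Suc j \<le> r" for r
  proof (cases "r \<le> n + j")
    case True
    then show ?thesis using choose_mult[of "Suc j" r "n + j"] that Suc by simp
  next
    case False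
    then have "k < r - Suc j" using Suc by simp
    then show ?thesis using False by (simp add: binomial_eq_0)
  qed
  have "((p + j) choose Suc j) * ((n + Suc j) choose (p + Suc j)) + ((p + j) choose j) * ((n + j) choose (Suc p + j))
    = ((n + j) choose (p + j)) * ((p + j) choose Suc j) + ((n + j) choose Suc (p + j)) * (Suc (p + j) choose Suc j)"
    by (simp add: algebra_simps)
  also have "\<dots> = ((n + j) choose Suc j) * (k choose q) + ((n + j) choose Suc j) * (k choose Suc q)"
    using mult[of "p + j"] mult[of "Suc (p + j)"] by (simp add: q)
  also have "\<dots> = ((n + j) choose Suc j) * (n choose p)"
    unfolding Suc q binomial_Suc_Suc by (simp only: distrib_left)
  finally show ?thesis unfolding r by (simp add: mult.commute)
qed

lemma dim_poly_part:
  assumes "CARD('x::finite) = n + 1"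
  shows "vs.dim (poly_part (int j) :: ('x, 'k::field) poly_ring set) = (n + j) choose n"
  unfolding poly_part_forms by (rule dim_forms[OF assms])

context resolved_ideal
begin

abbreviation "n \<equiv> length xs"
abbreviation "zs \<equiv> map var xs"
abbreviation "J0 \<equiv> RK.quot_by g poly_part (mon_part {})"

lemma card_UNIV: "CARD('x) = n + 1"
  unfolding xs(3)[symmetric] using xs(1,2) by (simp add: distinct_card)

lemma zs: "set zs \<subseteq> (poly_part 1 :: ('x, 'k) poly_ring set)" using var_poly_part by auto

lemma gmod_J0: "RK.gmod zs J0"
  by (intro RK.gmod_quot_by gmod_poly_part gmod_mon_part zs)

lemma J0_subset: "J0 j \<subseteq> poly_part j"
  by (rule RK.quot_by_le[of g "[]"]) (simp_all add: gmod_poly_part g(1) mon_part_le)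

lemma J0_exact:
  assumes "p \<ge> 1"
  shows "cycles (*) zs p poly_part J0 j \<subseteq> boundaries (*) zs p poly_part J0 j"
  using koszul_dim_mod_linear_form[OF g xs(1,2), of "{}" p j] assms
    RK.koszul_dim_0_iff[OF gmod_poly_part[OF zs] gmod_J0 J0_subset] by simp

lemma linear_form_injective: "g * p = 0 \<Longrightarrow> p = 0"
proof -
  assume "g * p = 0"
  then have "g * p \<in> mon_ideal {}" by (simp add: mon_ideal_def)
  then have "p \<in> mon_ideal {}" using linear_form_regular[OF g, of "{}" p] by simp
  then show "p = 0" by (simp add: mon_ideal_def flip: keys_eq_empty)
qed

lemma dim_image_linear_form:
  assumes "findim scale X"
  shows "vs.dim ((\<lambda>p. g * p) ` X) = vs.dim X"
  by (rule dim_image_inj[OF RK.linear_act assms]) (rule linear_form_injective)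

lemma J0_image: "J0 j = (\<lambda>p. g * p) ` poly_part (j - 1)"
  by (auto simp: RK.quot_by_def mon_part_empty)

lemma dim_J0: "vs.dim (J0 j) = vs.dim (poly_part (j - 1) :: ('x, 'k) poly_ring set)"
  unfolding J0_image by (rule dim_image_linear_form[OF findim_poly_part])

text \<open>The Koszul complex of \<open>R/gR\<close> is exact in positive degrees, so its ranks
  follow from the dimensions of the chain spaces alone. A strand ends in coefficient degree -1,
  where there are no chains; this starts the induction.\<close>

lemma kdiff_rank_J0:
  assumes "p \<ge> 1"
  shows "RK.kdiff_rank zs (int p) poly_part J0 (int j) = ((p + j - 1) choose j) * ((n + j) choose (p + j))"
  using assms
proof (induction j arbitrary: p)
  case 0
  have "RK.kdiff_rank zs (int p + 1) poly_part J0 (- 1) = 0"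
  proof -
    have "RK.ch.dim (chains (int p + 1) n (poly_part (- 1) :: ('x, 'k) poly_ring set)) = 0"
      by (simp only: RK.dim_chains[OF findim_poly_part]) (simp add: poly_part_neg)
    then show ?thesis unfolding RK.kdiff_rank_def by simp
  qed
  moreover have "RK.kdiff_rank zs (int p) poly_part J0 0 + RK.kdiff_rank zs (int p + 1) poly_part J0 (0 - 1) =
      (length (zs :: ('x, 'k) poly_ring list) choose nat (int p)) * (vs.dim (poly_part 0 :: ('x, 'k) poly_ring set) - vs.dim (J0 0))"
    by (rule RK.kdiff_rank_exact[OF gmod_poly_part[OF zs] gmod_J0 J0_subset J0_exact]) (use 0 in auto)
  moreover have "vs.dim (poly_part 0 :: ('x, 'k) poly_ring set) = 1"
    using dim_poly_part[OF card_UNIV, of 0, where 'k='k] by simp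
  moreover have "vs.dim (J0 0) = 0" unfolding dim_J0 by (simp add: poly_part_neg)
  ultimately show ?case by simp
next
  case (Suc j)
  have "RK.kdiff_rank zs (int p) poly_part J0 (int (Suc j)) + RK.kdiff_rank zs (int p + 1) poly_part J0 (int (Suc j) - 1) =
      (length (zs :: ('x, 'k) poly_ring list) choose nat (int p)) * (vs.dim (poly_part (int (Suc j)) :: ('x, 'k) poly_ring set) - vs.dim (J0 (int (Suc j))))"
    by (rule RK.kdiff_rank_exact[OF gmod_poly_part[OF zs] gmod_J0 J0_subset J0_exact]) (use Suc.prems in auto)
  moreover have "vs.dim (poly_part (int (Suc j)) :: ('x, 'k) poly_ring set) = (n + Suc j) choose n"
    by (rule dim_poly_part[OF card_UNIV])
  moreover have "vs.dim (J0 (int (Suc j))) = (n + j) choose n"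
    unfolding dim_J0 using dim_poly_part[OF card_UNIV, of j, where 'k='k] by simp
  moreover have "RK.kdiff_rank zs (int p + 1) poly_part J0 (int (Suc j) - 1) = ((p + j) choose j) * ((n + j) choose (Suc p + j))"
    using Suc.IH[of "Suc p"] by (simp add: add.commute)
  ultimately have "RK.kdiff_rank zs (int p) poly_part J0 (int (Suc j)) + ((p + j) choose j) * ((n + j) choose (Suc p + j)) =
     (n choose p) * (((n + Suc j) choose n) - ((n + j) choose n))"
    by simp
  then have "RK.kdiff_rank zs (int p) poly_part J0 (int (Suc j)) = ((p + j) choose Suc j) * ((n + Suc j) choose (p + Suc j))"
    using binomial_identity[OF Suc.prems, of j n] by linarith
  then show ?case by simp
qed

text \<open>The case of interest is \<open>R/J = A/gA\<close>.\<close>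

lemma koszul_dim_truncated:
  assumes J: "RK.gmod zs J" and JR: "\<And>j. J j \<subseteq> poly_part j"
    and low: "\<And>j. j \<le> int d \<Longrightarrow> J j = J0 j" and high: "\<And>j. j > int d \<Longrightarrow> J j = poly_part j"
    and p: "p \<ge> 1"
  shows "koszul_dim scale (*) zs (int p) poly_part J j =
    (if j = int d then ((p + d - 1) choose d) * ((n + d) choose (p + d)) else 0)"
proof -
  note R = gmod_poly_part[OF zs]
  consider "j > int d" | "j < int d" | "j = int d" by linarith
  then show ?thesis
  proof cases
    case 1
    then show ?thesis using RK.koszul_dim_trivial[OF R J JR high[OF 1, symmetric]] by simp
  next
    case 2
    then have "J j = J0 j" "J (j + 1) = J0 (j + 1)" by (auto intro!: low)
    then have "koszul_dim scale (*) zs (int p) poly_part J j = koszul_dim scale (*) zs (int p) poly_part J0 j"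
      unfolding koszul_dim_def cycles_def boundaries_def by simp
    also have "\<dots> = 0"
      using p J0_exact[of "int p" j] by (subst RK.koszul_dim_0_iff[OF R gmod_J0 J0_subset]) simp
    finally show ?thesis using 2 by simp
  next
    \<comment> \<open>Since degree \<open>d + 1\<close> of \<open>R/J\<close> is zero, every chain
      is a cycle, whereas the boundaries are those of \<open>R/gR\<close>, which by exactness are
      the cycles of \<open>R/gR\<close>. The difference is the rank of a differential on
      \<open>R/gR\<close>.\<close>
    case 3
    have "cycles (*) zs (int p) poly_part J j = chains (int p) (length (zs :: ('x, 'k) poly_ring list)) (poly_part j)"
    proof -
      have "kdiff (*) zs c l \<in> J (j + 1)" if "c \<in> chains (int p) (length (zs :: ('x, 'k) poly_ring list)) (poly_part j)" for c l
        unfolding high[of "j + 1", unfolded 3, simplified, folded 3]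
        by (rule chains_values[OF RK.gmod_kdiff[OF R that]]) (simp add: poly_part_def)
      then show ?thesis unfolding cycles_def by blast
    qed
    moreover have "boundaries (*) zs (int p) poly_part J j = cycles (*) zs (int p) poly_part J0 j"
    proof -
      have "boundaries (*) zs (int p) poly_part J j = boundaries (*) zs (int p) poly_part J0 j"
        unfolding boundaries_def using low[of j] 3 by simp
      also have "\<dots> = cycles (*) zs (int p) poly_part J0 j"
        using J0_exact[of "int p" j] RK.boundaries_cycles[OF R gmod_J0 J0_subset] p by (intro equalityI) auto
      finally show ?thesis .
    qed
    ultimately have "koszul_dim scale (*) zs (int p) poly_part J j = RK.kdiff_rank zs (int p) poly_part J0 (int d)"
      unfolding koszul_dim_def RK.kdiff_rank_def 3 by simp
    then show ?thesis using kdiff_rank_J0[OF p, of d] 3 by simp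
  qed
qed

text \<open>Rank-nullity for multiplication by \<open>g\<close> on \<open>A\<close>, lifted to
  \<open>R\<close>. There \<open>g\<close> acts injectively, and the part of its image that lies in
  \<open>I\<close> is \<open>g\<close> times the annihilator.\<close>

lemma dim_quot_by_plus_ann_by:
  "vs.dim (RK.quot_by g poly_part Ip (j + 1)) + vs.dim (RK.ann_by g poly_part Ip j) =
   vs.dim (poly_part j :: ('x, 'k) poly_ring set) + vs.dim (Ip (j + 1))"
proof -
  let ?K = "RK.ann_by g poly_part Ip j"
  have gR: "RK.gmod ys poly_part" by (rule gmod_poly_part[OF ys])
  have K: "findim scale ?K" by (rule RK.gmod_findim[OF RK.gmod_ann_by[OF gR gmod_Ip]])
  have I1: "findim scale (Ip (j + 1))" by (rule RK.gmod_findim[OF gmod_Ip])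
  have "(\<lambda>p. g * p) ` poly_part j \<inter> Ip (j + 1) = (\<lambda>p. g * p) ` ?K"
    by (auto simp: RK.ann_by_def)
  moreover have "{x + y | x y. x \<in> (\<lambda>p. g * p) ` poly_part j \<and> y \<in> Ip (j + 1)} = RK.quot_by g poly_part Ip (j + 1)"
    by (auto simp: RK.quot_by_def)
  ultimately show ?thesis
    using vs.dim_sums_Int_findim[OF findim_image[OF RK.linear_act findim_poly_part] I1, of g j]
    by (simp add: dim_image_linear_form findim_poly_part K)
qed

end

text \<open>For a Lefschetz form \<open>g\<close>, the annihilator of \<open>g\<close> in \<open>A\<close> lives in the degrees in which the
  Hilbert function drops; as no two of these are adjacent, it is killed by all linear forms.\<close>

theorem (in resolved_ideal) tor_lefschetz:
  assumes low: "\<And>j. j \<le> int d \<Longrightarrow> Ip j = {0}"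
    and high: "\<And>j. j > int d \<Longrightarrow> RK.quot_by g poly_part Ip j = poly_part j"
    and ann: "\<And>j. RK.ann_by g poly_part Ip j \<noteq> Ip j \<Longrightarrow> j \<in> U"
    and U: "\<And>j. j \<in> U \<Longrightarrow> j \<ge> int d + 2 \<and> j + 1 \<notin> U"
  shows "qdim (tensor_cycles F (Suc k) m) (tensor_boundaries F (Suc k) m) =
    (if int m - int k - 1 = int d then ((Suc k + d - 1) choose d) * ((n + d) choose (Suc k + d)) else 0) +
    (n choose k) * (vs.dim (RK.ann_by g poly_part Ip (int m - int k - 1)) - vs.dim (Ip (int m - int k - 1)))"
proof -
  let ?K = "RK.ann_by g poly_part Ip" and ?J = "RK.quot_by g poly_part Ip"
  define j where "j = int m - int k - 1"
  have R: "RK.gmod ys poly_part" by (rule gmod_poly_part[OF ys])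
  note Rz = RK.gmod_tl[OF R] and Iz = RK.gmod_tl[OF gmod_Ip]
  have IR: "\<And>j. Ip j \<subseteq> poly_part j" unfolding Ip_def by blast
  have K: "RK.gmod zs ?K" by (rule RK.gmod_ann_by[OF Rz Iz])
  have J: "RK.gmod zs ?J" by (rule RK.gmod_quot_by[OF Rz Iz])
  have IK: "\<And>j. Ip j \<subseteq> ?K j"
    unfolding RK.ann_by_def using IR RK.gmod_act[OF gmod_Ip, of g] by auto
  have JR: "\<And>j. ?J j \<subseteq> poly_part j" by (rule RK.quot_by_le[OF R IR])
  have lowJ: "\<And>j. j \<le> int d \<Longrightarrow> ?J j = J0 j"
    unfolding RK.quot_by_def mon_part_empty using low by simp
  note N = koszul_dim_truncated[OF J JR lowJ high]
  have Kq: "koszul_dim scale (*) zs q ?K Ip i = (if q \<ge> 0 then n choose nat q else 0) * (vs.dim (?K i) - vs.dim (Ip i))" for q i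
  proof (cases "?K i = Ip i")
    case True
    then show ?thesis using RK.koszul_dim_trivial[OF K Iz IK] by simp
  next
    case False
    then have "i \<in> U" by (rule ann)
    then have "i - 1 \<notin> U" "i + 1 \<notin> U" using U[of i] U[of "i - 1"] by auto
    then have "?K (i - 1) = Ip (i - 1)" "?K (i + 1) = Ip (i + 1)" using ann by blast+
    then show ?thesis using RK.koszul_dim_annihilated[OF K Iz IK] by simp
  qed
  \<comment> \<open>In both conditions of \<open>cone_dim\<close> the connecting homomorphism starts
    at \<open>A/gA\<close> in degree \<open>d\<close>, or else its source is zero. It then ends in
    degree \<open>d + 1\<close>, which the bound \<open>d + 2\<close> on \<open>U\<close> keeps free
    of the annihilator.\<close>
  have K0: "koszul_dim scale (*) zs q ?K Ip (int d + 1) = 0" for q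
  proof -
    have "?K (int d + 1) = Ip (int d + 1)" using ann[of "int d + 1"] U[of "int d + 1"] by force
    then show ?thesis by (rule RK.koszul_dim_trivial[OF K Iz IK])
  qed
  note exJ = RK.koszul_dim_0_iff[OF Rz J JR] and exK = RK.koszul_dim_0_iff[OF K Iz IK]
  have "koszul_dim scale (*) ys (int k + 1) poly_part Ip j =
      koszul_dim scale (*) zs (int k + 1) poly_part ?J j + koszul_dim scale (*) zs (int k + 1 - 1) ?K Ip j"
  proof (rule RK.cone_dim[OF R gmod_Ip IR])
    show "cycles (*) zs (int k + 1) poly_part ?J j \<subseteq> boundaries (*) zs (int k + 1) poly_part ?J j \<or>
      cycles (*) zs (int k + 1 - 2) ?K Ip (j + 1) \<subseteq> boundaries (*) zs (int k + 1 - 2) ?K Ip (j + 1)"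
      using N[where p="Suc k" and j=j] K0 unfolding exJ[symmetric] exK[symmetric]
      by (cases "j = int d") (simp_all add: add.commute)
    show "cycles (*) zs (int k + 1 - 1) ?K Ip j \<subseteq> boundaries (*) zs (int k + 1 - 1) ?K Ip j \<or>
      cycles (*) zs (int k + 1 + 1) poly_part ?J (j - 1) \<subseteq> boundaries (*) zs (int k + 1 + 1) poly_part ?J (j - 1)"
      using N[where p="Suc (Suc k)" and j="j - 1"] K0[of "int k + 1 - 1"] unfolding exJ[symmetric] exK[symmetric]
      by (cases "j = int d + 1") (simp_all add: add.commute)
  qed
  also have "\<dots> = (if j = int d then ((Suc k + d - 1) choose d) * ((n + d) choose (Suc k + d)) else 0) +
    (n choose k) * (vs.dim (?K j) - vs.dim (Ip j))"
    using N[where p="Suc k" and j=j] Kq[of "int k" j] by (simp add: add.commute)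
  finally show ?thesis unfolding tor_koszul j_def .
qed

section \<open>Drops of the Hilbert function and the resulting Betti numbers\<close>

lemma hilb_shape_drop:
  assumes shape: "hilb_shape I s l u" and j: "u 1 \<le> j"
  shows "hilb I (j + 1) \<le> hilb I j \<and> (hilb I (j + 1) \<noteq> hilb I j \<longrightarrow> (\<exists>k\<in>{2..l + 1}. u k = j + 1))"
proof (cases "j > s")
  case True
  then show ?thesis using shape by (simp add: hilb_shape_def)
next
  case False
  \<comment> \<open>\<open>k\<close> is the plateau containing \<open>j\<close>; the value can
    change only at its end, where \<open>u (k + 1) = j + 1\<close>. For \<open>k = l\<close> this
    end is \<open>s + 1\<close>, the drop to 0.\<close>
  define k where "k = Max {k \<in> {1..l}. u k \<le> j}"
  have fin: "finite {k \<in> {1..l}. u k \<le> j}" and ne: "{k \<in> {1..l}. u k \<le> j} \<noteq> {}"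
    using shape j by (auto simp: hilb_shape_def)
  have k: "k \<in> {1..l}" "u k \<le> j" using Max_in[OF fin ne] unfolding k_def by auto
  have "j < u (k + 1)"
  proof (cases "k = l")
    case True
    then show ?thesis using shape False by (simp add: hilb_shape_def)
  next
    case False
    show ?thesis
    proof (rule ccontr)
      assume "\<not> ?thesis"
      then have "k + 1 \<in> {k \<in> {1..l}. u k \<le> j}" using False k(1) by auto
      then show False using Max_ge[OF fin] unfolding k_def[symmetric] by fastforce
    qed
  qed
  have const: "hilb I i = hilb I (u k)" if "u k \<le> i" "i < u (k + 1)" for i
  proof -
    have "\<forall>k\<in>{1..l}. \<forall>j\<in>{u k..<u (k + 1)}. hilb I j = hilb I (u k)"
      using shape unfolding hilb_shape_def by blast
    moreover have "i \<in> {u k..<u (k + 1)}" using that by simp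
    ultimately show ?thesis using k(1) by blast
  qed
  show ?thesis
  proof (cases "j + 1 < u (k + 1)")
    case True
    then show ?thesis using const[of j] const[of "j + 1"] k(2) by simp
  next
    case False
    then have u: "u (k + 1) = j + 1" using \<open>j < u (k + 1)\<close> by simp
    have "hilb I (j + 1) \<le> hilb I j"
    proof (cases "k = l")
      case True
      then have "j + 1 = s + 1" using shape u by (simp add: hilb_shape_def)
      then show ?thesis using shape by (simp add: hilb_shape_def)
    next
      case False
      then have "k + 1 \<in> {2..l}" using k(1) by auto
      then have "hilb I (u (k + 1)) < hilb I (u (k + 1) - 1)" using shape unfolding hilb_shape_def by blast
      then show ?thesis unfolding u by simp
    qed
    moreover have "k + 1 \<in> {2..l + 1}" using k(1) by auto
    ultimately show ?thesis using u by blast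
  qed
qed

lemma hilb_shape_strict_drop:
  assumes shape: "hilb_shape I s l u" and k: "k \<in> {2..l + 1}"
  shows "hilb I (u k) < hilb I (u k - 1)"
proof (cases "k = l + 1")
  case True
  then show ?thesis using shape by (simp add: hilb_shape_def)
next
  case False
  then have "k \<in> {2..l}" using k by auto
  then show ?thesis using shape unfolding hilb_shape_def by blast
qed

lemma gaps:
  fixes u :: "nat \<Rightarrow> nat"
  assumes "\<And>k. 2 \<le> k \<Longrightarrow> k < l + 1 \<Longrightarrow> u k + 2 \<le> u (k + 1)" "2 \<le> k" "k < k'" "k' \<le> l + 1"
  shows "u k + 2 \<le> u k'"
  using assms(3,4)
proof (induction k')
  case (Suc k')
  then show ?case using assms(1)[of k'] assms(2) by (cases "k = k'") auto
qed simp

text \<open>The first value is the Betti number of a polynomial ring in \<open>n\<close> variables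
  modulo the power \<open>d + 1\<close> of its maximal ideal. Compared with the formula in English
  it carries the factor \<open>(d + i - 1) choose d\<close>, which is 1 for \<open>i = 1\<close>.
  For the square of the maximal ideal in two variables, with Betti numbers 3 and 2, this factor
  yields the 2. The index \<open>k\<close> runs up to \<open>l + 1\<close> with
  \<open>u (l + 1) = s + 1\<close>, so the final drop to 0 counts as a drop, also in the gap
  condition.\<close>

theorem corollary3p21:
  fixes I :: "('x::finite, 'k::field) poly_ring set"
    and n d s l i :: nat and u :: "nat \<Rightarrow> nat"
  assumes "CARD('x) = n + 1"
    and "homogeneous_ideal I"
    and "artinian_ideal I"
    and "weak_lefschetz I"
    and "hilb_shape I s l u"
    and "d = u 1"
    and "\<And>j. j \<le> d \<Longrightarrow> hilb I j = (n + j) choose n"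
    and "u 1 + 3 \<le> u 2"
    and "\<And>k. 2 \<le> k \<Longrightarrow> k < l + 1 \<Longrightarrow> u k + 2 \<le> u (k + 1)"
    and "1 \<le> i"
  shows "tor_dim I i (i + d) = ((d + i - 1) choose d) * ((n + d) choose (i + d)) \<and>
         (\<forall>k\<in>{2..l + 1}.
            int (tor_dim I i (i + (u k - 1))) = - delta_hilb I (u k) * int (n choose (i - 1))) \<and>
         (\<forall>m. m \<noteq> i + d \<and> (\<forall>k\<in>{2..l + 1}. m \<noteq> i + (u k - 1)) \<longrightarrow> tor_dim I i m = 0)"
proof -
  note shape = assms(5)
  obtain g where g: "g \<in> forms 1" "\<And>j. mult_rank I g j = min (hilb I j) (hilb I (j + 1))"
    using assms(4) unfolding weak_lefschetz_def by blast
  have idI: "RK.M.subspace I" using assms(2) unfolding homogeneous_ideal_def by blast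
  have subI: "vs.subspace I"
    using idI unfolding vs.subspace_def RK.M.subspace_def by (simp add: scale_def mult_map_scale_conv_mult)
  have fdsI: "findim scale (I \<inter> forms j)" for j
    unfolding poly_part_forms[symmetric]
    by (rule vs.findim_subspace[OF findim_poly_part vs.subspace_inter[OF subI subspace_poly_part]]) blast
  have dim_forms: "vs.dim (forms j :: ('x, 'k) poly_ring set) = (n + j) choose n" for j
    by (rule dim_forms[OF assms(1)])
  have hilb: "hilb I j + vs.dim (I \<inter> forms j) = vs.dim (forms j :: ('x, 'k) poly_ring set)" for j
    using vs.findim_dim_mono[OF findim_poly_part[of "int j"], of "I \<inter> forms j"]
    unfolding poly_part_forms hilb_def qdim_def by auto
  have low0: "I \<inter> forms j = {0}" if "j \<le> d" for j
  proof -
    have "vs.dim (I \<inter> forms j) \<le> vs.dim ({0} :: ('x, 'k) poly_ring set)"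
      using hilb[of j] assms(7)[OF that] dim_forms[of j] by simp
    moreover have "{0} \<subseteq> I \<inter> forms j" using vs.subspace_0[OF vs.findim_imp_subspace[OF fdsI]] by blast
    ultimately show ?thesis using vs.findim_dim_eq[OF fdsI vs.subspace_single_0] by metis
  qed
  have h0: "hilb I 0 = 1" using assms(7)[of 0] by simp
  \<comment> \<open>This excludes \<open>g = 0\<close>, whose rank in degree 0 would be 0 instead of
    \<open>min (hilb I 0) (hilb I 1)\<close>. For \<open>u 1 = 0\<close> the first plateau is long
    enough to contain degree 1.\<close>
  have "hilb I 1 > 0"
  proof (cases "u 1 = 0")
    case True
    have "hilb I 1 = hilb I (u 1)"
    proof -
      have "1 \<in> {u 1..<u (1 + 1)}" using True assms(8) by (simp add: numeral_2_eq_2)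
      moreover have "1 \<in> {1..l}" using shape by (simp add: hilb_shape_def)
      ultimately show ?thesis using shape unfolding hilb_shape_def by blast
    qed
    then have "hilb I 1 = hilb I 0" using True by simp
    then show ?thesis using h0 by simp
  next
    case False
    then have "hilb I 0 < hilb I (0 + 1)" using shape unfolding hilb_shape_def by blast
    then show ?thesis by simp
  qed
  have "g \<noteq> 0"
  proof
    assume "g = 0"
    have "{0 * p + q | p q. p \<in> forms 0 \<and> q \<in> I \<inter> forms (0 + 1)} = I \<inter> (forms (0 + 1) :: ('x, 'k) poly_ring set)"
      by (auto simp: forms_def intro: exI[of _ 0])
    then have "mult_rank I g 0 = 0" unfolding mult_rank_def \<open>g = 0\<close> qdim_def by simp
    then show False using g(2)[of 0] h0 \<open>hilb I 1 > 0\<close> by simp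
  qed
  then obtain t where t: "t \<in> keys g" by (metis ex_in_conv keys_eq_empty)
  then have "mdeg t = 1" using g(1) by (simp add: forms_def)
  then obtain x0 where x0: "t = single x0 1" by (rule mdeg_eq_1)
  obtain xs where xs: "set xs = UNIV - {x0}" "distinct xs"
    using finite_distinct_list[of "UNIV - {x0}"] by auto
  \<comment> \<open>The same \<open>SOME\<close> as in \<open>tor_dim\<close>, so that the locale
    speaks of the chosen resolution.\<close>
  define F where "F = (SOME F. graded_free_resolution I F)"
  have F: "graded_free_resolution I F"
    unfolding F_def by (rule someI_ex[OF graded_free_resolution_exists[OF assms(2)]])
  have Rp01: "poly_part 0 = (forms 0 :: ('x, 'k) poly_ring set)" "poly_part 1 = (forms 1 :: ('x, 'k) poly_ring set)"
    by (simp_all flip: poly_part_forms)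
  interpret R: resolved_ideal I F g x0 xs
  proof
    show "I \<inter> poly_part 0 = {0}" unfolding Rp01 by (rule low0) simp
    show "g \<in> poly_part 1" unfolding Rp01 by (rule g(1))
    show "lookup g (single x0 1) \<noteq> 0" using t x0 by (simp add: in_keys_iff)
  qed (use assms(2) F xs in auto)
  have n: "length xs = n" using R.card_UNIV assms(1) by simp
  have Ip: "R.Ip (int j) = I \<inter> forms j" for j by (simp add: R.Ip_def poly_part_forms)
  let ?J = "RK.quot_by g poly_part R.Ip" and ?K = "RK.ann_by g poly_part R.Ip"
  have ys: "RK.gmod R.ys poly_part" by (rule gmod_poly_part[OF R.ys])
  have fJ: "findim scale (?J j)" and scaleK: "findim scale (?K j)" for j
    by (rule RK.gmod_findim[OF RK.gmod_quot_by[OF ys R.gmod_Ip]], rule RK.gmod_findim[OF RK.gmod_ann_by[OF ys R.gmod_Ip]])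
  have IR: "R.Ip j \<subseteq> poly_part j" for j by (simp add: R.Ip_def)
  have IJ: "R.Ip j \<subseteq> ?J j" for j
  proof
    fix q assume "q \<in> R.Ip j"
    then have "g * 0 + q \<in> ?J j" by (intro RK.quot_byI) (simp add: poly_part_def)
    then show "q \<in> ?J j" by simp
  qed
  have JR: "?J j \<subseteq> poly_part j" for j by (rule RK.quot_by_le[OF ys IR])
  have IK: "R.Ip j \<subseteq> ?K j" for j
    unfolding RK.ann_by_def using IR RK.gmod_act[OF R.gmod_Ip, of g] by auto
  have dimJ: "vs.dim (?J (int j + 1)) = min (hilb I j) (hilb I (j + 1)) + vs.dim (R.Ip (int j + 1))" for j
  proof -
    have "{g * p + q | p q. p \<in> forms j \<and> q \<in> I \<inter> forms (j + 1)} = ?J (int j + 1)"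
      using Ip[of "j + 1"] by (simp add: RK.quot_by_def poly_part_forms add.commute)
    then have "mult_rank I g j = vs.dim (?J (int j + 1)) - vs.dim (R.Ip (int j + 1))"
      using Ip[of "j + 1"] by (simp add: mult_rank_def qdim_def add.commute)
    then show ?thesis using g(2)[of j] vs.findim_dim_mono[OF fJ IJ, of "int j + 1"] by linarith
  qed
  \<comment> \<open>Maximal rank makes the kernel of multiplication by \<open>g\<close> as small as
    possible: its dimension is the drop of the Hilbert function from \<open>j\<close> to
    \<open>j + 1\<close>, and 0 where there is no drop.\<close>
  have dimK: "vs.dim (?K (int j)) - vs.dim (R.Ip (int j)) = hilb I j - min (hilb I j) (hilb I (j + 1))" for j
    using R.dim_quot_by_plus_ann_by[of "int j"] dimJ[of j] hilb[of j] unfolding poly_part_forms Ip by linarith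
  define U where "U = {j. \<exists>k\<in>{2..l + 1}. j = int (u k) - 1}"
  have gap: "u k + 2 \<le> u k'" if "2 \<le> k" "k < k'" "k' \<le> l + 1" for k k'
    by (rule gaps[of l u, OF _ that]) (rule assms(9))
  have u2: "u 2 \<le> u k" if "k \<in> {2..l + 1}" for k
    using gap[of 2 k] that by (cases "k = 2") auto
  have low: "R.Ip j = {0}" if "j \<le> int d" for j
  proof (cases "j < 0")
    case True
    then show ?thesis using IR[of j] poly_part_neg[of j] vs.subspace_0[OF RK.gmod_subspace[OF R.gmod_Ip]] by blast
  next
    case False
    then show ?thesis using low0[of "nat j"] Ip[of "nat j"] that by simp
  qed
  \<comment> \<open>From degree \<open>u 1\<close> on the Hilbert function does not increase, so
    maximal rank means surjectivity, and \<open>A/gA\<close> vanishes beyond degree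
    \<open>d\<close>.\<close>
  have high: "?J j = poly_part j" if "j > int d" for j
  proof -
    define a where "a = nat (j - 1)"
    have j: "j = int a + 1" "d \<le> a" "j = int (a + 1)" using that by (auto simp: a_def)
    have "hilb I (a + 1) \<le> hilb I a" using hilb_shape_drop[OF shape, of a] j(2) assms(6) by simp
    then have "vs.dim (poly_part j :: ('x, 'k) poly_ring set) \<le> vs.dim (?J j)"
      using dimJ[of a] hilb[of "a + 1"] unfolding j(1)[symmetric] unfolding j(3) poly_part_forms Ip by simp
    then show ?thesis using vs.findim_dim_eq[OF findim_poly_part vs.findim_imp_subspace[OF fJ] JR] by blast
  qed
  have ann: "j \<in> U" if neq: "?K j \<noteq> R.Ip j" for j
  proof (cases "j < 0")
    case True
    then have "?K j \<subseteq> {0}" using poly_part_neg[of j] by (auto simp: RK.ann_by_def)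
    then show ?thesis
      using neq IK[of j] vs.subspace_0[OF RK.gmod_subspace[OF R.gmod_Ip], of j] by blast
  next
    case False
    define a where "a = nat j"
    have j: "j = int a" using False by (simp add: a_def)
    have "\<not> vs.dim (?K j) \<le> vs.dim (R.Ip j)"
      using vs.findim_dim_eq[OF scaleK RK.gmod_subspace[OF R.gmod_Ip] IK] neq by metis
    then have less: "hilb I (a + 1) < hilb I a" using dimK[of a] unfolding j by linarith
    then have "\<not> a < u 1" using shape unfolding hilb_shape_def by (meson less_asym)
    then obtain k where "k \<in> {2..l + 1}" "u k = a + 1"
      using hilb_shape_drop[OF shape, of a] less by auto
    then show ?thesis unfolding U_def j by (intro CollectI bexI[of _ k]) auto
  qed
  have U: "j \<ge> int d + 2 \<and> j + 1 \<notin> U" if jU: "j \<in> U" for j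
  proof
    obtain k where k: "k \<in> {2..l + 1}" "j = int (u k) - 1" using jU unfolding U_def by blast
    \<comment> \<open>From \<open>j = u k - 1 \<ge> u 2 - 1\<close> and
      \<open>u 2 \<ge> d + 3\<close>: here the gap of three enters.\<close>
    show "j \<ge> int d + 2" using u2[OF k(1)] assms(6,8) k(2) by linarith
    show "j + 1 \<notin> U"
    proof
      assume "j + 1 \<in> U"
      then obtain k' where k': "k' \<in> {2..l + 1}" "j + 1 = int (u k') - 1" unfolding U_def by blast
      have "u k' = u k + 1" using k(2) k'(2) by linarith
      moreover have "k < k' \<Longrightarrow> u k + 2 \<le> u k'" "k' < k \<Longrightarrow> u k' + 2 \<le> u k"
        using gap[of k k'] gap[of k' k] k(1) k'(1) by auto
      ultimately show False by (cases k k' rule: linorder_cases) auto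
    qed
  qed
  obtain k0 where k0: "i = Suc k0" using assms(10) by (cases i) auto
  have tor: "tor_dim I i m =
    (if int m - int i = int d then ((i + d - 1) choose d) * ((n + d) choose (i + d)) else 0) +
    (n choose k0) * (vs.dim (?K (int m - int i)) - vs.dim (R.Ip (int m - int i)))" for m
    using R.tor_lefschetz[OF low high ann U, of k0 m] n
    unfolding tor_dim_def F_def[symmetric] k0 by (simp add: algebra_simps)
  have trivial: "vs.dim (?K j) - vs.dim (R.Ip j) = 0" if "j \<notin> U" for j
    using ann[of j] that by fastforce
  show ?thesis
  proof (intro conjI ballI allI impI)
    have "int d \<notin> U" using U[of "int d"] by auto
    then show "tor_dim I i (i + d) = ((d + i - 1) choose d) * ((n + d) choose (i + d))"
      unfolding tor using trivial[of "int d"] by (simp add: add.commute)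
  next
    fix k assume k: "k \<in> {2..l + 1}"
    have uk: "u k \<ge> d + 3" using u2[OF k] assms(6,8) by simp
    define a where "a = u k - 1"
    have a: "u k = a + 1" "a \<noteq> d" using uk by (auto simp: a_def)
    have "hilb I (a + 1) < hilb I a" using hilb_shape_strict_drop[OF shape k] unfolding a(1) by simp
    then have "tor_dim I i (i + (u k - 1)) = (n choose k0) * (hilb I a - hilb I (a + 1))"
      unfolding tor a(1) using dimK[of a] a(2) by simp
    moreover have "- delta_hilb I (u k) = int (hilb I a - hilb I (a + 1))"
      using \<open>hilb I (a + 1) < hilb I a\<close> unfolding a(1) delta_hilb_def by simp
    ultimately show "int (tor_dim I i (i + (u k - 1))) = - delta_hilb I (u k) * int (n choose (i - 1))"
      unfolding k0 by (simp add: mult.commute)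
  next
    fix m assume m: "m \<noteq> i + d \<and> (\<forall>k\<in>{2..l + 1}. m \<noteq> i + (u k - 1))"
    have "int m - int i \<notin> U"
    proof
      assume "int m - int i \<in> U"
      then obtain k where k: "k \<in> {2..l + 1}" "int m - int i = int (u k) - 1" unfolding U_def by blast
      have "u k \<ge> 1" using u2[OF k(1)] assms(8) by simp
      then have "m = i + (u k - 1)" using k(2) by linarith
      then show False using m k(1) by blast
    qed
    then show "tor_dim I i m = 0" unfolding tor using trivial m by simp
  qed
qed

end
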